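(* Fix a constant $0 \le \varepsilon \le 1/4$ and let $A, B \subseteq \{0,1,2\}^d$ be two sets of vectors such that every $\vec{v} \in A \cup B$ has exactly $\varepsilon d$ coordinates equal to $2$ and exactly $d/2$ coordinates equal to $1$. There exists a randomized algorithm that, if there is a pair $(\vec{a}, \vec{b}) \in A \times B$ with $\vec{a} - \vec{b} \in \{-1,0,1\}^d$, recovers such a pair with high probability, and runs in time $O\left(2^{c(\varepsilon) d}\cdot(|A| + |B|)\right)$, where $$c(\varepsilon) = (1-\varepsilon)\, H\!\left(\frac{\varepsilon}{1-\varepsilon}\right) + \left(\frac12 + \varepsilon\right) H\!\left(\frac{4\varepsilon}{1+2\varepsilon}\right) - H(2\varepsilon) + o(1).$$
   Context: $H$ denotes the binary entropy function $H(p) = -p\log_2 p - (1-p)\log_2(1-p)$. "With high probability" means the algorithm never outputs an incorrect pair and succeeds with probability that can be made arbitrarily close to $1$ (e.g. by polynomial repetition). *)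

theory Defs
  imports "HOL-Probability.Probability" "HOL-Library.Log_Nat"
begin

section \<open>A randomized random access machine with logarithmic cost\<close>

text \<open>
  Programs are finite structured commands over registers and a random access memory, both holding
  natural numbers.  The first argument of an arithmetic command, \<open>Load\<close> or \<open>Flip\<close> is the target
  register: \<open>Load r s\<close> sets register \<open>r\<close> to the memory cell whose address is in register \<open>s\<close>;
  \<open>Store r s\<close> writes register \<open>s\<close> to the memory cell whose address is in register \<open>r\<close>.
  Tests ask whether a register is nonzero.  \<open>Sub\<close> truncates at \<open>0\<close>, and division by \<open>0\<close> gives \<open>0\<close>.
\<close>

datatype com =
    Skip
  | Const nat nat
  | Add nat nat nat
  | Sub nat nat nat
  | Mult nat nat nat
  | Div nat nat nat
  | Load nat nat
  | Store nat nat
  | Flip nat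
  | Seq com com
  | If nat com com
  | While nat com

text \<open>The commands still to be executed, the registers, the memory and the time spent so far.\<close>

type_synonym config = "com list \<times> (nat \<Rightarrow> nat) \<times> (nat \<Rightarrow> nat) \<times> nat"

text \<open>
  The logarithmic cost criterion: a step costs one unit plus the bit lengths of the numbers
  (operands, addresses, contents) it handles, so that arithmetic on huge numbers is not free.
  \<open>floorlog 2 n\<close> is the number of binary digits of \<open>n\<close>, and is \<open>0\<close> for \<open>n = 0\<close>.
\<close>

abbreviation bits :: "nat \<Rightarrow> nat" where
  "bits n \<equiv> floorlog 2 n"

fun step :: "config \<Rightarrow> config pmf" where
  "step ([], R, M, t) = return_pmf ([], R, M, t)"
| "step (Skip # K, R, M, t) = return_pmf (K, R, M, t + 1)"
| "step (Const r n # K, R, M, t) = return_pmf (K, R(r := n), M, t + 1 + bits n)"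
| "step (Add r s u # K, R, M, t) =
     return_pmf (K, R(r := R s + R u), M, t + 1 + bits (R s) + bits (R u))"
| "step (Sub r s u # K, R, M, t) =
     return_pmf (K, R(r := R s - R u), M, t + 1 + bits (R s) + bits (R u))"
| "step (Mult r s u # K, R, M, t) =
     return_pmf (K, R(r := R s * R u), M, t + 1 + bits (R s) + bits (R u))"
| "step (Div r s u # K, R, M, t) =
     return_pmf (K, R(r := R s div R u), M, t + 1 + bits (R s) + bits (R u))"
| "step (Load r s # K, R, M, t) =
     return_pmf (K, R(r := M (R s)), M, t + 1 + bits (R s) + bits (M (R s)))"
| "step (Store r s # K, R, M, t) =
     return_pmf (K, R, M(R r := R s), t + 1 + bits (R r) + bits (R s))"
| "step (Flip r # K, R, M, t) =
     map_pmf (\<lambda>b. (K, R(r := of_bool b), M, t + 1)) (bernoulli_pmf (1/2))"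
| "step (Seq c1 c2 # K, R, M, t) = return_pmf (c1 # c2 # K, R, M, t + 1)"
| "step (If r c1 c2 # K, R, M, t) =
     return_pmf ((if R r \<noteq> 0 then c1 else c2) # K, R, M, t + 1 + bits (R r))"
| "step (While r c # K, R, M, t) =
     return_pmf (if R r \<noteq> 0 then c # While r c # K else K, R, M, t + 1 + bits (R r))"

primrec run :: "nat \<Rightarrow> config \<Rightarrow> config pmf" where
  "run 0 cf = return_pmf cf"
| "run (Suc n) cf = bind_pmf (step cf) (run n)"

definition initial :: "com \<Rightarrow> nat list \<Rightarrow> config" where
  "initial P w = ([P], \<lambda>_. 0, \<lambda>i. if i < length w then w ! i else 0, 0)"

text \<open>
  On input \<open>w\<close> the program \<open>P\<close> halts for all outcomes of its coin flips, and \<open>D\<close> is the joint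
  distribution of the final memory and the running time.  As \<open>step\<close> does not change halted
  configurations, \<open>D\<close> does not depend on \<open>n\<close>.
\<close>

definition halts_with :: "com \<Rightarrow> nat list \<Rightarrow> ((nat \<Rightarrow> nat) \<times> nat) pmf \<Rightarrow> bool" where
  "halts_with P w D \<longleftrightarrow>
     (\<exists>n. (\<forall>(K, R, M, t) \<in> set_pmf (run n (initial P w)). K = []) \<and>
          D = map_pmf (\<lambda>(K, R, M, t). (M, t)) (run n (initial P w)))"


section \<open>The problem\<close>

definition ternary_vectors :: "nat \<Rightarrow> nat list set" where
  "ternary_vectors d = {v. length v = d \<and> set v \<subseteq> {0, 1, 2}}"

text \<open>The condition \<open>a - b \<in> {-1, 0, 1}\<^sup>d\<close>; the subtraction must not be truncated.\<close>

definition compatible :: "nat \<Rightarrow> nat list \<Rightarrow> nat list \<Rightarrow> bool" where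
  "compatible d a b \<longleftrightarrow> (\<forall>i<d. int (a ! i) - int (b ! i) \<in> {-1, 0, 1})"

text \<open>
  The two sets are presented to the machine as lists: the memory initially holds \<open>d\<close>, the sizes of
  the two lists, and then the coordinates of all vectors, one coordinate per cell.
\<close>

definition encode :: "nat \<Rightarrow> nat list list \<Rightarrow> nat list list \<Rightarrow> nat list" where
  "encode d as bs = [d, length as, length bs] @ concat as @ concat bs"

text \<open>
  Cell \<open>0\<close> of the final memory tells whether a pair is reported; if so, its two vectors occupy the
  cells \<open>1, \<dots>, d\<close> and \<open>d + 1, \<dots>, 2 d\<close>.
\<close>

definition reported_pair :: "nat \<Rightarrow> (nat \<Rightarrow> nat) \<Rightarrow> (nat list \<times> nat list) option" where
  "reported_pair d M =
     (if M 0 = 0 then None else Some (map M [1..<d + 1], map M [d + 1..<2 * d + 1]))"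


section \<open>The exponent\<close>

text \<open>The usual convention \<open>0 log 0 = 0\<close> holds because \<open>log 2 0\<close> is multiplied by \<open>0\<close>.\<close>

definition binary_entropy :: "real \<Rightarrow> real" where
  "binary_entropy p = - p * log 2 p - (1 - p) * log 2 (1 - p)"

definition exponent :: "real \<Rightarrow> real" where
  "exponent \<epsilon> =
     (1 - \<epsilon>) * binary_entropy (\<epsilon> / (1 - \<epsilon>))
     + (1 / 2 + \<epsilon>) * binary_entropy (4 * \<epsilon> / (1 + 2 * \<epsilon>))
     - binary_entropy (2 * \<epsilon>)"

end

theory Submission
  imports Defs "HOL-Real_Asymp.Real_Asymp"
begin

text \<open>
A pair $(a, b)$ is compatible iff the twos of $a$ avoid the zeros of $b$ and vice versa. Split the coordinates
into about $d / k$ blocks of length $k \approx \log \log d$. Within a block, compatibility of $u$ and $v$ is witnessed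
by two sets, one containing the twos of $u$ and disjoint from the zeros of $v$, the other with the roles exchanged.
For every possible profile of digit counts there is a family of subsets of the block which contains such a witness
for each disjoint pair, while any single vector lies in few members; a random family would do, and conditional
expectations make the choice explicit. A choice of one member per block is a label, and the vectors of $A$ and $B$
sharing a label are compatible.

The program runs through the labels of each vector of $A$ and marks the memory cells addressed by them, then looks
up the labels of each vector of $B$. As a good system of families is only known to exist, the program tries all
codes $x$ of such systems, whose length is only polylogarithmic in $d$, and verifies every collision; hence
it is correct on every input and needs no coin flips. The number of labels per vector is a product over
the blocks of ratios of binomial coefficients. Vandermonde's identity bounds the numerators, and the pigeonhole
principle gives block profiles for which the denominators are as large as possible up to a factor $2^{o(d)}$; the
entropy estimates for binomial coefficients then yield the exponent.
\<close>

section \<open>Running time of register programs\<close>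

text \<open>Each summand of the exponent counts one choice. Let \<open>h = d / 2\<close> and let
  \<open>t\<close> be the number of twos of a vector. For a compatible pair, the twos of one vector
  and the zeros of the other leave \<open>h\<close> free coordinates, and the members used contain
  \<open>t\<close> elements besides the \<open>t\<close> twos. For a family over all coordinates, a
  vector would lie in about C(d - t, t) / C(h, t) members containing its twos and in about C(h + t,
  2t) / C(h, t) members avoiding its zeros. It needs one of each kind, so C(d - t, t) C(h + t, 2t) /
  C(h, t)^2 is the number of labels, and the three factors give the three entropies. An exhaustive
  search for a family over all coordinates would be far too expensive; blocks make it affordable, at
  the price of losing a small factor per block. Only one of the tables tried has to be good: a label
  begins with the code of its table, so that bad tables never touch the cells of a good one.\<close>

type_synonym cond = "(nat \<Rightarrow> nat) \<Rightarrow> (nat \<Rightarrow> nat) \<Rightarrow> nat \<Rightarrow> bool"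

text \<open>
An instruction costs at most $2\beta + 1$ as long as all values involved are below $2^\beta$, so it suffices to count
instructions; the last argument of a condition is this counter. Quantifying over the continuation $K$ makes
the rules compositional.
\<close>

definition wp :: "com \<Rightarrow> nat \<Rightarrow> cond \<Rightarrow> cond" where
  "wp c \<beta> Q R M n \<longleftrightarrow> (\<exists>R' M' n'. Q R' M' n' \<and> n \<le> n' \<and>
     (\<forall>K t. \<exists>m \<tau>. run m (c # K, R, M, t) = return_pmf (K, R', M', t + \<tau>) \<and>
        \<tau> \<le> (n' - n) * (2 * \<beta> + 1)))"

lemma run_add: "run (m + n) cf = bind_pmf (run m cf) (run n)"
proof (induction m arbitrary: cf)
  case (Suc m)
  have "run (m + n) = (\<lambda>cf. bind_pmf (run m cf) (run n))" by (rule_tac ext) (rule Suc)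
  then show ?case by (simp add: bind_assoc_pmf)
qed (simp add: bind_return_pmf)

lemma cost_add:
  fixes \<beta> :: nat
  assumes "a = Suc (b + c)" "s \<le> 2 * \<beta> + 1" "x \<le> b * (2 * \<beta> + 1)" "y \<le> c * (2 * \<beta> + 1)"
  shows "s + x + y \<le> a * (2 * \<beta> + 1)"
  unfolding assms(1) mult_Suc add_mult_distrib
  using add_mono[OF add_mono[OF assms(2,3)] assms(4)] by (simp only: add.assoc)

lemma bits_le: "x < 2 ^ \<beta> \<Longrightarrow> bits x \<le> \<beta>"
  by (simp add: floorlog_le_iff)

lemma wp_step:
  assumes "\<And>K t. \<exists>\<tau>. step (c # K, R, M, t) = return_pmf (K, R', M', t + \<tau>) \<and> \<tau> \<le> 2 * \<beta> + 1"
    and "Q R' M' (Suc n)"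
  shows "wp c \<beta> Q R M n"
proof -
  have "\<exists>m \<tau>. run m (c # K, R, M, t) = return_pmf (K, R', M', t + \<tau>) \<and>
        \<tau> \<le> (Suc n - n) * (2 * \<beta> + 1)" for K t
  proof -
    obtain \<tau> where "step (c # K, R, M, t) = return_pmf (K, R', M', t + \<tau>)" "\<tau> \<le> 2 * \<beta> + 1"
      using assms(1) by blast
    then show ?thesis by (intro exI[of _ 1] exI[of _ \<tau>]) (simp add: bind_return_pmf)
  qed
  then show ?thesis unfolding wp_def using assms(2) by (intro exI[of _ R'] exI[of _ M'] exI[of _ "Suc n"]) simp
qed

lemma wp_jump:
  assumes "\<And>K t. \<exists>\<tau>. step (c # K, R, M, t) = return_pmf (c' # K, R, M, t + \<tau>) \<and> \<tau> \<le> 2 * \<beta> + 1"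
    and "wp c' \<beta> Q R M (Suc n)"
  shows "wp c \<beta> Q R M n"
proof -
  obtain R' M' n' where Q: "Q R' M' n'" "Suc n \<le> n'" and
    ex: "\<And>K t. \<exists>m \<tau>. run m (c' # K, R, M, t) = return_pmf (K, R', M', t + \<tau>) \<and>
        \<tau> \<le> (n' - Suc n) * (2 * \<beta> + 1)"
    using assms(2) unfolding wp_def by blast
  have "\<exists>m \<tau>. run m (c # K, R, M, t) = return_pmf (K, R', M', t + \<tau>) \<and>
        \<tau> \<le> (n' - n) * (2 * \<beta> + 1)" for K t
  proof -
    obtain \<tau> where 1: "step (c # K, R, M, t) = return_pmf (c' # K, R, M, t + \<tau>)" "\<tau> \<le> 2 * \<beta> + 1"
      using assms(1) by blast
    obtain m \<tau>' where 2: "run m (c' # K, R, M, t + \<tau>) = return_pmf (K, R', M', t + \<tau> + \<tau>')"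
        "\<tau>' \<le> (n' - Suc n) * (2 * \<beta> + 1)"
      using ex by blast
    have "n' - n = Suc (n' - Suc n)" using Q(2) by simp
    then have "\<tau> + \<tau>' \<le> (n' - n) * (2 * \<beta> + 1)" using 1(2) 2(2) by simp
    then show ?thesis using 1(1) 2(1)
      by (intro exI[of _ "Suc m"] exI[of _ "\<tau> + \<tau>'"]) (simp add: bind_return_pmf add.assoc)
  qed
  moreover have "n \<le> n'" using Q(2) by simp
  ultimately show ?thesis unfolding wp_def using Q(1) by blast
qed

lemma wp_Seq:
  assumes "wp c1 \<beta> (wp c2 \<beta> Q) R M (Suc n)"
  shows "wp (Seq c1 c2) \<beta> Q R M n"
proof -
  obtain R1 M1 n1 where Q1: "wp c2 \<beta> Q R1 M1 n1" "Suc n \<le> n1" and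
    ex1: "\<And>K t. \<exists>m \<tau>. run m (c1 # K, R, M, t) = return_pmf (K, R1, M1, t + \<tau>) \<and>
        \<tau> \<le> (n1 - Suc n) * (2 * \<beta> + 1)"
    using assms(1) unfolding wp_def[of c1] by blast
  obtain R' M' n' where Q: "Q R' M' n'" "n1 \<le> n'" and
    ex2: "\<And>K t. \<exists>m \<tau>. run m (c2 # K, R1, M1, t) = return_pmf (K, R', M', t + \<tau>) \<and>
        \<tau> \<le> (n' - n1) * (2 * \<beta> + 1)"
    using Q1 unfolding wp_def by blast
  have "\<exists>m \<tau>. run m (Seq c1 c2 # K, R, M, t) = return_pmf (K, R', M', t + \<tau>) \<and>
        \<tau> \<le> (n' - n) * (2 * \<beta> + 1)" for K t
  proof -
    obtain m1 \<tau>1 where 1: "run m1 (c1 # c2 # K, R, M, t + 1) = return_pmf (c2 # K, R1, M1, t + 1 + \<tau>1)"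
        "\<tau>1 \<le> (n1 - Suc n) * (2 * \<beta> + 1)"
      using ex1 by blast
    obtain m2 \<tau>2 where 2: "run m2 (c2 # K, R1, M1, t + 1 + \<tau>1) = return_pmf (K, R', M', t + 1 + \<tau>1 + \<tau>2)"
        "\<tau>2 \<le> (n' - n1) * (2 * \<beta> + 1)"
      using ex2 by blast
    have "n' - n = Suc ((n1 - Suc n) + (n' - n1))" using Q(2) Q1(2) by simp
    then have "1 + \<tau>1 + \<tau>2 \<le> (n' - n) * (2 * \<beta> + 1)" by (rule cost_add[OF _ _ 1(2) 2(2)]) auto
    moreover have "run (Suc (m1 + m2)) (Seq c1 c2 # K, R, M, t) = return_pmf (K, R', M', t + (1 + \<tau>1 + \<tau>2))"
      using 1(1) 2(1) by (simp add: bind_return_pmf run_add add.assoc del: add_Suc_right add_Suc)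
    ultimately show ?thesis by blast
  qed
  moreover have "n \<le> n'" using Q(2) Q1(2) by simp
  ultimately show ?thesis unfolding wp_def using Q(1) by blast
qed

lemma wp_mono:
  assumes "wp c \<beta> Q R M n" "\<And>R M n. Q R M n \<Longrightarrow> Q' R M n"
  shows "wp c \<beta> Q' R M n"
  using assms unfolding wp_def by metis

text \<open>
Straight-line code is evaluated symbolically; loops are left to the invariant rule for \<open>wp\<close>.
\<close>

primrec vc :: "com \<Rightarrow> nat \<Rightarrow> cond \<Rightarrow> cond" where
  "vc Skip \<beta> Q R M n \<longleftrightarrow> Q R M (Suc n)"
| "vc (Const r v) \<beta> Q R M n \<longleftrightarrow> v < 2 ^ \<beta> \<and> Q (R(r := v)) M (Suc n)"
| "vc (Add r a b) \<beta> Q R M n \<longleftrightarrow> R a < 2 ^ \<beta> \<and> R b < 2 ^ \<beta> \<and> Q (R(r := R a + R b)) M (Suc n)"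
| "vc (Sub r a b) \<beta> Q R M n \<longleftrightarrow> R a < 2 ^ \<beta> \<and> R b < 2 ^ \<beta> \<and> Q (R(r := R a - R b)) M (Suc n)"
| "vc (Mult r a b) \<beta> Q R M n \<longleftrightarrow> R a < 2 ^ \<beta> \<and> R b < 2 ^ \<beta> \<and> Q (R(r := R a * R b)) M (Suc n)"
| "vc (Div r a b) \<beta> Q R M n \<longleftrightarrow> R a < 2 ^ \<beta> \<and> R b < 2 ^ \<beta> \<and> Q (R(r := R a div R b)) M (Suc n)"
| "vc (Load r a) \<beta> Q R M n \<longleftrightarrow> R a < 2 ^ \<beta> \<and> M (R a) < 2 ^ \<beta> \<and> Q (R(r := M (R a))) M (Suc n)"
| "vc (Store r a) \<beta> Q R M n \<longleftrightarrow> R r < 2 ^ \<beta> \<and> R a < 2 ^ \<beta> \<and> Q R (M(R r := R a)) (Suc n)"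
| "vc (Flip r) \<beta> Q R M n \<longleftrightarrow> False"
| "vc (Seq c1 c2) \<beta> Q R M n \<longleftrightarrow> vc c1 \<beta> (vc c2 \<beta> Q) R M (Suc n)"
| "vc (If r c1 c2) \<beta> Q R M n \<longleftrightarrow> R r < 2 ^ \<beta> \<and> (R r \<noteq> 0 \<longrightarrow> vc c1 \<beta> Q R M (Suc n)) \<and>
     (R r = 0 \<longrightarrow> vc c2 \<beta> Q R M (Suc n))"
| "vc (While r c) \<beta> Q R M n \<longleftrightarrow> wp (While r c) \<beta> Q R M n"

text \<open>\<open>wp\<close> speaks of runs that end in a point mass, so a coin flip can only be
  rejected: the condition of \<open>Flip\<close> is \<open>False\<close>. The loop case is trivial
  because \<open>vc\<close> hands loops over to \<open>wp\<close>, where \<open>wp_While\<close>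
  supplies the invariant.\<close>

lemma vc_sound: "vc c \<beta> Q R M n \<Longrightarrow> wp c \<beta> Q R M n"
proof (induction c arbitrary: Q R M n)
  case Skip
  then have v: "Q R M (Suc n)" by simp
  show ?case by (rule wp_step[where Q = Q and R' = R and M' = M, OF _ v], rule exI[of _ 1]) simp
next
  case (Const r v)
  then have v: "v < 2 ^ \<beta>" "Q (R(r := v)) M (Suc n)" by simp_all
  show ?case
    by (rule wp_step[where Q = Q and R' = "R(r := v)" and M' = M, OF _ v(2)], rule exI[of _ "1 + bits v"]) (use bits_le[OF v(1)] in simp)
next
  case (Add r a b)
  then have v: "R a < 2 ^ \<beta>" "R b < 2 ^ \<beta>" "Q (R(r := R a + R b)) M (Suc n)" by simp_all
  show ?case
    by (rule wp_step[where Q = Q and R' = "R(r := R a + R b)" and M' = M, OF _ v(3)], rule exI[of _ "1 + bits (R a) + bits (R b)"]) (use bits_le[OF v(1)] bits_le[OF v(2)] in simp)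
next
  case (Sub r a b)
  then have v: "R a < 2 ^ \<beta>" "R b < 2 ^ \<beta>" "Q (R(r := R a - R b)) M (Suc n)" by simp_all
  show ?case
    by (rule wp_step[where Q = Q and R' = "R(r := R a - R b)" and M' = M, OF _ v(3)], rule exI[of _ "1 + bits (R a) + bits (R b)"]) (use bits_le[OF v(1)] bits_le[OF v(2)] in simp)
next
  case (Mult r a b)
  then have v: "R a < 2 ^ \<beta>" "R b < 2 ^ \<beta>" "Q (R(r := R a * R b)) M (Suc n)" by simp_all
  show ?case
    by (rule wp_step[where Q = Q and R' = "R(r := R a * R b)" and M' = M, OF _ v(3)], rule exI[of _ "1 + bits (R a) + bits (R b)"]) (use bits_le[OF v(1)] bits_le[OF v(2)] in simp)
next
  case (Div r a b)
  then have v: "R a < 2 ^ \<beta>" "R b < 2 ^ \<beta>" "Q (R(r := R a div R b)) M (Suc n)" by simp_all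
  show ?case
    by (rule wp_step[where Q = Q and R' = "R(r := R a div R b)" and M' = M, OF _ v(3)], rule exI[of _ "1 + bits (R a) + bits (R b)"]) (use bits_le[OF v(1)] bits_le[OF v(2)] in simp)
next
  case (Load r a)
  then have v: "R a < 2 ^ \<beta>" "M (R a) < 2 ^ \<beta>" "Q (R(r := M (R a))) M (Suc n)" by simp_all
  show ?case
    by (rule wp_step[where Q = Q and R' = "R(r := M (R a))" and M' = M, OF _ v(3)], rule exI[of _ "1 + bits (R a) + bits (M (R a))"]) (use bits_le[OF v(1)] bits_le[OF v(2)] in simp)
next
  case (Store r a)
  then have v: "R r < 2 ^ \<beta>" "R a < 2 ^ \<beta>" "Q R (M(R r := R a)) (Suc n)" by simp_all
  show ?case
    by (rule wp_step[where Q = Q and R' = R and M' = "M(R r := R a)", OF _ v(3)], rule exI[of _ "1 + bits (R r) + bits (R a)"]) (use bits_le[OF v(1)] bits_le[OF v(2)] in simp)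
next
  case (Seq c1 c2)
  have "wp c1 \<beta> (vc c2 \<beta> Q) R M (Suc n)" using Seq by simp
  then have "wp c1 \<beta> (wp c2 \<beta> Q) R M (Suc n)" by (rule wp_mono) (rule Seq.IH(2))
  then show ?case by (rule wp_Seq)
next
  case (If r c1 c2)
  then have w: "wp (if R r \<noteq> 0 then c1 else c2) \<beta> Q R M (Suc n)" and r: "R r < 2 ^ \<beta>" by simp_all
  show ?case
    by (rule wp_jump[OF _ w], rule exI[of _ "1 + bits (R r)"]) (use bits_le[OF r] in simp)
next
  case (While r c)
  then show ?case by simp
next
  case (Flip r)
  then show ?case by simp
qed

lemma wp_While_unfold:
  assumes "R r < 2 ^ \<beta>"
    and "R r = 0 \<Longrightarrow> Q R M (Suc n)"
    and "R r \<noteq> 0 \<Longrightarrow> wp c \<beta> (wp (While r c) \<beta> Q) R M (Suc n)"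
  shows "wp (While r c) \<beta> Q R M n"
proof (cases "R r = 0")
  case True
  then have q: "Q R M (Suc n)" by (rule assms(2))
  have "bits 0 = 0" by (simp add: floorlog_def)
  then show ?thesis
    by (rule_tac wp_step[where Q = Q and R' = R and M' = M, OF _ q], rule_tac exI[of _ 1]) (simp add: True)
next
  case False
  obtain R1 M1 n1 where Q1: "wp (While r c) \<beta> Q R1 M1 n1" "Suc n \<le> n1" and
    ex1: "\<And>K t. \<exists>m \<tau>. run m (c # K, R, M, t) = return_pmf (K, R1, M1, t + \<tau>) \<and>
        \<tau> \<le> (n1 - Suc n) * (2 * \<beta> + 1)"
    using assms(3)[OF False] unfolding wp_def[of c] by blast
  obtain R' M' n' where Q: "Q R' M' n'" "n1 \<le> n'" and
    ex2: "\<And>K t. \<exists>m \<tau>. run m (While r c # K, R1, M1, t) = return_pmf (K, R', M', t + \<tau>) \<and>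
        \<tau> \<le> (n' - n1) * (2 * \<beta> + 1)"
    using Q1 unfolding wp_def by blast
  have "\<exists>m \<tau>. run m (While r c # K, R, M, t) = return_pmf (K, R', M', t + \<tau>) \<and>
        \<tau> \<le> (n' - n) * (2 * \<beta> + 1)" for K t
  proof -
    let ?s = "1 + bits (R r)"
    obtain m1 \<tau>1 where 1: "run m1 (c # While r c # K, R, M, t + ?s) = return_pmf (While r c # K, R1, M1, t + ?s + \<tau>1)"
        "\<tau>1 \<le> (n1 - Suc n) * (2 * \<beta> + 1)"
      using ex1 by blast
    obtain m2 \<tau>2 where 2: "run m2 (While r c # K, R1, M1, t + ?s + \<tau>1) = return_pmf (K, R', M', t + ?s + \<tau>1 + \<tau>2)"
        "\<tau>2 \<le> (n' - n1) * (2 * \<beta> + 1)"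
      using ex2 by blast
    have "n' - n = Suc ((n1 - Suc n) + (n' - n1))" using Q(2) Q1(2) by simp
    then have "?s + \<tau>1 + \<tau>2 \<le> (n' - n) * (2 * \<beta> + 1)" by (rule cost_add[OF _ _ 1(2) 2(2)]) (use bits_le[OF assms(1)] in auto)
    moreover have "run (Suc (m1 + m2)) (While r c # K, R, M, t) = return_pmf (K, R', M', t + (?s + \<tau>1 + \<tau>2))"
      using 1(1) 2(1) False by (simp add: bind_return_pmf run_add add.assoc)
    ultimately show ?thesis by blast
  qed
  moreover have "n \<le> n'" using Q(2) Q1(2) by simp
  ultimately show ?thesis unfolding wp_def using Q(1) by blast
qed

text \<open>The tested register is its own termination measure, as every loop of the program lowers
  it strictly. Time needs no separate argument: the invariant relates the counter \<open>n\<close>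
  to the register.\<close>

lemma wp_While:
  assumes "I R M n"
    and "\<And>R M n. I R M n \<Longrightarrow> R r < 2 ^ \<beta>"
    and "\<And>R M n. I R M n \<Longrightarrow> R r = 0 \<Longrightarrow> Q R M (Suc n)"
    and "\<And>R M n. I R M n \<Longrightarrow> R r \<noteq> 0 \<Longrightarrow>
      vc c \<beta> (\<lambda>R' M' n'. I R' M' n' \<and> R' r < R r) R M (Suc n)"
  shows "wp (While r c) \<beta> Q R M n"
  using assms(1)
proof (induction "R r" arbitrary: R M n rule: less_induct)
  case less
  show ?case
  proof (rule wp_While_unfold)
    show "R r < 2 ^ \<beta>" "R r = 0 \<Longrightarrow> Q R M (Suc n)" using assms(2,3) less.prems by auto
    assume "R r \<noteq> 0"
    from vc_sound[OF assms(4)[OF less.prems this]]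
    show "wp c \<beta> (wp (While r c) \<beta> Q) R M (Suc n)"
      by (rule wp_mono) (auto intro: less.hyps)
  qed
qed

primrec block :: "com list \<Rightarrow> com" where
  "block [] = Skip"
| "block (c # cs) = Seq c (block cs)"

section \<open>The search program\<close>

definition pow_com :: "nat \<Rightarrow> nat \<Rightarrow> nat \<Rightarrow> com" where
  "pow_com r s e = block [Const r 1, While e (block [Mult r r s, Sub e e 1])]"

text \<open>Multiplication is charged for its operands, so intermediate powers have to stay below
  the bound as well. For base 0 the power \<open>0 ^ 0 = 1\<close> may exceed \<open>a ^ n\<close>,
  whence \<open>1 < B\<close>.\<close>

lemma power_partial_less:
  fixes a :: nat
  assumes "a ^ n < B" "i \<le> n" "1 < B"
  shows "a ^ i < B"
proof (cases "a = 0")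
  case True
  then show ?thesis using assms by (cases i) auto
next
  case False
  then have "a ^ i \<le> a ^ n" using assms by (intro power_increasing) auto
  then show ?thesis using assms by simp
qed

text \<open>A pass costs six: the test, two \<open>Seq\<close>, the two instructions and the closing
  \<open>Skip\<close>. The time bounds of the later loops arise in the same way, rounded up.\<close>

lemma vc_pow_com:
  assumes regs: "r \<noteq> s" "r \<noteq> e" "s \<noteq> e" "r \<noteq> 1" "e \<noteq> 1" and one: "R 1 = 1" "1 < (2::nat) ^ \<beta>"
    and bnd: "R s < 2 ^ \<beta>" "R e < 2 ^ \<beta>" "R s ^ R e < 2 ^ \<beta>"
    and Q: "\<And>n'. n' \<le> n + 6 * R e + 6 \<Longrightarrow> Q (R(r := R s ^ R e, e := 0)) M n'"
  shows "vc (pow_com r s e) \<beta> Q R M n"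
proof -
  define I where "I = (\<lambda>R' M' n'. M' = M \<and> R' e \<le> R e \<and> R' = R(r := R s ^ (R e - R' e), e := R' e)
    \<and> n' + 6 * R' e \<le> n + 6 * R e + 3)"
  have "wp (While e (block [Mult r r s, Sub e e 1])) \<beta> (vc Skip \<beta> Q) (R(r := 1)) M (Suc (Suc (Suc n)))"
  proof (rule wp_While[where I = I])
    show "I (R(r := 1)) M (Suc (Suc (Suc n)))"
      using regs by (auto simp: I_def)
  next
    fix R' M' n' assume "I R' M' n'"
    then show "R' e < 2 ^ \<beta>" using bnd by (auto simp: I_def)
  next
    fix R' M' n' assume I: "I R' M' n'" and "R' e = 0"
    then have "R' = R(r := R s ^ R e, e := 0)" "M' = M" "n' + 2 \<le> n + 6 * R e + 6"
      by (auto simp: I_def)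
    then show "vc Skip \<beta> Q R' M' (Suc n')" using Q[of "n' + 2"] by simp
  next
    fix R' M' n' assume I: "I R' M' n'" and nz: "R' e \<noteq> 0"
    define i where "i = R' e"
    have i: "0 < i" "i \<le> R e" and R': "R' = R(r := R s ^ (R e - i), e := i)" and M': "M' = M"
      and n': "n' + 6 * i \<le> n + 6 * R e + 3"
      using I nz unfolding I_def i_def by auto
    have "R s ^ (R e - i) < 2 ^ \<beta>" by (rule power_partial_less[OF bnd(3)]) (use one in auto)
    moreover have "R e - (i - Suc 0) = Suc (R e - i)" using i by simp
    ultimately show "vc (block [Mult r r s, Sub e e 1]) \<beta> (\<lambda>R'' M'' n''. I R'' M'' n'' \<and> R'' e < R' e) R' M' (Suc n')"
      using regs one bnd i n' unfolding R' M' I_def by (auto simp: fun_eq_iff)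
  qed
  then show ?thesis using one by (simp add: pow_com_def)
qed

section \<open>Reading tables and computing labels\<close>

definition digit :: "nat \<Rightarrow> nat \<Rightarrow> nat \<Rightarrow> nat" where
  "digit D x i = x div D ^ i mod D"

text \<open>
The number $x$ is read as a table in base $D$. For role $\rho$ (0 for $A$, 1 for $B$), block content $y < b$ and profile
code $s < S$, its entries are the codes of the members available to $y$; the row $y = b$, which is no block content,
stores at column 0 the number of members to be enumerated, minus one. The mixed-radix number $w$ chooses a
profile and a member for each block.
\<close>

primrec label :: "nat \<Rightarrow> nat \<Rightarrow> nat \<Rightarrow> nat \<Rightarrow> nat \<Rightarrow> nat \<Rightarrow> nat \<Rightarrow> nat \<Rightarrow> nat \<Rightarrow> nat" where
  "label b S D x \<rho> 0 w u L = L"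
| "label b S D x \<rho> (Suc j) w u L =
     (let s = w mod S;
          w1 = w div S;
          r = digit D x (((\<rho> * D + b) * D + s) * D) + 1;
          i = w1 mod r;
          e = digit D x (((\<rho> * D + u mod b) * D + s) * D + i)
      in label b S D x \<rho> j (w1 div r) (u div b) (L * D + e))"

text \<open>The input is \<open>x\<close> in register 24 and the position in register 30, the output
  is register 31. There is no remainder instruction; remainders are always formed as
  \<open>a - a div b * b\<close>.\<close>

definition digit_com :: com where
  "digit_com = block [pow_com 32 8 30, Div 31 24 32, Div 32 31 8, Mult 32 32 8, Sub 31 31 32]"

text \<open>Registers 23, 26 and 25 play the roles of \<open>w\<close>, \<open>u\<close> and
  \<open>L\<close> in \<open>label\<close>; 28, 29, 34 and 35 receive the profile code, the radix,
  the block content and the member index.\<close>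

definition label_body :: com where
  "label_body = block [Sub 27 27 1,
     Div 33 23 10, Mult 32 33 10, Sub 28 23 32, Add 23 33 0,
     Mult 30 19 8, Add 30 30 6, Mult 30 30 8, Add 30 30 28, Mult 30 30 8,
     digit_com,
     Add 29 31 1, Div 33 23 29, Mult 32 33 29, Sub 35 23 32, Add 23 33 0,
     Div 33 26 6, Mult 32 33 6, Sub 34 26 32, Add 26 33 0,
     Mult 30 19 8, Add 30 30 34, Mult 30 30 8, Add 30 30 28, Mult 30 30 8, Add 30 30 35,
     digit_com,
     Mult 25 25 8, Add 25 25 31]"

text \<open>The visit number in register 22 has the code \<open>x\<close> as its last digit in base
  \<open>X\<close>; the rest chooses profiles and members. Taking \<open>x\<close> also as the
  initial label makes it the leading part of the address, which keeps the cells of different tables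
  apart.\<close>

definition label_com :: com where
  "label_com = block [Div 33 22 9, Mult 32 33 9, Sub 24 22 32, Add 23 33 0, Add 25 24 0,
     Add 26 20 0, Add 27 7 0, While 27 label_body]"

text \<open>A label is a code below \<open>X\<close> followed by \<open>q\<close> digits in base
  \<open>D\<close>, hence \<open>off + X * D ^ q\<close> exceeds all addresses. The bound
  \<open>3 ^ (d + 1)\<close> leaves room for one more multiplication by 3 while a vector is
  read.\<close>

locale search_params =
  fixes d off b q D X S Wc h \<beta> :: nat
  assumes b: "0 < b" "b < D" and S: "0 < S" "S \<le> D" and X: "X = D ^ (2 * D ^ 3)"
    and big: "off + X * D ^ q < 2 ^ \<beta>" "3 ^ (d + 1) < (2::nat) ^ \<beta>" "3 \<le> off" "q < 2 ^ \<beta>"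
begin

text \<open>
Registers 0 to 12 hold parameters. Registers 13 and 14 count the remaining vectors of $A$ and of both sets, 15 is the
read pointer, 16 the success flag and 17, 18 the pair found; 19 holds the role, 20 the ternary value and
21 the number of twos of the current vector, and 22 counts down its labels. The others are scratch registers.
\<close>

definition fixed_regs :: "(nat \<Rightarrow> nat) \<Rightarrow> bool" where
  "fixed_regs R \<longleftrightarrow> R 0 = 0 \<and> R 1 = 1 \<and> R 2 = 2 \<and> R 3 = 3 \<and> R 4 = d \<and> R 5 = off \<and> R 6 = b \<and> R 7 = q \<and>
     R 8 = D \<and> R 9 = X \<and> R 10 = S \<and> R 11 = Wc \<and> R 12 = h"

lemma fixed_cong: "\<forall>r<23. R' r = R r \<Longrightarrow> fixed_regs R \<Longrightarrow> fixed_regs R'"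
  by (simp add: fixed_regs_def)

lemma D2: "2 \<le> D" using b by simp

lemma X_ge: "2 * D ^ 3 < X"
  unfolding X using D2 by (intro less_exp[THEN less_le_trans] power_mono) auto

lemma X_less: "X < 2 ^ \<beta>"
proof -
  have "X \<le> X * D ^ q" using D2 by simp
  then show ?thesis using big(1) by linarith
qed

lemma one_less: "1 < (2::nat) ^ \<beta>" "2 < (2::nat) ^ \<beta>" "3 < (2::nat) ^ \<beta>"
  using X_ge X_less big by auto

lemma D_less: "D < 2 ^ \<beta>" and D3: "D \<le> 2 * D ^ 3"
proof -
  show "D \<le> 2 * D ^ 3" using D2 self_le_power[of D 3] by linarith
  then show "D < 2 ^ \<beta>" using X_ge X_less by linarith
qed

lemma index_bound:
  assumes "\<rho> \<le> 1" "y \<le> b" "s < S" "i < D"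
  shows "((\<rho> * D + y) * D + s) * D + i < 2 * D ^ 3"
proof -
  have 1: "\<rho> * D + y < 2 * D" using assms b by (cases \<rho>) auto
  have "(\<rho> * D + y) * D + s < (\<rho> * D + y + 1) * D" using assms S by simp
  also have "\<dots> \<le> 2 * D * D" using 1 by (intro mult_le_mono1) simp
  finally have 2: "(\<rho> * D + y) * D + s + 1 \<le> 2 * D * D" by simp
  have "((\<rho> * D + y) * D + s) * D + i < ((\<rho> * D + y) * D + s + 1) * D" using assms by simp
  also have "\<dots> \<le> 2 * D * D * D" using 2 by (rule mult_le_mono1)
  finally show ?thesis by (simp add: power3_eq_cube)
qed

lemma index_less:
  assumes "\<rho> \<le> 1" "y \<le> b" "s < S" "i < D"
  shows "\<rho> * D < 2 ^ \<beta>" "\<rho> * D + y < 2 ^ \<beta>" "(\<rho> * D + y) * D < 2 ^ \<beta>" "(\<rho> * D + y) * D + s < 2 ^ \<beta>"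
    "((\<rho> * D + y) * D + s) * D < 2 ^ \<beta>" "((\<rho> * D + y) * D + s) * D + i < 2 ^ \<beta>"
proof -
  have m: "u \<le> u * D" for u using D2 by (cases D) auto
  let ?a = "\<rho> * D" let ?b = "\<rho> * D + y" let ?c = "(\<rho> * D + y) * D" let ?d = "(\<rho> * D + y) * D + s"
  have "?a \<le> ?b" "?b \<le> ?c" "?c \<le> ?d" "?d \<le> ?d * D" "?d * D \<le> ?d * D + i" "?d * D + i < 2 ^ \<beta>"
    using m index_bound[OF assms] X_ge X_less by auto
  then show "?a < 2 ^ \<beta>" "?b < 2 ^ \<beta>" "?c < 2 ^ \<beta>" "?d < 2 ^ \<beta>" "?d * D < 2 ^ \<beta>" "?d * D + i < 2 ^ \<beta>"
    by linarith+
qed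

lemma digit_less: "digit D x i < D" using D2 by (simp add: digit_def)

lemma vc_digit_com:
  assumes c: "R 1 = 1" "R 8 = D" and i: "R 30 < 2 * D ^ 3" and x: "R 24 < 2 ^ \<beta>"
    and Q: "\<And>n' R'. n' \<le> n + 12 * D ^ 3 + 20 \<Longrightarrow> R' 31 = digit D (R 24) (R 30) \<Longrightarrow>
      (\<And>r. r \<noteq> 30 \<Longrightarrow> r \<noteq> 31 \<Longrightarrow> r \<noteq> 32 \<Longrightarrow> R' r = R r) \<Longrightarrow> Q R' M n'"
  shows "vc digit_com \<beta> Q R M n"
proof -
  have p: "D ^ R 30 < 2 ^ \<beta>"
  proof -
    have "D ^ R 30 \<le> X" unfolding X using i D2 by (intro power_increasing) auto
    then show ?thesis using X_less by simp
  qed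
  have i2: "R 30 < 2 ^ \<beta>" using i X_ge X_less by linarith
  have x2: "R 24 div D ^ R 30 < 2 ^ \<beta>" "R 24 div D ^ R 30 div D < 2 ^ \<beta>"
     "R 24 div D ^ R 30 div D * D < 2 ^ \<beta>"
    using x by (meson div_le_dividend div_times_less_eq_dividend le_less_trans)+
  show ?thesis
    unfolding digit_com_def block.simps vc.simps
  proof (rule vc_pow_com, goal_cases)
    case (11 n')
    have "R 30 \<le> 2 * D ^ 3" using i by simp
    then have n': "n' \<le> Suc n + 12 * D ^ 3 + 6" using 11 by simp
    show ?case using c one_less D_less x x2 n' p
      by (simp, intro Q) (auto simp: digit_def minus_div_mult_eq_mod)
  qed (use c one_less D_less i2 p in simp_all)
qed

definition label_cost :: nat where "label_cost = 24 * D ^ 3 + 150"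

text \<open>The postcondition does not describe the new registers one by one. It says that the
  remaining recursion of \<open>label\<close> still has the same value, which is the invariant of
  the enclosing loop.\<close>

lemma vc_label_body:
  assumes f: "fixed_regs R" and role: "R 19 \<le> 1" and x: "R 24 < X" and j: "R 27 = Suc j"
    and bnd: "R 23 < 2 ^ \<beta>" "R 26 < 2 ^ \<beta>" "R 25 * D + D \<le> X * D ^ q" "R 27 < 2 ^ \<beta>"
    and Q: "\<And>n' R'. n' \<le> n + label_cost \<Longrightarrow> (\<And>r. r < 23 \<or> r = 24 \<Longrightarrow> R' r = R r) \<Longrightarrow>
      R' 27 = j \<Longrightarrow> R' 23 \<le> R 23 \<Longrightarrow> R' 26 \<le> R 26 \<Longrightarrow> R' 25 < R 25 * D + D \<Longrightarrow>
      label b S D (R 24) (R 19) j (R' 23) (R' 26) (R' 25) = label b S D (R 24) (R 19) (Suc j) (R 23) (R 26) (R 25) \<Longrightarrow> Q R' M n'"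
  shows "vc label_body \<beta> Q R M n"
proof -
  define \<rho> where "\<rho> = R 19"
  define s where "s = R 23 mod S"
  define w where "w = R 23 div S"
  define r where "r = digit D (R 24) (((\<rho> * D + b) * D + s) * D) + 1"
  define i where "i = w mod r"
  define y where "y = R 26 mod b"
  define e where "e = digit D (R 24) (((\<rho> * D + y) * D + s) * D + i)"
  have S_less: "S < 2 ^ \<beta>" and b_less: "b < 2 ^ \<beta>" using S b D_less by auto
  have x_less: "R 24 < 2 ^ \<beta>" using x X_less by simp
  have s: "s < S" and y: "y < b" using S b by (auto simp: s_def y_def)
  have s_less: "s < 2 ^ \<beta>" and y_less: "y < 2 ^ \<beta>" using s y S_less b_less by auto
  have rD: "r \<le> D" "0 < r" "r < 2 ^ \<beta>" using digit_less[of "R 24" "((\<rho> * D + b) * D + s) * D"] D_less by (auto simp: r_def)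
  have i: "i < D" "i < 2 ^ \<beta>" using rD mod_less_divisor[of r w] D_less unfolding i_def by linarith+
  have e: "e < D" "e < 2 ^ \<beta>" using digit_less D_less less_trans unfolding e_def by blast+
  have w: "w < 2 ^ \<beta>" "w * S < 2 ^ \<beta>" "w div r < 2 ^ \<beta>" "w div r * r < 2 ^ \<beta>" "w div r \<le> R 23"
    using bnd(1) unfolding w_def
    by (meson div_le_dividend div_times_less_eq_dividend le_less_trans le_trans)+
  have u: "R 26 div b < 2 ^ \<beta>" "R 26 div b * b < 2 ^ \<beta>"
    using bnd(2) by (meson div_le_dividend div_times_less_eq_dividend le_less_trans)+
  have role': "\<rho> \<le> 1" "\<rho> < 2 ^ \<beta>" using role one_less by (auto simp: \<rho>_def)
  have i1: "((\<rho> * D + b) * D + s) * D + 0 < 2 * D ^ 3" by (rule index_bound) (use role' s D2 in auto)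
  have i2: "((\<rho> * D + y) * D + s) * D + i < 2 * D ^ 3" by (rule index_bound) (use role' s y i in auto)
  have D0: "0 < D" using D2 by simp
  note l1 = index_less[OF role'(1) order.refl s D0]
  have sub: "R 23 - w * S = s" "w - w div r * r = i" "R 26 - R 26 div b * b = y"
    by (simp_all add: minus_div_mult_eq_mod w_def s_def i_def y_def)
  note l2 = index_less[OF role'(1) less_imp_le[OF y] s i(1)]
  have "R 25 \<le> R 25 * D" using D2 by (cases D) auto
  then have L: "R 25 < 2 ^ \<beta>" "R 25 * D < 2 ^ \<beta>"
    using bnd(3) big(1) by linarith+
  have rr: "Suc (digit D (R 24) (((\<rho> * D + b) * D + s) * D)) = r" by (simp add: r_def)
  have dl: "digit D z k < 2 ^ \<beta>" for z k using digit_less D_less less_trans by blast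
  note bounds = dl one_less one_less[simplified] D_less S_less b_less x_less s_less y_less rD i e w u role' l1 l2 L bnd
  show ?thesis
    using f unfolding fixed_regs_def label_body_def block.simps
    apply (simp add: bounds sub flip: \<rho>_def w_def)
    apply (rule vc_digit_com)
        apply simp_all[2]
      apply (use i1 in simp)
     apply (simp add: x_less)
    apply (simp add: bounds sub rr flip: \<rho>_def w_def)
    apply (rule vc_digit_com)
        apply simp_all[2]
      apply (use i2 in simp)
     apply (simp add: x_less)
    apply (simp add: bounds sub rr flip: \<rho>_def w_def e_def)
    apply (rule Q)
          apply (simp add: label_cost_def)
         apply auto[1]
        apply (simp add: j)
       apply (simp add: w)
      apply simp
     apply (simp add: e)
    apply (simp add: Let_def \<rho>_def s_def w_def i_def y_def e_def r_def)
    done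
qed

lemma vc_label_com:
  assumes f: "fixed_regs R" and role: "R 19 \<le> 1"
    and bnd: "R 22 < 2 ^ \<beta>" "R 20 < 2 ^ \<beta>"
    and Q: "\<And>n' R'. n' \<le> n + q * (label_cost + 1) + 20 \<Longrightarrow> (\<And>r. r < 23 \<Longrightarrow> R' r = R r) \<Longrightarrow>
      R' 25 = label b S D (R 22 mod X) (R 19) q (R 22 div X) (R 20) (R 22 mod X) \<Longrightarrow>
      R' 25 < X * D ^ q \<Longrightarrow> Q R' M n'"
  shows "vc label_com \<beta> Q R M n"
proof -
  define A where "A = label b S D (R 22 mod X) (R 19) q (R 22 div X) (R 20) (R 22 mod X)"
  have X0: "0 < X" using X_ge by simp
  define I where "I = (\<lambda>R' M' n'. M' = M \<and> (\<forall>r<23. R' r = R r) \<and> R' 24 = R 22 mod X \<and> R' 27 \<le> q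
    \<and> label b S D (R 22 mod X) (R 19) (R' 27) (R' 23) (R' 26) (R' 25) = A
    \<and> R' 25 + 1 \<le> X * D ^ (q - R' 27) \<and> R' 23 < 2 ^ \<beta> \<and> R' 26 < 2 ^ \<beta>
    \<and> n' + R' 27 * (label_cost + 1) \<le> n + q * (label_cost + 1) + 17)"
  have loop: "wp (While 27 label_body) \<beta> (vc Skip \<beta> Q) R0 M n0" if I0: "I R0 M n0" for R0 n0
  proof (rule wp_While[where I = I])
    show "I R0 M n0" by fact
  next
    fix R' M' n' assume "I R' M' n'"
    then show "R' 27 < 2 ^ \<beta>" using big(4) by (auto simp: I_def)
  next
    fix R' M' n' assume "I R' M' n'" "R' 27 = 0"
    then have *: "M' = M" "\<And>r. r < 23 \<Longrightarrow> R' r = R r" "R' 25 = A" "R' 25 < X * D ^ q" "n' + 2 \<le> n + q * (label_cost + 1) + 20"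
      by (auto simp: I_def)
    then show "vc Skip \<beta> Q R' M' (Suc n')" using Q[of "n' + 2" R'] by (simp add: A_def)
  next
    fix R' M' n' assume I: "I R' M' n'" and nz: "R' 27 \<noteq> 0"
    then obtain j where j: "R' 27 = Suc j" by (cases "R' 27") auto
    have M': "M' = M" and frame: "\<And>r. r < 23 \<Longrightarrow> R' r = R r" and x: "R' 24 = R 22 mod X" and jq: "Suc j \<le> q"
      and lab: "label b S D (R 22 mod X) (R 19) (Suc j) (R' 23) (R' 26) (R' 25) = A"
      and L: "R' 25 + 1 \<le> X * D ^ (q - Suc j)" and w: "R' 23 < 2 ^ \<beta>" and u: "R' 26 < 2 ^ \<beta>"
      and n': "n' + Suc j * (label_cost + 1) \<le> n + q * (label_cost + 1) + 17"
      using I unfolding I_def j by auto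
    have "q - j = Suc (q - Suc j)" using jq by simp
    then have pw: "X * D ^ (q - j) = X * D ^ (q - Suc j) * D" by simp
    have L1: "R' 25 * D + D \<le> X * D ^ (q - j)"
      unfolding pw using mult_le_mono1[OF L, of D] by simp
    also have "\<dots> \<le> X * D ^ q" using D2 by (intro mult_le_mono2 power_increasing) auto
    finally have L2: "R' 25 * D + D \<le> X * D ^ q" .
    show "vc label_body \<beta> (\<lambda>R'' M'' n''. I R'' M'' n'' \<and> R'' 27 < R' 27) R' M' (Suc n')"
    proof (rule vc_label_body[OF _ _ _ j w u L2])
      show "fixed_regs R'" using fixed_cong[of R' R] frame f by simp
      show "R' 19 \<le> 1" using frame role by simp
      show "R' 24 < X" using x X0 by simp
      show "R' 27 < 2 ^ \<beta>" using j jq big(4) by simp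
    next
      fix n'' R''
      assume n'': "n'' \<le> Suc n' + label_cost" and fr: "\<And>r. r < 23 \<or> r = 24 \<Longrightarrow> R'' r = R' r"
        and j': "R'' 27 = j" and le: "R'' 23 \<le> R' 23" "R'' 26 \<le> R' 26" and L': "R'' 25 < R' 25 * D + D"
        and lab': "label b S D (R' 24) (R' 19) j (R'' 23) (R'' 26) (R'' 25) = label b S D (R' 24) (R' 19) (Suc j) (R' 23) (R' 26) (R' 25)"
      have "label b S D (R 22 mod X) (R 19) j (R'' 23) (R'' 26) (R'' 25) = A"
        using lab' lab x frame[of 19] by (simp del: label.simps)
      moreover have "n'' + j * (label_cost + 1) \<le> n + q * (label_cost + 1) + 17"
        using n' n'' by simp
      moreover have "R'' 25 + 1 \<le> X * D ^ (q - j)" using L' L1 by linarith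
      ultimately show "I R'' M' n'' \<and> R'' 27 < R' 27"
        using fr frame x j j' jq le w u M' unfolding I_def by simp
    qed
  qed
  have "R 22 div X < 2 ^ \<beta>" "R 22 div X * X < 2 ^ \<beta>" "R 22 mod X < 2 ^ \<beta>"
    using bnd(1) by (meson div_le_dividend div_times_less_eq_dividend mod_less_eq_dividend le_less_trans)+
  note bounds = this bnd big(4) X_less one_less
  show ?thesis
    using f unfolding fixed_regs_def label_com_def block.simps
    apply (simp add: bounds minus_div_mult_eq_mod)
    apply (rule loop)
    using X0 bounds
    apply (simp add: I_def A_def Suc_leI)
    done
qed

end

text \<open>
With truncated subtraction, $(c - v) + (v - c)$ is the distance of two digits, and its half is 1 exactly for $\{0, 2\}$.
\<close>

primrec clash :: "nat \<Rightarrow> nat \<Rightarrow> nat \<Rightarrow> nat" where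
  "clash 0 c v = 0"
| "clash (Suc j) c v = ((c mod 3 - v mod 3) + (v mod 3 - c mod 3)) div 2 + clash j (c div 3) (v div 3)"

definition clash_body :: com where
  "clash_body = block [Sub 27 27 1, Div 28 23 3, Mult 32 28 3, Sub 29 23 32, Add 23 28 0,
     Div 28 26 3, Mult 32 28 3, Sub 30 26 32, Add 26 28 0,
     Sub 32 29 30, Sub 28 30 29, Add 32 32 28, Div 32 32 2, Add 31 31 32]"

definition clash_com :: com where
  "clash_com = block [Const 31 0, Add 23 33 0, Add 26 20 0, Add 27 4 0, While 27 clash_body]"

text \<open>Cells hold the ternary value plus 1, so that 0 means unmarked even for value 0. A mark
  met in role 1 is only a candidate; it is recorded after the direct comparison by
  \<open>clash_com\<close>.\<close>

definition visit_com :: com where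
  "visit_com = block [label_com, Add 25 25 5,
     If 19
      (block [Load 33 25,
         If 33 (block [Sub 33 33 1, clash_com, If 31 Skip (block [Const 16 1, Add 17 33 0, Add 18 20 0])]) Skip])
      (block [Add 33 20 1, Store 25 33])]"

section \<open>Verification of a single visit\<close>

context search_params begin

lemma d_less: "d + 1 < 2 ^ \<beta>"
proof -
  have "d + 1 < 2 ^ (d + 1)" by (rule less_exp)
  also have "\<dots> \<le> 3 ^ (d + 1)" by (rule power_mono) auto
  finally show ?thesis using big(2) by simp
qed

lemma vc_clash_com:
  assumes f: "fixed_regs R" and bnd: "R 33 < 2 ^ \<beta>" "R 20 < 2 ^ \<beta>"
    and Q: "\<And>n' R'. n' \<le> n + d * 31 + 20 \<Longrightarrow> (\<And>r. r < 23 \<or> r = 33 \<Longrightarrow> R' r = R r) \<Longrightarrow>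
      R' 31 = clash d (R 33) (R 20) \<Longrightarrow> R' 31 < 2 ^ \<beta> \<Longrightarrow> Q R' M n'"
  shows "vc clash_com \<beta> Q R M n"
proof -
  define A where "A = clash d (R 33) (R 20)"
  define I where "I = (\<lambda>R' M' n'. M' = M \<and> (\<forall>r. r < 23 \<or> r = 33 \<longrightarrow> R' r = R r) \<and> R' 27 \<le> d
    \<and> R' 31 + clash (R' 27) (R' 23) (R' 26) = A
    \<and> R' 31 + R' 27 \<le> d \<and> R' 23 < 2 ^ \<beta> \<and> R' 26 < 2 ^ \<beta>
    \<and> n' + R' 27 * 31 \<le> n + d * 31 + 17)"
  have loop: "wp (While 27 clash_body) \<beta> (vc Skip \<beta> Q) R0 M n0" if I0: "I R0 M n0" for R0 n0
  proof (rule wp_While[where I = I])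
    show "I R0 M n0" by fact
  next
    fix R' M' n' assume "I R' M' n'"
    then show "R' 27 < 2 ^ \<beta>" using d_less by (auto simp: I_def)
  next
    fix R' M' n' assume "I R' M' n'" "R' 27 = 0"
    then have *: "M' = M" "\<And>r. r < 23 \<or> r = 33 \<Longrightarrow> R' r = R r" "R' 31 = A" "R' 31 \<le> d" "n' + 2 \<le> n + d * 31 + 20"
      by (auto simp: I_def)
    then show "vc Skip \<beta> Q R' M' (Suc n')" using Q[of "n' + 2" R'] d_less by (simp add: A_def)
  next
    fix R' M' n' assume I: "I R' M' n'" and nz: "R' 27 \<noteq> 0"
    then obtain j where j: "R' 27 = Suc j" by (cases "R' 27") auto
    have M': "M' = M" and frame: "\<And>r. r < 23 \<or> r = 33 \<Longrightarrow> R' r = R r" and jd: "Suc j \<le> d"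
      and cl: "R' 31 + clash (Suc j) (R' 23) (R' 26) = A"
      and bd: "R' 31 + Suc j \<le> d" and w: "R' 23 < 2 ^ \<beta>" and u: "R' 26 < 2 ^ \<beta>"
      and n': "n' + Suc j * 31 \<le> n + d * 31 + 17"
      using I unfolding I_def j by auto
    have f': "fixed_regs R'" using fixed_cong[of R' R] frame f by simp
    define c v where "c = R' 23 mod 3" and "v = R' 26 mod 3"
    have cv: "c < 3" "v < 3" by (auto simp: c_def v_def)
    have t: "(c - v + (v - c)) div 2 \<le> 1" using cv by auto
    have sub: "R' 23 - R' 23 div 3 * 3 = c" "R' 26 - R' 26 div 3 * 3 = v"
      by (simp_all add: minus_div_mult_eq_mod c_def v_def)
    have "R' 23 div 3 < 2 ^ \<beta>" "R' 26 div 3 < 2 ^ \<beta>" "R' 23 div 3 * 3 < 2 ^ \<beta>" "R' 26 div 3 * 3 < 2 ^ \<beta>"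
      using w u by (meson div_le_dividend div_times_less_eq_dividend le_less_trans)+
    moreover have "c < 2 ^ \<beta>" "v < 2 ^ \<beta>" "c - v < 2 ^ \<beta>" "v - c < 2 ^ \<beta>" "c - v + (v - c) < 2 ^ \<beta>"
      "(c - v + (v - c)) div 2 < 2 ^ \<beta>" "R' 31 < 2 ^ \<beta>" "Suc j < 2 ^ \<beta>"
      using cv t one_less bd d_less by linarith+
    ultimately show "vc clash_body \<beta> (\<lambda>R'' M'' n''. I R'' M'' n'' \<and> R'' 27 < R' 27) R' M' (Suc n')"
      using f' unfolding fixed_regs_def clash_body_def block.simps
      apply (simp add: j one_less one_less[simplified] w u sub)
      using cl[simplified, folded c_def v_def] t bd n' jd M' frame
      by (simp add: I_def)
  qed
  show ?thesis
    using f unfolding fixed_regs_def clash_com_def block.simps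
    apply (simp add: bnd one_less d_less[simplified, THEN Suc_lessD])
    apply (rule loop)
    using bnd
    apply (simp add: I_def A_def)
    done
qed

definition address :: "nat \<Rightarrow> nat \<Rightarrow> nat \<Rightarrow> nat" where
  "address \<rho> V W = off + label b S D (W mod X) \<rho> q (W div X) V (W mod X)"

definition visit_cost :: nat where "visit_cost = q * (label_cost + 1) + d * 31 + 80"

lemma vc_visit_com:
  assumes f: "fixed_regs R" and role: "R 19 \<le> 1" and mem: "\<And>a. M a < 2 ^ \<beta>"
    and bnd: "R 22 < 2 ^ \<beta>" "R 20 + 1 < 2 ^ \<beta>"
    and store: "\<And>n' R'. R 19 = 0 \<Longrightarrow> n' \<le> n + visit_cost \<Longrightarrow> (\<And>r. r < 23 \<Longrightarrow> R' r = R r) \<Longrightarrow>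
      Q R' (M(address 0 (R 20) (R 22) := R 20 + 1)) n'"
    and hit: "\<And>n' R'. R 19 = 1 \<Longrightarrow> n' \<le> n + visit_cost \<Longrightarrow> M (address 1 (R 20) (R 22)) \<noteq> 0 \<Longrightarrow>
      clash d (M (address 1 (R 20) (R 22)) - 1) (R 20) = 0 \<Longrightarrow>
      (\<And>r. r < 23 \<Longrightarrow> r \<noteq> 16 \<Longrightarrow> r \<noteq> 17 \<Longrightarrow> r \<noteq> 18 \<Longrightarrow> R' r = R r) \<Longrightarrow>
      R' 16 = 1 \<Longrightarrow> R' 17 = M (address 1 (R 20) (R 22)) - 1 \<Longrightarrow> R' 18 = R 20 \<Longrightarrow> Q R' M n'"
    and miss: "\<And>n' R'. R 19 = 1 \<Longrightarrow> n' \<le> n + visit_cost \<Longrightarrow>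
      M (address 1 (R 20) (R 22)) = 0 \<or> clash d (M (address 1 (R 20) (R 22)) - 1) (R 20) \<noteq> 0 \<Longrightarrow>
      (\<And>r. r < 23 \<Longrightarrow> R' r = R r) \<Longrightarrow> Q R' M n'"
  shows "vc visit_com \<beta> Q R M n"
  unfolding visit_com_def block.simps vc.simps(10)
proof (rule vc_label_com[OF f role bnd(1)], goal_cases)
  case 1
  then show ?case using bnd by simp
next
  case (2 n' R')
  have f': "fixed_regs R'" using fixed_cong[of R' R] 2(2) f by simp
  have fr: "R' 19 = R 19" "R' 20 = R 20" "R' 22 = R 22" using 2(2) by auto
  define a where "a = address (R 19) (R 20) (R 22)"
  have a: "R' 25 + off = a" using 2(3) by (simp add: a_def address_def)
  have ab: "R' 25 < 2 ^ \<beta>" "off < 2 ^ \<beta>" "a < 2 ^ \<beta>" using 2(4) a big(1) by linarith+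
  have n': "n' \<le> Suc n + q * (label_cost + 1) + 20" by (fact 2(1))
  have V: "R 20 < 2 ^ \<beta>" "Suc (R 20) < 2 ^ \<beta>" using bnd by simp_all
  show ?case
  proof (cases "R 19 = 0")
    case True
    have Q: "Q R'' (M(a := R 20 + 1)) n''" if "n'' \<le> n' + 30" "\<And>r. r < 23 \<Longrightarrow> R'' r = R' r" for R'' n''
      unfolding a_def True using that True n' 2(2)
      by (intro store) (auto simp: visit_cost_def)
    show ?thesis
      using f' unfolding fixed_regs_def vc.simps
      using True V ab one_less[simplified]
      by (simp add: fr a) (rule Q[simplified]; simp)
  next
    case False
    then have r1: "R 19 = 1" using role by simp
    have m: "M a < 2 ^ \<beta>" "M a - Suc 0 < 2 ^ \<beta>" using mem[of a] by auto
    have missQ: "Q R'' M n''" if "M a = 0 \<or> clash d (M a - 1) (R 20) \<noteq> 0" "n'' \<le> n' + d * 31 + 50"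
      "\<And>r. r < 23 \<Longrightarrow> R'' r = R' r" for R'' n''
      using that r1 n' 2(2) by (intro miss) (auto simp: visit_cost_def a_def)
    have hitQ: "Q R'' M n''" if "M a \<noteq> 0" "clash d (M a - 1) (R 20) = 0" "n'' \<le> n' + d * 31 + 50"
      "\<And>r. r < 23 \<Longrightarrow> r \<noteq> 16 \<Longrightarrow> r \<noteq> 17 \<Longrightarrow> r \<noteq> 18 \<Longrightarrow> R'' r = R' r"
      "R'' 16 = 1" "R'' 17 = M a - 1" "R'' 18 = R 20" for R'' n''
      using that r1 n' 2(2) by (intro hit) (auto simp: visit_cost_def a_def)
    show ?thesis
      using f' unfolding fixed_regs_def vc.simps block.simps
      using r1 V ab one_less[simplified] m
      apply (simp add: fr a)
      apply (intro conjI impI)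
       defer
       apply (rule missQ; simp)
      apply (rule vc_clash_com)
      subgoal by (simp add: fixed_regs_def)
      subgoal by simp
      subgoal by (simp add: fr)
      subgoal for n'' R''
        apply (simp add: fr V)
        apply (intro conjI impI)
         apply (rule missQ; simp add: fr)
        apply (rule hitQ; simp add: fr)
        done
      done
  qed
qed

end

section \<open>Processing one vector\<close>

definition load_body :: com where
  "load_body = block [Sub 27 27 1, Load 33 15, Add 15 15 1, Mult 20 20 3, Add 20 20 33,
     Div 33 33 2, Add 21 21 33]"

definition load_com :: com where
  "load_com = block [Const 20 0, Const 21 0, Add 27 4 0, While 27 load_body]"

text \<open>Each self-power needs a copy of its base, since \<open>pow_com\<close> counts the
  exponent register down to 0.\<close>

definition bound_com :: com where
  "bound_com = block [Sub 30 4 21, Add 31 30 0, pow_com 32 31 30, Add 22 32 0,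
     Add 30 12 21, Add 31 30 0, pow_com 32 31 30, Mult 22 22 32,
     Add 30 21 0, pow_com 32 21 30, Div 22 22 32,
     Sub 30 12 21, Add 31 30 0, pow_com 32 31 30, Div 22 22 32,
     Add 30 4 0, pow_com 32 4 30, Div 22 22 32, Add 22 22 1, Mult 22 22 11]"

definition vector_com :: com where
  "vector_com = block [Sub 14 14 1, If 13 (block [Const 19 0, Sub 13 13 1]) (Const 19 1),
     load_com, bound_com, While 22 (block [Sub 22 22 1, visit_com])]"

text \<open>Horner's scheme, following the order in which the coordinates are read: the first one
  becomes the most significant digit. Blocks are thus counted from the end of the vector, which is
  harmless as all vectors are reversed alike.\<close>

definition ternary_value :: "nat list \<Rightarrow> nat" where
  "ternary_value = foldl (\<lambda>a x. 3 * a + x) 0"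

lemma ternary_value_snoc: "ternary_value (xs @ [x]) = 3 * ternary_value xs + x"
  by (simp add: ternary_value_def)

lemma ternary_value_less: "set xs \<subseteq> {0, 1, 2} \<Longrightarrow> ternary_value xs < 3 ^ length xs"
proof (induction xs rule: rev_induct)
  case (snoc x xs)
  then have "x \<le> 2" "ternary_value xs < 3 ^ length xs" by auto
  then show ?case by (simp add: ternary_value_snoc)
qed (simp add: ternary_value_def)

lemma le_mult_pos: "0 < w \<Longrightarrow> x \<le> x * (w :: nat)"
  by (cases w) auto

lemma count_list_le_length: "count_list xs x \<le> length xs"
  by (induction xs) auto

text \<open>
Dividing by the factors of the denominator in turn gives the same as dividing by their product, and keeps the intermediate
values small; note $0^0 = 1$ for $t = 0$.
\<close>

definition visits_bound :: "nat \<Rightarrow> nat \<Rightarrow> nat \<Rightarrow> nat \<Rightarrow> nat" where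
  "visits_bound d h Wc t =
     ((d - t) ^ (d - t) * (h + t) ^ (h + t) div t ^ t div (h - t) ^ (h - t) div d ^ d + 1) * Wc"

text \<open>The numerator of \<open>visits_bound\<close> is at most
  \<open>(d + 1) ^ (2 * d)\<close>, because both of its bases are at most \<open>d\<close> as soon
  as \<open>t \<le> h\<close> and \<open>2 * h \<le> d\<close>.\<close>

locale search_bounds = search_params +
  assumes big2: "((d + 1) ^ (2 * d) + 1) * Wc < 2 ^ \<beta>" "2 * h \<le> d" "0 < Wc"
begin

lemma vc_load_com:
  assumes f: "fixed_regs R" and v: "length v = d" "set v \<subseteq> {0, 1, 2}"
    and M: "\<And>i. i < d \<Longrightarrow> M (R 15 + i) = v ! i" and ptr: "R 15 + d < 2 ^ \<beta>"
    and Q: "\<And>n' R'. n' \<le> n + d * 20 + 20 \<Longrightarrow> (\<And>r. r < 20 \<Longrightarrow> r \<noteq> 15 \<Longrightarrow> R' r = R r) \<Longrightarrow>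
      R' 15 = R 15 + d \<Longrightarrow> R' 20 = ternary_value v \<Longrightarrow> R' 21 = count_list v 2 \<Longrightarrow> Q R' M n'"
  shows "vc load_com \<beta> Q R M n"
proof -
  define I where "I = (\<lambda>R' M' n'. M' = M \<and> (\<forall>r. r < 20 \<and> r \<noteq> 15 \<longrightarrow> R' r = R r) \<and> R' 27 \<le> d
    \<and> R' 15 + R' 27 = R 15 + d \<and> R' 20 = ternary_value (take (d - R' 27) v) \<and> R' 21 = count_list (take (d - R' 27) v) 2
    \<and> n' + R' 27 * 20 \<le> n + d * 20 + 17)"
  have loop: "wp (While 27 load_body) \<beta> (vc Skip \<beta> Q) R0 M n0" if I0: "I R0 M n0" for R0 n0
  proof (rule wp_While[where I = I])
    show "I R0 M n0" by fact
  next
    fix R' M' n' assume "I R' M' n'"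
    then show "R' 27 < 2 ^ \<beta>" using d_less by (auto simp: I_def)
  next
    fix R' M' n' assume "I R' M' n'" "R' 27 = 0"
    then have *: "M' = M" "\<And>r. r < 20 \<Longrightarrow> r \<noteq> 15 \<Longrightarrow> R' r = R r" "R' 15 = R 15 + d"
      "R' 20 = ternary_value v" "R' 21 = count_list v 2" "n' + 2 \<le> n + d * 20 + 20"
      using v by (auto simp: I_def)
    then show "vc Skip \<beta> Q R' M' (Suc n')" using Q[of "n' + 2" R'] by simp
  next
    fix R' M' n' assume I: "I R' M' n'" and nz: "R' 27 \<noteq> 0"
    then obtain j where j: "R' 27 = Suc j" by (cases "R' 27") auto
    define i where "i = d - Suc j"
    have M': "M' = M" and frame: "\<And>r. r < 20 \<and> r \<noteq> 15 \<Longrightarrow> R' r = R r" and jd: "Suc j \<le> d"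
      and p: "R' 15 = R 15 + i" and V: "R' 20 = ternary_value (take i v)" and T: "R' 21 = count_list (take i v) 2"
      and n': "n' + Suc j * 20 \<le> n + d * 20 + 17"
      using I unfolding I_def j i_def by auto
    have f': "fixed_regs R'" using frame f by (simp add: fixed_regs_def)
    have i: "i < d" "d - j = Suc i" using jd by (auto simp: i_def)
    have mi: "M (R 15 + i) = v ! i" using M i by simp
    have vi: "v ! i \<in> {0, 1, 2}" using v i nth_mem by blast
    have tk: "take (Suc i) v = take i v @ [v ! i]" using i v by (simp add: take_Suc_conv_app_nth)
    have "ternary_value (take i v) < 3 ^ i" using ternary_value_less[of "take i v"] v i set_take_subset[of i v] by auto
    moreover have "(3::nat) ^ Suc i \<le> 3 ^ (d + 1)" using i by (intro power_increasing) auto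
    then have "3 * (3::nat) ^ i \<le> 3 ^ (d + 1)" by (simp only: power_Suc)
    ultimately have "ternary_value (take i v) * 3 < 2 ^ \<beta>" using big(2) by linarith
    moreover have "count_list (take i v) 2 < 2 ^ \<beta>" "Suc j < 2 ^ \<beta>" "R 15 + i < 2 ^ \<beta>" "v ! i < 2 ^ \<beta>" "v ! i div 2 < 2 ^ \<beta>"
      using count_list_le_length[of "take i v" 2] v i jd ptr d_less vi one_less by auto
    moreover have "ternary_value (take i v) < 2 ^ \<beta>" using calculation(1) by simp
    \<comment> \<open>Half of a digit, rounded down, is 1 exactly for the digit 2, so twos are
      counted without a branch.\<close>
    moreover have "count_list (take (Suc i) v) 2 = count_list (take i v) 2 + v ! i div 2"
      unfolding tk using vi by auto
    moreover have "ternary_value (take (Suc i) v) = ternary_value (take i v) * 3 + v ! i"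
      unfolding tk by (simp add: ternary_value_snoc)
    ultimately show "vc load_body \<beta> (\<lambda>R'' M'' n''. I R'' M'' n'' \<and> R'' 27 < R' 27) R' M' (Suc n')"
      using f' unfolding fixed_regs_def load_body_def block.simps
      apply (simp add: j p V T M' mi one_less one_less[simplified])
      using n' i jd frame p
      apply (simp add: I_def)
      done
  qed
  show ?thesis
    using f unfolding fixed_regs_def load_com_def block.simps
    apply (simp add: one_less d_less[simplified, THEN Suc_lessD])
    apply (rule loop)
    apply (simp add: I_def ternary_value_def)
    done
qed

lemma self_power_le: "a \<le> d \<Longrightarrow> a ^ a \<le> (d + 1) ^ d"
  by (rule order.trans[OF power_mono power_increasing]) auto

lemma self_power_bound: "(d + 1) ^ d < 2 ^ \<beta>" "(d + 1) ^ (2 * d) + 1 < 2 ^ \<beta>"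
proof -
  have "(d + 1) ^ (2 * d) + 1 \<le> ((d + 1) ^ (2 * d) + 1) * Wc" by (rule le_mult_pos[OF big2(3)])
  then show "(d + 1) ^ (2 * d) + 1 < 2 ^ \<beta>" using big2(1) by (rule le_less_trans)
  moreover have "(d + 1) ^ d \<le> (d + 1) ^ (2 * d)" by (rule power_increasing) auto
  ultimately show "(d + 1) ^ d < 2 ^ \<beta>" by linarith
qed

lemma vc_pow_self:
  assumes f: "fixed_regs R" and s: "s \<noteq> 32" "s \<noteq> 30" "R s = R 30" "R 30 \<le> d"
    and Q: "\<And>n' R'. n' \<le> n + 6 * d + 6 \<Longrightarrow> (\<And>r. r \<noteq> 30 \<Longrightarrow> r \<noteq> 32 \<Longrightarrow> R' r = R r) \<Longrightarrow>
      R' 32 = R 30 ^ R 30 \<Longrightarrow> Q R' M n'"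
  shows "vc (pow_com 32 s 30) \<beta> Q R M n"
proof (rule vc_pow_com, goal_cases)
  case (11 n')
  then have "n' \<le> n + 6 * d + 6" using s by simp
  then show ?case using s by (intro Q) auto
next
  case 10
  then show ?case using self_power_le[OF s(4)] self_power_bound s by simp
qed (use s f one_less d_less in \<open>auto simp: fixed_regs_def\<close>)

lemma vc_bound_com:
  assumes f: "fixed_regs R" and t: "R 21 = t" "t \<le> h"
    and Q: "\<And>n' R'. n' \<le> n + 30 * d + 150 \<Longrightarrow> (\<And>r. r < 22 \<Longrightarrow> R' r = R r) \<Longrightarrow>
      R' 22 = visits_bound d h Wc t \<Longrightarrow> visits_bound d h Wc t < 2 ^ \<beta> \<Longrightarrow> Q R' M n'"
  shows "vc bound_com \<beta> Q R M n"
proof -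
  define a1 a2 a3 a4 where a: "a1 = (d - t) ^ (d - t)" "a2 = (h + t) ^ (h + t)" "a3 = t ^ t" "a4 = (h - t) ^ (h - t)"
  have le: "a1 \<le> (d + 1) ^ d" "a2 \<le> (d + 1) ^ d" "a3 \<le> (d + 1) ^ d" "a4 \<le> (d + 1) ^ d" "d ^ d \<le> (d + 1) ^ d"
    unfolding a by (rule self_power_le; use t big2(2) in linarith)+
  then have less: "a1 < 2 ^ \<beta>" "a2 < 2 ^ \<beta>" "a3 < 2 ^ \<beta>" "a4 < 2 ^ \<beta>" "d ^ d < 2 ^ \<beta>"
    using self_power_bound(1) by linarith+
  have "a1 * a2 \<le> (d + 1) ^ d * (d + 1) ^ d" using le by (intro mult_le_mono) auto
  then have a12: "a1 * a2 \<le> (d + 1) ^ (2 * d)" by (simp flip: power_add add: mult_2)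
  then have p: "a1 * a2 < 2 ^ \<beta>" using self_power_bound(2) by linarith
  have q1: "a1 * a2 div a3 \<le> a1 * a2" "a1 * a2 div a3 div a4 \<le> a1 * a2" "a1 * a2 div a3 div a4 div d ^ d \<le> a1 * a2"
    by (meson div_le_dividend le_trans)+
  then have q: "a1 * a2 div a3 < 2 ^ \<beta>" "a1 * a2 div a3 div a4 < 2 ^ \<beta>" "a1 * a2 div a3 div a4 div d ^ d < 2 ^ \<beta>"
    "Suc (a1 * a2 div a3 div a4 div d ^ d) < 2 ^ \<beta>"
    using p a12 self_power_bound(2) by linarith+
  have "visits_bound d h Wc t \<le> ((d + 1) ^ (2 * d) + 1) * Wc"
    unfolding visits_bound_def a[symmetric] using q1 a12 by (intro mult_le_mono1) linarith
  then have vb: "visits_bound d h Wc t < 2 ^ \<beta>" using big2(1) by simp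
  have "1 * Wc \<le> ((d + 1) ^ (2 * d) + 1) * Wc" by (intro mult_le_mono1) simp
  then have Wc: "Wc < 2 ^ \<beta>" using big2(1) by simp
  have td: "t < 2 ^ \<beta>" "h < 2 ^ \<beta>" "d < 2 ^ \<beta>" "d - t < 2 ^ \<beta>" "h + t < 2 ^ \<beta>" "h - t < 2 ^ \<beta>"
    "t \<le> d" "d - t \<le> d" "h - t \<le> d" "h + t \<le> d"
    using t big2(2) d_less by auto
  note bounds = td Wc less p q one_less one_less[simplified]
  note fr = f[unfolded fixed_regs_def]
  show ?thesis
    unfolding bound_com_def block.simps
    using fr t(1)
    apply (simp add: bounds)
    apply (rule vc_pow_self)
         apply (simp add: fixed_regs_def)
        apply (simp_all add: bounds)[4]
    apply (simp add: bounds flip: a)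
    apply (rule vc_pow_self)
         apply (simp add: fixed_regs_def)
        apply (simp_all add: bounds)[4]
    apply (simp add: bounds flip: a)
    apply (rule vc_pow_self)
         apply (simp add: fixed_regs_def)
        apply (simp_all add: bounds)[4]
    apply (simp add: bounds flip: a)
    apply (rule vc_pow_self)
         apply (simp add: fixed_regs_def)
        apply (simp_all add: bounds)[4]
    apply (simp add: bounds flip: a)
    apply (rule vc_pow_self)
         apply (simp add: fixed_regs_def)
        apply (simp_all add: bounds)[4]
    apply (simp add: bounds flip: a)
    apply (rule Q)
       apply simp
      apply simp
     apply (simp add: visits_bound_def flip: a)
    apply (rule vb)
    done
qed

end

section \<open>The invariant of the enumeration\<close>

locale search_input = search_bounds +
  fixes N nA t :: nat and vec :: "nat \<Rightarrow> nat list" and M0 :: "nat \<Rightarrow> nat"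
  assumes vec: "\<And>i. i < N \<Longrightarrow> length (vec i) = d" "\<And>i. i < N \<Longrightarrow> set (vec i) \<subseteq> {0, 1, 2}"
      "\<And>i. i < N \<Longrightarrow> count_list (vec i) 2 = t"
    and t: "0 < N \<Longrightarrow> t \<le> h" and nA: "nA \<le> N"
    and off: "off = 3 + N * d" "N < 2 ^ \<beta>"
    and M0: "\<And>i j. i < N \<Longrightarrow> j < d \<Longrightarrow> M0 (3 + i * d + j) = vec i ! j"
      "\<And>a. off \<le> a \<Longrightarrow> M0 a = 0" "\<And>a. M0 a < 2 ^ \<beta>"
begin

definition val :: "nat \<Rightarrow> nat" where "val i = ternary_value (vec i)"
definition Wm :: nat where "Wm = visits_bound d h Wc t"

text \<open>Register 22 counts down, so for the current vector \<open>m\<close> the visits with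
  numbers from \<open>W\<close> upwards are those already made.\<close>

definition visited :: "nat \<Rightarrow> nat \<Rightarrow> (nat \<times> nat) set" where
  "visited m W = {(i, w). i < N \<and> w < Wm \<and> (i < m \<or> i = m \<and> W \<le> w)}"

text \<open>This half of the invariant makes a report trustworthy: a mark stems from a vector of A
  that has this label, and the registers hold a pair that has passed the comparison. The input cells
  stay intact for the vectors still to be read.\<close>

definition sound :: "(nat \<Rightarrow> nat) \<Rightarrow> (nat \<Rightarrow> nat) \<Rightarrow> bool" where
  "sound R M \<longleftrightarrow> (\<forall>a<off. M a = M0 a) \<and> (\<forall>a. M a < 2 ^ \<beta>) \<and>
     (\<forall>a\<ge>off. M a \<noteq> 0 \<longrightarrow> (\<exists>i<nA. \<exists>w<Wm. a = address 0 (val i) w \<and> M a = val i + 1)) \<and>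
     R 16 \<le> 1 \<and> (R 16 \<noteq> 0 \<longrightarrow> (\<exists>i<nA. \<exists>j<N. nA \<le> j \<and> R 17 = val i \<and> R 18 = val j \<and> clash d (val i) (val j) = 0))"

text \<open>
All visits in $V$ have left their mark: a cell for $A$, and a pair in the registers if a compatible one was met for $B$.
A cell may be overwritten by a later vector of $A$ with the same label.
\<close>

definition covers :: "(nat \<times> nat) set \<Rightarrow> (nat \<Rightarrow> nat) \<Rightarrow> (nat \<Rightarrow> nat) \<Rightarrow> bool" where
  "covers V R M \<longleftrightarrow> (\<forall>(i, w)\<in>V. (i < nA \<longrightarrow> M (address 0 (val i) w) \<noteq> 0) \<and>
     (nA \<le> i \<longrightarrow> M (address 1 (val i) w) \<noteq> 0 \<longrightarrow> clash d (M (address 1 (val i) w) - 1) (val i) = 0 \<longrightarrow> R 16 \<noteq> 0))"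

lemma val_less: "i < N \<Longrightarrow> val i + 1 < 2 ^ \<beta>"
proof -
  assume i: "i < N"
  have "val i < 3 ^ d" unfolding val_def using ternary_value_less[of "vec i"] vec(1,2)[OF i] by simp
  also have "(3::nat) ^ d + 1 \<le> 3 ^ (d + 1)" by simp
  finally show ?thesis using big(2) by simp
qed

lemma address_ge: "off \<le> address \<rho> V w" by (simp add: address_def)

lemma vc_visit_step:
  assumes f: "fixed_regs R" and s: "sound R M" and c: "covers (visited m (Suc W)) R M"
    and m: "m < N" and role: "R 19 = (if m < nA then 0 else 1)" and V: "R 20 = val m" and W: "R 22 = W" "W < Wm" "Wm < 2 ^ \<beta>"
    and Q: "\<And>n' R' M'. n' \<le> n + visit_cost \<Longrightarrow> sound R' M' \<Longrightarrow> covers (visited m W) R' M' \<Longrightarrow>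
      (\<And>r. r < 23 \<Longrightarrow> r \<noteq> 16 \<Longrightarrow> r \<noteq> 17 \<Longrightarrow> r \<noteq> 18 \<Longrightarrow> R' r = R r) \<Longrightarrow> Q R' M' n'"
  shows "vc visit_com \<beta> Q R M n"
proof -
  have vis: "visited m W = insert (m, W) (visited m (Suc W))"
    using m W by (auto simp: visited_def)
  have lt: "i \<le> m" if "(i, w) \<in> visited m W'" for i w W' using that by (auto simp: visited_def)
  have sd: "M a < 2 ^ \<beta>" for a using s by (simp add: sound_def)
  show ?thesis
  proof (rule vc_visit_com[OF f], goal_cases)
    case 1
    then show ?case using role by simp
  next
    case 2
    then show ?case by (rule sd)
  next
    case 3
    then show ?case using W by simp
  next
    case 4
    then show ?case using V val_less[OF m] by simp
  next
    \<comment> \<open>Cases 5, 6 and 7 are a mark set for A, a successful comparison for B and a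
      visit for B without success.\<close>
    case (5 n' R')
    have mA: "m < nA" using 5(1) role by (simp split: if_splits)
    let ?M = "M(address 0 (R 20) (R 22) := R 20 + 1)"
    have r: "R' 16 = R 16" "R' 17 = R 17" "R' 18 = R 18" using 5(3) by auto
    have s1: "sound R' ?M"
      using s address_ge[of 0 "val m" W] val_less[OF m] mA W unfolding sound_def r V by auto
    \<comment> \<open>An overwritten cell stays nonzero, and no earlier look-up can be invalidated
      because all of A is processed before B.\<close>
    have c1: "covers (visited m W) R' ?M"
      unfolding covers_def vis
    proof (safe, goal_cases)
      case 1
      then show ?case by (simp add: V W)
    next
      case 2
      then show ?case using mA by simp
    next
      case (3 i w)
      then have "M (address 0 (val i) w) \<noteq> 0" using c by (auto simp: covers_def)
      then show ?case using 3 by (simp split: if_splits)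
    next
      case (4 i w)
      then show ?case using lt[OF 4(1)] mA by simp
    qed
    show ?case by (rule Q[OF 5(2) s1 c1]) (rule 5(3))
  next
    case (6 n' R')
    have mA: "nA \<le> m" using 6(1) role by (cases "m < nA") simp_all
    let ?a = "address 1 (val m) W"
    have a: "address 1 (R 20) (R 22) = ?a" using V W by simp
    have "\<exists>i<nA. \<exists>w<Wm. ?a = address 0 (val i) w \<and> M ?a = val i + 1"
      using s 6(3) address_ge[of 1 "val m" W] unfolding sound_def a by blast
    then obtain i where i: "i < nA" "M ?a = val i + 1" by blast
    have "\<exists>i<nA. \<exists>j<N. nA \<le> j \<and> R' 17 = val i \<and> R' 18 = val j \<and> clash d (val i) (val j) = 0"
      by (rule exI[of _ i], rule conjI[OF i(1)], rule exI[of _ m]) (use i(2) mA m 6(4,7,8) in \<open>simp add: V W(1)\<close>)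
    then have s1: "sound R' M" using s 6(6) unfolding sound_def by simp
    have c1: "covers (visited m W) R' M"
      unfolding covers_def
    proof (safe, goal_cases)
      case (1 i w)
      then have "(i, w) \<in> visited m (Suc W)" using mA by (auto simp: vis)
      then show ?case using c 1 by (auto simp: covers_def)
    next
      case 2
      then show ?case using 6(6) by simp
    qed
    show ?case by (rule Q[OF 6(2) s1 c1]) (rule 6(5))
  next
    case (7 n' R')
    have mA: "nA \<le> m" using 7(1) role by (cases "m < nA") simp_all
    have a: "address 1 (R 20) (R 22) = address 1 (val m) W" using V W by simp
    have r: "R' 16 = R 16" "R' 17 = R 17" "R' 18 = R 18" using 7(4) by auto
    have s1: "sound R' M" using s unfolding sound_def r .
    have c1: "covers (visited m W) R' M"
      unfolding covers_def
    proof (safe, goal_cases)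
      case (1 i w)
      then have "(i, w) \<in> visited m (Suc W)" using mA by (auto simp: vis)
      then show ?case using c 1 by (auto simp: covers_def)
    next
      case (2 i w)
      then have "(i, w) \<in> visited m (Suc W)" using 7(3) by (auto simp: vis V W(1))
      then show ?case using c 2 r by (auto simp: covers_def)
    qed
    show ?case by (rule Q[OF 7(2) s1 c1]) (rule 7(4))
  qed
qed

definition vector_cost :: nat where
  "vector_cost = Wm * (visit_cost + 10) + d * 50 + 250"

lemma visited_0: "visited m 0 = visited (Suc m) Wm"
  by (auto simp: visited_def)

lemma vc_vector_com:
  assumes f: "fixed_regs R" and s: "sound R M" and c: "covers (visited m Wm) R M"
    and m: "m < N" and r: "R 13 = nA - m" "R 14 = N - m" "R 15 = 3 + m * d"
    and Q: "\<And>n' R' M'. n' \<le> n + vector_cost \<Longrightarrow> sound R' M' \<Longrightarrow> covers (visited (Suc m) Wm) R' M' \<Longrightarrow>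
      (\<And>r. r < 13 \<Longrightarrow> R' r = R r) \<Longrightarrow> R' 13 = nA - Suc m \<Longrightarrow> R' 14 = N - Suc m \<Longrightarrow> R' 15 = 3 + Suc m * d \<Longrightarrow> Q R' M' n'"
  shows "vc vector_com \<beta> Q R M n"
proof -
  define \<rho> :: nat where "\<rho> = (if m < nA then 0 else 1)"
  have vm: "length (vec m) = d" "set (vec m) \<subseteq> {0, 1, 2}" "count_list (vec m) 2 = t" using vec m by auto
  have th: "t \<le> h" using t m by simp
  have offl: "off < 2 ^ \<beta>" using big(1) by linarith
  have md: "3 + m * d + d \<le> off" unfolding off using mult_le_mono1[of "Suc m" N d] m by simp
  have Md: "M (3 + m * d + i) = vec m ! i" if "i < d" for i
    using s M0(1)[OF m that] md that unfolding sound_def by simp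
  define I where "I = (\<lambda>R' M' n'. sound R' M' \<and> covers (visited m (R' 22)) R' M' \<and> (\<forall>r<13. R' r = R r) \<and>
    R' 13 = nA - Suc m \<and> R' 14 = N - Suc m \<and> R' 15 = 3 + Suc m * d \<and> R' 19 = \<rho> \<and> R' 20 = val m \<and> R' 22 \<le> Wm \<and>
    n' + R' 22 * (visit_cost + 10) \<le> n + Wm * (visit_cost + 10) + d * 50 + 240)"
  have loop: "wp (While 22 (block [Sub 22 22 1, visit_com])) \<beta> (vc Skip \<beta> Q) R0 M n0"
    if I0: "I R0 M n0" and Wb: "Wm < 2 ^ \<beta>" for R0 n0
  proof (rule wp_While[where I = I])
    show "I R0 M n0" by fact
  next
    fix R' M' n' assume "I R' M' n'"
    then show "R' 22 < 2 ^ \<beta>" using Wb by (auto simp: I_def)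
  next
    fix R' M' n' assume "I R' M' n'" "R' 22 = 0"
    then show "vc Skip \<beta> Q R' M' (Suc n')" unfolding I_def
      by (simp add: visited_0, intro Q) (auto simp: vector_cost_def)
  next
    fix R' M' n' assume I: "I R' M' n'" and nz: "R' 22 \<noteq> 0"
    then obtain W where W: "R' 22 = Suc W" by (cases "R' 22") auto
    have s': "sound R' M'" and c': "covers (visited m (Suc W)) R' M'" and fr: "\<And>r. r < 13 \<Longrightarrow> R' r = R r"
      and rs: "R' 13 = nA - Suc m" "R' 14 = N - Suc m" "R' 15 = 3 + Suc m * d" "R' 19 = \<rho>" "R' 20 = val m"
      and Wl: "Suc W \<le> Wm" and n': "n' + Suc W * (visit_cost + 10) \<le> n + Wm * (visit_cost + 10) + d * 50 + 240"
      using I unfolding I_def W by auto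
    have f': "fixed_regs R'" using fr f by (simp add: fixed_regs_def)
    have step: "vc visit_com \<beta> (vc Skip \<beta> (\<lambda>R'' M'' n''. I R'' M'' n'' \<and> R'' 22 < Suc W)) (R'(22 := W)) M' n2"
      if n2: "n2 \<le> n' + 5" for n2
    proof (rule vc_visit_step[where m = m and W = W], goal_cases)
      case 1
      then show ?case using f' by (simp add: fixed_regs_def)
    next
      case 2
      then show ?case using s' by (simp add: sound_def)
    next
      case 3
      then show ?case using c' by (simp add: covers_def)
    next
      case (10 n3 R3 M3)
      then have "\<And>r. r < 13 \<Longrightarrow> R3 r = R r" "R3 13 = nA - Suc m" "R3 14 = N - Suc m" "R3 15 = 3 + Suc m * d"
        "R3 19 = \<rho>" "R3 20 = val m" "R3 22 = W" using fr rs by auto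
      then show ?case using 10(1-3) n' Wl n2 by (simp add: I_def)
    qed (use rs m Wl Wb in \<open>auto simp: \<rho>_def\<close>)
    show "vc (block [Sub 22 22 1, visit_com]) \<beta> (\<lambda>R'' M'' n''. I R'' M'' n'' \<and> R'' 22 < R' 22) R' M' (Suc n')"
      using f' Wl Wb unfolding fixed_regs_def by (simp add: one_less[simplified] W step)
  qed
  have nN: "nA - m < 2 ^ \<beta>" "N - m < 2 ^ \<beta>" "0 < N - m" using nA off(2) m by auto
  define tl where "tl = block [load_com, bound_com, While 22 (block [Sub 22 22 1, visit_com])]"
  have tl: "vector_com = Seq (Sub 14 14 1) (Seq (If 13 (block [Const 19 0, Sub 13 13 1]) (Const 19 1)) tl)"
    unfolding vector_com_def tl_def by simp
  \<comment> \<open>The two branches of the role test join here; the tail is treated once, for all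
    registers that either branch can produce.\<close>
  have rest: "vc tl \<beta> Q R1 M n1"
    if R1: "\<And>r. r < 13 \<or> 15 \<le> r \<and> r \<noteq> 19 \<Longrightarrow> R1 r = R r" "R1 13 = nA - Suc m" "R1 14 = N - Suc m" "R1 19 = \<rho>"
      and n1: "n1 \<le> n + 20" for R1 n1
    unfolding tl_def block.simps(2)[of load_com] block.simps(2)[of bound_com] block.simps(2)[of "While _ _"] block.simps(1) vc.simps(10)
  proof (rule vc_load_com[where v = "vec m"], goal_cases)
    case 1
    then show ?case using R1(1) f by (simp add: fixed_regs_def)
  next
    case (4 i)
    then show ?case using R1(1) r Md by simp
  next
    case 5
    then show ?case using R1(1) r md offl by simp
  next
    case (6 n2 R2)
    have R2: "\<And>r. r < 13 \<Longrightarrow> R2 r = R r" "R2 13 = nA - Suc m" "R2 14 = N - Suc m" "R2 19 = \<rho>"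
      "R2 16 = R 16" "R2 17 = R 17" "R2 18 = R 18" "R2 15 = 3 + Suc m * d" "R2 20 = val m" "R2 21 = t"
      using 6(2-5) R1 r vm(3) by (auto simp: val_def)
    show ?case
    proof (rule vc_bound_com[where t = t], goal_cases)
      case 1
      then show ?case using R2 f by (simp add: fixed_regs_def)
    next
      case 2
      show ?case by (rule R2(10))
    next
      case 3
      show ?case by (rule th)
    next
      case (4 n3 R3)
      have R3: "\<And>r. r < 13 \<Longrightarrow> R3 r = R r" "R3 13 = nA - Suc m" "R3 14 = N - Suc m" "R3 19 = \<rho>"
        "R3 16 = R 16" "R3 17 = R 17" "R3 18 = R 18" "R3 15 = 3 + Suc m * d" "R3 20 = val m" "R3 22 = Wm"
        using 4(2,3) R2 by (auto simp: Wm_def)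
      have "I R3 M (Suc n3)" unfolding I_def
        using R3 s c 4(1) 6(1) n1 by (simp add: sound_def covers_def)
      then show ?case unfolding vc.simps(10,12) using 4(4) by (intro loop) (simp_all add: Wm_def)
    qed
  qed (use vm in auto)
  show ?thesis
    using f nN r unfolding fixed_regs_def tl
    apply (simp add: one_less one_less[simplified])
    apply (intro conjI impI)
     apply (rule rest; auto simp: \<rho>_def)
    apply (rule rest; auto simp: \<rho>_def)
    done
qed

end

section \<open>Output, parameters and the complete program\<close>

definition output_body :: com where
  "output_body = block [Div 33 17 3, Mult 32 33 3, Sub 31 17 32, Store 27 31, Add 17 33 0,
     Add 30 4 27, Div 33 18 3, Mult 32 33 3, Sub 31 18 32, Store 30 31, Add 18 33 0, Sub 27 27 1]"

text \<open>Writing the pair destroys the input, so both vectors are decoded from their ternary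
  values. The last coordinate is the least significant digit, hence cells are filled downwards; the
  flag in cell 0 comes last.\<close>

definition output_com :: com where
  "output_com = If 16 (block [Add 27 4 0, While 27 output_body, Store 0 1]) (Store 0 0)"

text \<open>Repeated halving computes bit lengths, first of \<open>d\<close> and then of the result;
  starting registers 34 and 6 at 1 and 3 accounts for the summand 1 in the block length and keeps
  register 6 equal to the matching power of 3. Four squarings give \<open>D = b ^ 16\<close>, and
  \<open>S\<close> is a square times a fourth power.\<close>

definition init_com :: com where
  "init_com = block [Const 1 1, Const 2 2, Const 3 3, Load 4 0, Load 13 1, Load 14 2,
     Add 14 14 13, Mult 5 14 4, Add 5 5 3,
     Add 33 4 0, While 33 (block [Div 33 33 2, Add 27 27 1]),
     Const 34 1, Const 6 3, While 27 (block [Div 27 27 2, Add 34 34 1, Mult 6 6 3]),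
     Div 7 4 34, Add 7 7 1,
     Mult 8 6 6, Mult 8 8 8, Mult 8 8 8, Mult 8 8 8,
     Const 33 9, Add 33 34 33, Mult 32 33 33, Mult 10 32 32, Mult 10 10 32,
     Mult 30 8 8, Mult 30 30 8, Mult 30 30 2, pow_com 9 8 30,
     Mult 31 10 10, Add 30 7 0, pow_com 32 31 30, Mult 11 32 9, Mult 11 11 8,
     Add 33 4 1, Mult 11 11 33, Mult 11 11 33,
     Div 12 4 2, Add 15 3 0]"

definition search_com :: com where
  "search_com = block [init_com, While 14 vector_com, output_com]"

lemma floorlog_step: "x \<noteq> 0 \<Longrightarrow> floorlog 2 x = Suc (floorlog 2 (x div 2))"
  using compute_floorlog[of 2 x] by simp

lemma floorlog_zero: "floorlog 2 0 = 0"
  by (simp add: floorlog_def)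

lemma floorlog_le_self: "floorlog 2 x \<le> x"
  by (simp add: floorlog_le_iff less_exp)

text \<open>A profile consists of six numbers up to \<open>k\<close>, so \<open>S\<close> exceeds
  the number of profiles; it also exceeds the loss \<open>(13 * k * (k + 1))\<^sup>2\<close> per
  block. In \<open>Wc\<close> the factor \<open>X\<close> stands for the table code, one power
  \<open>S ^ q\<close> for the profiles and the other for this loss, \<open>D\<close> for the factor
  \<open>2 ^ k\<close> due to rounding \<open>d\<close> up to \<open>q * k\<close>, and
  \<open>(d + 1)\<^sup>2\<close> for the entropy estimate of the denominator.\<close>

locale search_setup = search_input +
  fixes k :: nat
  assumes k: "k = floorlog 2 (floorlog 2 d) + 1" and bk: "b = 3 ^ k" and qk: "q = d div k + 1"
    and Db: "D = b ^ 16" and Sk: "S = (k + 9) ^ 6" and Wck: "Wc = X * D * (d + 1)\<^sup>2 * (S * S) ^ q"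
    and hd: "h = d div 2"
    and M0': "M0 0 = d" "M0 1 = nA" "M0 2 = N - nA"
begin

lemma vc_output_com:
  assumes f: "fixed_regs R" and s: "sound R M"
    and none: "\<And>n' R' M'. n' \<le> n + 20 * d + 20 \<Longrightarrow> R 16 = 0 \<Longrightarrow> M' 0 = 0 \<Longrightarrow> Q R' M' n'"
    and some: "\<And>n' R' M' i j. n' \<le> n + 30 * d + 20 \<Longrightarrow> i < nA \<Longrightarrow> j < N \<Longrightarrow> nA \<le> j \<Longrightarrow> clash d (val i) (val j) = 0 \<Longrightarrow>
      M' 0 = 1 \<Longrightarrow> (\<And>a. a < d \<Longrightarrow> M' (1 + a) = vec i ! a) \<Longrightarrow> (\<And>a. a < d \<Longrightarrow> M' (d + 1 + a) = vec j ! a) \<Longrightarrow> Q R' M' n'"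
  shows "vc output_com \<beta> Q R M n"
proof (cases "R 16 = 0")
  case True
  then show ?thesis using f one_less unfolding output_com_def fixed_regs_def
    by (simp add: none)
next
  case False
  then obtain i j where ij: "i < nA" "j < N" "nA \<le> j" "R 17 = val i" "R 18 = val j" "clash d (val i) (val j) = 0"
    using s unfolding sound_def by blast
  have iN: "i < N" using ij nA by simp
  note vi = vec(1,2)[OF iN] and vj = vec(1,2)[OF ij(2)]
  define I where "I = (\<lambda>R' M' n'. (\<forall>r<13. R' r = R r) \<and> R' 27 \<le> d \<and> R' 17 = ternary_value (take (R' 27) (vec i)) \<and>
     R' 18 = ternary_value (take (R' 27) (vec j)) \<and>
     (\<forall>a<d. R' 27 \<le> a \<longrightarrow> M' (1 + a) = vec i ! a \<and> M' (d + 1 + a) = vec j ! a) \<and>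
     n' + R' 27 * 30 \<le> n + d * 30 + 10)"
  have d: "d < 2 ^ \<beta>" using d_less by simp
  have d2: "2 * d < 2 ^ \<beta>"
  proof -
    have "d < 3 ^ d" using less_exp[of d] power_mono[of "2::nat" 3 d] by linarith
    then have "2 * d < 3 ^ (d + 1)" by simp
    then show ?thesis using big(2) by simp
  qed
  have loop: "wp (While 27 output_body) \<beta> (vc (Seq (Store 0 1) Skip) \<beta> Q) R0 M1 n0" if "I R0 M1 n0" for R0 M1 n0
  proof (rule wp_While[where I = I])
    show "I R0 M1 n0" by fact
  next
    fix R' M' n' assume "I R' M' n'"
    then show "R' 27 < 2 ^ \<beta>" using d by (auto simp: I_def)
  next
    fix R' M' n' assume I: "I R' M' n'" "R' 27 = 0"
    then have "R' 0 = 0" "R' 1 = 1" using f by (auto simp: I_def fixed_regs_def)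
    moreover have "Q R' (M'(0 := 1)) (Suc (Suc (Suc (Suc n'))))"
      using I by (intro some[OF _ ij(1,2,3,6)]) (auto simp: I_def)
    ultimately show "vc (Seq (Store 0 1) Skip) \<beta> Q R' M' (Suc n')"
      using one_less by simp
  next
    fix R' M' n' assume I: "I R' M' n'" and nz: "R' 27 \<noteq> 0"
    then obtain a where a: "R' 27 = Suc a" by (cases "R' 27") auto
    have fr: "\<And>r. r < 13 \<Longrightarrow> R' r = R r" and ad: "a < d"
      and V: "R' 17 = ternary_value (take (Suc a) (vec i))" "R' 18 = ternary_value (take (Suc a) (vec j))"
      and M': "\<And>c. c < d \<Longrightarrow> Suc a \<le> c \<Longrightarrow> M' (1 + c) = vec i ! c" "\<And>c. c < d \<Longrightarrow> Suc a \<le> c \<Longrightarrow> M' (d + 1 + c) = vec j ! c"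
      and n': "n' + Suc a * 30 \<le> n + d * 30 + 10"
      using I a by (auto simp: I_def)
    have f': "fixed_regs R'" using fr f by (simp add: fixed_regs_def)
    have dec: "ternary_value (take (Suc a) v) div 3 = ternary_value (take a v)"
      "ternary_value (take (Suc a) v) - ternary_value (take a v) * 3 = v ! a" "v ! a < 2 ^ \<beta>"
      "ternary_value (take (Suc a) v) < 2 ^ \<beta>" "ternary_value (take a v) < 2 ^ \<beta>" "ternary_value (take a v) * 3 < 2 ^ \<beta>"
      if v: "length v = d" "set v \<subseteq> {0, 1, 2}" for v
    proof -
      have "v ! a \<in> set v" using ad v by simp
      then have va: "v ! a \<le> 2" using v by auto
      have e: "ternary_value (take (Suc a) v) = 3 * ternary_value (take a v) + v ! a"
        using ad v by (simp add: take_Suc_conv_app_nth ternary_value_snoc)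
      have "ternary_value (take (Suc a) v) < 3 ^ Suc a"
      proof -
        have "set (take (Suc a) v) \<subseteq> {0, 1, 2}" using set_take_subset[of "Suc a" v] v(2) by (rule subset_trans)
        moreover have "length (take (Suc a) v) = Suc a" using ad v by simp
        ultimately show ?thesis using ternary_value_less by metis
      qed
      also have "(3::nat) ^ Suc a \<le> 3 ^ (d + 1)" using ad by (intro power_increasing) auto
      finally have l: "ternary_value (take (Suc a) v) < 2 ^ \<beta>" using big(2) by (rule less_trans)
      show "ternary_value (take (Suc a) v) div 3 = ternary_value (take a v)"
        "ternary_value (take (Suc a) v) - ternary_value (take a v) * 3 = v ! a"
        using e va by auto
      show "v ! a < 2 ^ \<beta>" using va one_less by linarith
      show "ternary_value (take (Suc a) v) < 2 ^ \<beta>" "ternary_value (take a v) < 2 ^ \<beta>" "ternary_value (take a v) * 3 < 2 ^ \<beta>"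
        using l e by linarith+
    qed
    have sa: "Suc a < 2 ^ \<beta>" "d + Suc a < 2 ^ \<beta>" using ad d d2 by linarith+
    show "vc output_body \<beta> (\<lambda>R'' M'' n''. I R'' M'' n'' \<and> R'' 27 < R' 27) R' M' (Suc n')"
      using f' unfolding fixed_regs_def output_body_def block.simps
      apply (simp add: a V dec[OF vi] dec[OF vj] one_less one_less[simplified] d sa[simplified] sa)
      using fr ad n' M'
      apply (simp add: I_def)
      done
  qed
  show ?thesis
    using f False unfolding fixed_regs_def output_com_def block.simps
    apply (simp add: one_less[simplified] d)
    apply (intro conjI)
    subgoal using s one_less unfolding sound_def by linarith
    subgoal
      apply (rule loop[simplified])
      apply (simp add: I_def ij vi vj val_def)
      done
    done
qed

lemma d_less2: "d < 2 ^ \<beta>"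
  using d_less by simp

lemma k_bounds: "1 \<le> k" "k \<le> d + 1" "k < 2 ^ \<beta>" "3 ^ k \<le> D" "k + 9 \<le> D"
proof -
  show "1 \<le> k" by (simp add: k)
  have "k \<le> floorlog 2 d + 1" using floorlog_le_self[of "floorlog 2 d"] by (simp add: k)
  then show "k \<le> d + 1" using floorlog_le_self[of d] by linarith
  then show "k < 2 ^ \<beta>" using d_less by simp
  show "3 ^ k \<le> D" using b bk by simp
  have "(k + 9) ^ 1 \<le> S" unfolding Sk by (rule power_increasing) auto
  then show "k + 9 \<le> D" using S by simp
qed

lemma vc_bits_loop:
  assumes r: "R 1 = 1" "R 2 = 2" "R 33 = d" "R 27 = 0"
    and Q: "\<And>n' R'. n' \<le> n + 6 * d + 6 \<Longrightarrow> (\<And>r. r \<noteq> 27 \<Longrightarrow> r \<noteq> 33 \<Longrightarrow> R' r = R r) \<Longrightarrow>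
       R' 27 = floorlog 2 d \<Longrightarrow> Q R' M n'"
  shows "wp (While 33 (block [Div 33 33 2, Add 27 27 1])) \<beta> Q R M n"
proof (rule wp_While[where I = "\<lambda>R' M' n'. M' = M \<and> (\<forall>r. r \<noteq> 27 \<longrightarrow> r \<noteq> 33 \<longrightarrow> R' r = R r) \<and> R' 33 \<le> d \<and>
      R' 27 + floorlog 2 (R' 33) = floorlog 2 d \<and> n' \<le> n + 6 * R' 27"], goal_cases)
  case 1
  then show ?case using r by simp
next
  case (2 R' M' n')
  then show ?case using d_less by simp
next
  case (3 R' M' n')
  then have "n' \<le> n + 6 * d" using floorlog_le_self[of d] by (simp add: floorlog_zero)
  then show ?case using 3 by (auto simp: floorlog_zero intro!: Q)
next
  case (4 R' M' n')
  then have nz: "R' 33 \<noteq> 0" by simp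
  have fl: "R' 27 + Suc (floorlog 2 (R' 33 div 2)) = floorlog 2 d"
    using 4 floorlog_step[OF nz] by simp
  then have "R' 27 \<le> d" using floorlog_le_self[of d] by linarith
  then have b: "R' 27 < 2 ^ \<beta>" "R' 33 < 2 ^ \<beta>" using 4 d_less by auto
  have f: "R' 1 = 1" "R' 2 = 2" using 4 r by auto
  have "R' 33 div 2 < R' 33" "R' 33 div 2 \<le> d" using nz 4 by auto
  then show ?case using 4 fl b f one_less by (simp add: one_less[simplified])
qed

lemma vc_block_loop:
  assumes r: "R 1 = 1" "R 2 = 2" "R 3 = 3" "R 27 = floorlog 2 d" "R 34 = 1" "R 6 = 3"
    and Q: "\<And>n' R'. n' \<le> n + 8 * d + 8 \<Longrightarrow> (\<And>r. r \<noteq> 27 \<Longrightarrow> r \<noteq> 34 \<Longrightarrow> r \<noteq> 6 \<Longrightarrow> R' r = R r) \<Longrightarrow>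
       R' 34 = k \<Longrightarrow> R' 6 = b \<Longrightarrow> Q R' M n'"
  shows "wp (While 27 (block [Div 27 27 2, Add 34 34 1, Mult 6 6 3])) \<beta> Q R M n"
proof (rule wp_While[where I = "\<lambda>R' M' n'. M' = M \<and> (\<forall>r. r \<noteq> 27 \<longrightarrow> r \<noteq> 34 \<longrightarrow> r \<noteq> 6 \<longrightarrow> R' r = R r) \<and> R' 27 \<le> d \<and>
      R' 34 + floorlog 2 (R' 27) = k \<and> R' 6 = 3 ^ R' 34 \<and> n' + 8 \<le> n + 8 * R' 34"], goal_cases)
  case 1
  then show ?case using r floorlog_le_self[of d] by (simp add: k)
next
  case (2 R' M' n')
  then show ?case using d_less by simp
next
  case (3 R' M' n')
  then have "R' 34 = k" by (simp add: floorlog_zero)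
  moreover from this have "Suc n' \<le> n + 8 * d + 8" using 3 k_bounds by linarith
  ultimately show ?case using 3 by (auto simp: bk intro!: Q)
next
  case (4 R' M' n')
  then have nz: "R' 27 \<noteq> 0" by simp
  have fl: "R' 34 + Suc (floorlog 2 (R' 27 div 2)) = k"
    using 4 floorlog_step[OF nz] by simp
  then have "R' 34 \<le> k" by linarith
  then have "R' 34 < 2 ^ \<beta>" "3 ^ R' 34 \<le> (3 :: nat) ^ k" using k_bounds by (auto intro: power_increasing)
  then have b: "R' 34 < 2 ^ \<beta>" "3 ^ R' 34 < (2::nat) ^ \<beta>" using k_bounds(4) D_less by linarith+
  have b2: "R' 27 < 2 ^ \<beta>" using 4 d_less by auto
  have f: "R' 1 = 1" "R' 2 = 2" "R' 3 = 3" using 4 r by auto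
  have "R' 27 div 2 < R' 27" "R' 27 div 2 \<le> d" using nz 4 by auto
  then show ?case using 4 fl b b2 f one_less by (simp add: one_less[simplified])
qed

definition init_cost :: nat where "init_cost = 12 * D ^ 3 + 6 * q + 14 * d + 200"

lemma vc_init_com:
  assumes Q: "\<And>n' R'. n' \<le> n + init_cost \<Longrightarrow> fixed_regs R' \<Longrightarrow> R' 13 = nA \<Longrightarrow> R' 14 = N \<Longrightarrow> R' 15 = 3 \<Longrightarrow> R' 16 = 0 \<Longrightarrow> Q R' M0 n'"
  shows "vc init_com \<beta> Q (\<lambda>_. 0) M0 n"
proof -
  have N: "N - nA + nA = N" "N < 2 ^ \<beta>" "nA < 2 ^ \<beta>" "N - nA < 2 ^ \<beta>" "N * d < 2 ^ \<beta>" "off < 2 ^ \<beta>" "3 + N * d = off" "N * d + 3 = off"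
    using nA off big(1) by auto
  have b2: "b * b = b ^ 2" "b ^ 2 * b ^ 2 = b ^ 4" "b ^ 4 * b ^ 4 = b ^ 8" "b ^ 8 * b ^ 8 = D"
    by (simp_all add: Db flip: power_add power2_eq_square)
  have "b ^ i \<le> D" if "i \<le> 16" for i unfolding Db using b that by (intro power_increasing) auto
  then have bl: "b ^ 1 \<le> D" "b ^ 2 \<le> D" "b ^ 4 \<le> D" "b ^ 8 \<le> D" by (meson one_le_numeral numeral_le_iff semiring_norm)+
  then have bl: "b < 2 ^ \<beta>" "b ^ 2 < 2 ^ \<beta>" "b ^ 4 < 2 ^ \<beta>" "b ^ 8 < 2 ^ \<beta>" using D_less by auto
  have s2: "(k + 9) * (k + 9) = (k + 9) ^ 2" "(k + 9) ^ 2 * (k + 9) ^ 2 = (k + 9) ^ 4" "(k + 9) ^ 4 * (k + 9) ^ 2 = S"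
    by (simp_all add: Sk flip: power_add power2_eq_square)
  have "(k + 9) ^ i \<le> S" if "i \<le> 6" for i unfolding Sk using that by (intro power_increasing) auto
  then have "(k + 9) ^ 2 \<le> S" "(k + 9) ^ 4 \<le> S" by simp_all
  then have sl: "(k + 9) ^ 2 < 2 ^ \<beta>" "(k + 9) ^ 4 < 2 ^ \<beta>" "S < 2 ^ \<beta>" "k + 9 < 2 ^ \<beta>"
    using S D_less k_bounds(5) by linarith+
  have "D * D * D * 2 = 2 * D ^ 3" by (simp add: power3_eq_cube)
  moreover have "D * D \<le> D * D * D" "D * D * D \<le> D * D * D * 2" using D2 by auto
  ultimately have Dl: "D * D < 2 ^ \<beta>" "D * D * D < 2 ^ \<beta>" "D * D * D * 2 < 2 ^ \<beta>" "D * D * D * 2 = 2 * D ^ 3"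
    using X_ge X_less by linarith+
  define P where "P = (S * S) ^ q"
  have X1: "1 \<le> X" using X_ge by simp
  have P1: "1 \<le> P" using S by (simp add: P_def)
  have W: "P * X * D * (d + 1) * (d + 1) = Wc" by (simp add: Wck P_def power2_eq_square algebra_simps)
  have Wl: "Wc < 2 ^ \<beta>"
    using le_mult_pos[of "(d + 1) ^ (2 * d) + 1" Wc] big2(1) by (simp add: mult.commute)
  have "P \<le> P * X" "P * X \<le> P * X * D" "P * X * D \<le> P * X * D * (d + 1)" "P * X * D * (d + 1) \<le> P * X * D * (d + 1) * (d + 1)"
    using X1 D2 by (auto intro!: le_mult_pos)
  then have Pl: "P < 2 ^ \<beta>" "P * X < 2 ^ \<beta>" "P * X * D < 2 ^ \<beta>" "P * X * D * (d + 1) < 2 ^ \<beta>" "P * X * D * (d + 1) * (d + 1) < 2 ^ \<beta>"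
    using W Wl by linarith+
  have "S * S \<le> P" unfolding P_def using S by (simp add: qk)
  then have SS: "S * S < 2 ^ \<beta>" using Pl by linarith
  have nine: "9 < (2::nat) ^ \<beta>" using sl(4) by linarith
  have q: "Suc (d div k) = q" "d div k < 2 ^ \<beta>" using qk big(4) by auto
  have D3l: "2 * D ^ 3 < 2 ^ \<beta>" using Dl by simp
  note bounds = D3l Db[symmetric] Sk[symmetric] N b2 bl s2 sl Dl Pl Pl[simplified] SS nine q one_less one_less[simplified] d_less2 d_less[simplified] D_less X_less big(4) k_bounds(3)
  show ?thesis
    unfolding init_com_def block.simps
    apply (simp add: bounds M0' M0'[simplified])
    apply (rule vc_bits_loop[unfolded block.simps One_nat_def])
        apply simp_all[4]
    apply (simp add: bounds)
    apply (rule vc_block_loop[unfolded block.simps One_nat_def])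
          apply simp_all[6]
    apply (simp add: bounds)
    apply (rule vc_pow_com)
              apply (simp_all add: bounds flip: X)[10]
    apply (simp add: bounds flip: X)
    apply (rule vc_pow_com)
              apply (simp_all add: bounds flip: P_def)[10]
    apply (simp add: bounds flip: X P_def)
    apply (rule Q)
         apply (simp add: init_cost_def)
        apply (unfold fixed_regs_def)[1]
        apply (simp add: bounds hd W[simplified])
       apply (simp_all add: N)
    done
qed

definition search_cost :: nat where
  "search_cost = init_cost + N * (vector_cost + 2) + 30 * d + 60"

text \<open>If nothing is reported, a shared cell does not yet show that the colliding pair itself
  clashes, since the mark of \<open>i\<close> may have been overwritten. What survives is that some
  vector \<open>i'\<close> of A with this very label clashes with \<open>j\<close>. For a good table
  this is impossible.\<close>

lemma vc_search_com:
  assumes none: "\<And>n' R' M'. n' \<le> search_cost \<Longrightarrow> M' 0 = 0 \<Longrightarrow>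
      (\<And>i j w w'. i < nA \<Longrightarrow> nA \<le> j \<Longrightarrow> j < N \<Longrightarrow> w < Wm \<Longrightarrow> w' < Wm \<Longrightarrow> address 0 (val i) w = address 1 (val j) w' \<Longrightarrow>
         \<exists>i'<nA. \<exists>w''<Wm. address 0 (val i') w'' = address 1 (val j) w' \<and> clash d (val i') (val j) \<noteq> 0) \<Longrightarrow> Q R' M' n'"
    and some: "\<And>n' R' M' i j. n' \<le> search_cost \<Longrightarrow> i < nA \<Longrightarrow> j < N \<Longrightarrow> nA \<le> j \<Longrightarrow> clash d (val i) (val j) = 0 \<Longrightarrow>
      M' 0 = 1 \<Longrightarrow> (\<And>a. a < d \<Longrightarrow> M' (1 + a) = vec i ! a) \<Longrightarrow> (\<And>a. a < d \<Longrightarrow> M' (d + 1 + a) = vec j ! a) \<Longrightarrow> Q R' M' n'"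
  shows "vc search_com \<beta> Q (\<lambda>_. 0) M0 0"
proof -
  define C where "C = vector_cost + 2"
  define I where "I = (\<lambda>R M n. fixed_regs R \<and> sound R M \<and> R 14 \<le> N \<and> covers (visited (N - R 14) Wm) R M \<and>
     R 13 = nA - (N - R 14) \<and> R 15 = 3 + (N - R 14) * d \<and> n + R 14 * C \<le> init_cost + N * C + 10)"
  have loop: "wp (While 14 vector_com) \<beta> (vc (Seq output_com Skip) \<beta> Q) R0 M n0" if "I R0 M n0" for R0 M n0
  proof (rule wp_While[where I = I])
    show "I R0 M n0" by fact
  next
    fix R M n assume "I R M n"
    then show "R 14 < 2 ^ \<beta>" using off(2) by (simp add: I_def)
  next
    fix R M n assume I: "I R M n" "R 14 = 0"
    then have f: "fixed_regs R" and s: "sound R M" and c: "covers (visited N Wm) R M"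
      and n: "n \<le> init_cost + N * C + 10" by (auto simp: I_def)
    show "vc (Seq output_com Skip) \<beta> Q R M (Suc n)"
      unfolding vc.simps(10)
    proof (rule vc_output_com[OF f s], goal_cases)
      case (1 n' R' M')
      have "Q R' M' (Suc n')"
      proof (rule none)
        show "Suc n' \<le> search_cost" using 1(1) n by (simp add: search_cost_def C_def)
        show "M' 0 = 0" by (rule 1(3))
      next
        fix i j w w' assume ij: "i < nA" "nA \<le> j" "j < N" "w < Wm" "w' < Wm" and e: "address 0 (val i) w = address 1 (val j) w'"
        have v: "(i, w) \<in> visited N Wm" "(j, w') \<in> visited N Wm" using ij by (auto simp: visited_def)
        have nz: "M (address 1 (val j) w') \<noteq> 0" using c v(1) ij e by (auto simp: covers_def)
        have "clash d (M (address 1 (val j) w') - 1) (val j) \<noteq> 0"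
          using c v(2) ij nz 1(2) unfolding covers_def by fastforce
        moreover have "\<exists>i'<nA. \<exists>w''<Wm. address 1 (val j) w' = address 0 (val i') w'' \<and> M (address 1 (val j) w') = val i' + 1"
          using s nz address_ge[of 1 "val j" w'] unfolding sound_def by blast
        then obtain i' w'' where "i' < nA" "w'' < Wm" "address 1 (val j) w' = address 0 (val i') w''" "M (address 1 (val j) w') = val i' + 1"
          by blast
        ultimately show "\<exists>i'<nA. \<exists>w''<Wm. address 0 (val i') w'' = address 1 (val j) w' \<and> clash d (val i') (val j) \<noteq> 0"
          by (intro exI[of _ i'] exI[of _ w''] conjI) auto
      qed
      then show ?case by simp
    next
      case (2 n' R' M' i j)
      have "Q R' M' (Suc n')"
        by (rule some[OF _ 2(2-8)]) (use 2(1) n in \<open>simp add: search_cost_def C_def\<close>)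
      then show ?case by simp
    qed
  next
    fix R M n assume I: "I R M n" and nz: "R 14 \<noteq> 0"
    define m where "m = N - R 14"
    have f: "fixed_regs R" and s: "sound R M" and c: "covers (visited m Wm) R M" and mN: "m < N"
      and r: "R 13 = nA - m" "R 14 = N - m" "R 15 = 3 + m * d"
      and n: "n + R 14 * C \<le> init_cost + N * C + 10"
      using I nz unfolding I_def m_def by auto
    have "Suc (N - Suc m) = R 14" using r mN by simp
    then have n2: "n + C + (N - Suc m) * C \<le> init_cost + N * C + 10"
      using n by (metis add.assoc mult_Suc add.commute)
    show "vc vector_com \<beta> (\<lambda>R' M' n'. I R' M' n' \<and> R' 14 < R 14) R M (Suc n)"
    proof (rule vc_vector_com[OF f s c mN r], goal_cases)
      case (1 n' R' M')
      have "fixed_regs R'" using f 1(4) by (simp add: fixed_regs_def)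
      moreover have "N - R' 14 = Suc m" using 1(6) mN by simp
      moreover have "n' + (N - Suc m) * C \<le> init_cost + N * C + 10" using 1(1) n2 by (simp add: C_def)
      moreover have "N - Suc m < N - m" using mN by simp
      ultimately show ?case using 1(2-) r by (simp add: I_def)
    qed
  qed
  show ?thesis
    unfolding search_com_def block.simps vc.simps(10,12)
  proof (rule vc_init_com, goal_cases)
    case (1 n' R')
    have "\<And>a. off \<le> a \<Longrightarrow> M0 a = 0" "\<And>a. M0 a < 2 ^ \<beta>" using M0 by auto
    then have "sound R' M0" using 1 by (simp add: sound_def)
    moreover have "covers (visited 0 Wm) R' M0" by (auto simp: covers_def visited_def)
    ultimately have "I R' M0 (Suc n')" using 1 by (simp add: I_def)
    then show ?case by (rule loop[unfolded vc.simps(10)])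
  qed
qed

end

section \<open>Sparse separating families\<close>

text \<open>
The conditional expectations argument: \<open>\<beta>\<close> is the average of the multiplicative weight \<open>f\<close> over one random member, and
each new member is chosen so that the expected final weight does not increase.
\<close>

lemma greedy_list:
  fixes f :: "'c \<Rightarrow> 's \<Rightarrow> real" and \<beta> :: "'c \<Rightarrow> real"
  assumes fin: "finite A" "A \<noteq> {}" and f: "\<And>c S. 0 \<le> f c S"
    and avg: "\<And>c. c \<in> C \<Longrightarrow> (\<Sum>S\<in>A. f c S) = \<beta> c * real (card A)"
  shows "(\<And>c. 0 \<le> \<alpha> c) \<Longrightarrow> \<exists>Ls. set Ls \<subseteq> A \<and> length Ls = N \<and>
    (\<Sum>c\<in>C. \<alpha> c * prod_list (map (f c) Ls)) \<le> (\<Sum>c\<in>C. \<alpha> c * \<beta> c ^ N)"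
proof (induction N arbitrary: \<alpha>)
  case 0
  then show ?case by (intro exI[of _ "[]"]) simp
next
  case (Suc N)
  have "\<exists>S\<in>A. (\<Sum>c\<in>C. (\<alpha> c * f c S) * \<beta> c ^ N) \<le> (\<Sum>c\<in>C. \<alpha> c * \<beta> c ^ Suc N)"
  proof (rule ccontr)
    assume "\<not> ?thesis"
    then have "(\<Sum>S\<in>A. \<Sum>c\<in>C. \<alpha> c * \<beta> c ^ Suc N) < (\<Sum>S\<in>A. \<Sum>c\<in>C. (\<alpha> c * f c S) * \<beta> c ^ N)"
      by (intro sum_strict_mono[OF fin]) (meson not_le_imp_less)
    also have "\<dots> = (\<Sum>c\<in>C. \<Sum>S\<in>A. (\<alpha> c * f c S) * \<beta> c ^ N)" by (rule sum.swap)
    also have "\<dots> = (\<Sum>c\<in>C. \<alpha> c * \<beta> c ^ N * (\<Sum>S\<in>A. f c S))"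
      by (simp add: sum_distrib_left sum_distrib_right mult_ac)
    also have "\<dots> = (\<Sum>c\<in>C. \<alpha> c * \<beta> c ^ Suc N * real (card A))"
      by (intro sum.cong refl) (simp add: avg mult_ac)
    also have "\<dots> = (\<Sum>S\<in>A. \<Sum>c\<in>C. \<alpha> c * \<beta> c ^ Suc N)"
      by (simp add: sum_distrib_left mult_ac)
    finally show False by simp
  qed
  then obtain S where S: "S \<in> A" "(\<Sum>c\<in>C. (\<alpha> c * f c S) * \<beta> c ^ N) \<le> (\<Sum>c\<in>C. \<alpha> c * \<beta> c ^ Suc N)"
    by blast
  have "\<And>c. 0 \<le> \<alpha> c * f c S" by (rule mult_nonneg_nonneg[OF Suc.prems f])
  from Suc.IH[of "\<lambda>c. \<alpha> c * f c S", OF this] obtain Ls where Ls: "set Ls \<subseteq> A" "length Ls = N"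
    "(\<Sum>c\<in>C. (\<alpha> c * f c S) * prod_list (map (f c) Ls)) \<le> (\<Sum>c\<in>C. (\<alpha> c * f c S) * \<beta> c ^ N)"
    by (elim exE conjE)
  have "(\<Sum>c\<in>C. \<alpha> c * prod_list (map (f c) (S # Ls))) \<le> (\<Sum>c\<in>C. \<alpha> c * \<beta> c ^ Suc N)"
    using order.trans[OF Ls(3) S(2)] by (simp only: list.map prod_list.Cons mult.assoc)
  then show ?case using Ls S(1) by (intro exI[of _ "S # Ls"]) simp
qed

lemma card_sandwiched_sets:
  fixes T Z :: "nat set"
  assumes "T \<subseteq> {..<k}" "Z \<subseteq> {..<k}" "T \<inter> Z = {}"
  shows "card {S. S \<subseteq> {..<k} \<and> card S = card T + m \<and> T \<subseteq> S \<and> S \<inter> Z = {}} = (k - card T - card Z) choose m"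
proof -
  have fin: "finite T" "finite Z" using assms finite_subset by blast+
  let ?U = "{..<k} - (T \<union> Z)"
  have U: "card ?U = k - card T - card Z"
    using assms fin by (subst card_Diff_subset) (auto simp: card_Un_disjoint)
  have "{S. S \<subseteq> {..<k} \<and> card S = card T + m \<and> T \<subseteq> S \<and> S \<inter> Z = {}} = (\<lambda>S. T \<union> S) ` {S. S \<subseteq> ?U \<and> card S = m}"
    (is "?L = ?f ` ?A")
  proof (intro equalityI subsetI)
    fix S assume S: "S \<in> ?L"
    then have "finite S" using finite_subset by blast
    then have "card (S - T) = m" using S fin by (auto simp: card_Diff_subset)
    then show "S \<in> ?f ` ?A" using S by (intro image_eqI[of _ _ "S - T"]) auto
  next
    fix S assume "S \<in> ?f ` ?A"
    then obtain S' where S': "S = T \<union> S'" "S' \<subseteq> ?U" "card S' = m" by blast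
    then have "card S = card T + m"
      using fin finite_subset[OF S'(2)] by (subst S'(1), subst card_Un_disjoint) auto
    then show "S \<in> ?L" using S' assms by auto
  qed
  moreover have "inj_on ?f ?A" by (auto simp: inj_on_def)
  ultimately have "card {S. S \<subseteq> {..<k} \<and> card S = card T + m \<and> T \<subseteq> S \<and> S \<inter> Z = {}} = card ?A"
    by (simp add: card_image)
  also have "\<dots> = card ?U choose m" by (rule n_subsets) simp
  finally show ?thesis by (simp add: U)
qed

lemma prod_list_two_power:
  "prod_list (map (\<lambda>S. if P S then 2 else (1 :: real)) Ls) = 2 ^ length (filter P Ls)"
  by (induction Ls) auto

text \<open>Take binary logarithms, using \<open>1 + q \<le> exp q \<le> 4 powr q\<close>. The
  origin of 13 is \<open>2 + k + 2 * (2 * k + 3) * R \<le> (5 * k + 8) * R \<le> 13 * k * R\<close>,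
  valid as \<open>k\<close> and \<open>R\<close> are at least 1.\<close>

lemma load_bound:
  fixes q N R :: real and L k :: nat
  assumes "2 ^ L < 4 * 2 ^ k * (1 + q) ^ n" "0 \<le> q" "q * n \<le> (2 * k + 3) * R" "1 \<le> R" "1 \<le> k"
  shows "L \<le> 13 * k * R"
proof -
  have "1 + q \<le> exp q" by (rule exp_ge_add_one_self)
  also have "exp q \<le> 2 powr (2 * q)"
    using ln2_ge_two_thirds assms(2) mult_right_mono[of 1 "2 * ln 2" q] by (simp add: powr_def mult_ac)
  finally have "(1 + q) ^ n \<le> (2 powr (2 * q)) ^ n" using assms(2) by (intro power_mono) auto
  also have "\<dots> = 2 powr (2 * q * n)" by (simp add: powr_powr flip: powr_realpow)
  finally have "(1 + q) ^ n \<le> 2 powr (2 * q * n)" .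
  then have "2 ^ L < 4 * 2 ^ k * 2 powr (2 * q * n)"
    using assms(1) by (smt (verit) mult_left_mono zero_le_power)
  also have "4 * 2 ^ k * 2 powr (2 * q * n) = 2 powr (2 + k + 2 * q * n)"
    by (simp add: powr_add powr_realpow)
  finally have "2 powr (real L) < 2 powr (2 + k + 2 * q * n)" by (simp add: powr_realpow)
  then have "L < 2 + k + 2 * q * n" by simp
  also have "\<dots> \<le> 2 + k + (4 * k + 6) * R" using assms(3) by (simp add: algebra_simps)
  also have "\<dots> \<le> (2 + k) * R + (4 * k + 6) * R" using assms(4) mult_left_mono[of 1 R "2 + real k"] by simp
  also have "\<dots> = (5 * k + 8) * R" by (simp add: algebra_simps)
  also have "\<dots> \<le> (13 * k) * R" using assms(4,5) by (intro mult_right_mono) auto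
  finally show ?thesis by simp
qed

text \<open>
Members are sets of size $t + m$, and \<open>greedy_list\<close> is applied with three kinds of weights at once: a pair $(T, Z)$ loses
its weight when it is separated, and the weights of $T$ and of $Z$ double whenever a member contains $T$ or avoids $Z$.
\<close>

lemma sparse_separating_family:
  fixes k t z m :: nat
  assumes k: "1 \<le> k" and le: "t + z + m \<le> k"
  obtains F :: "nat set set" where "F \<subseteq> Pow {..<k}"
    "\<And>T Z. T \<subseteq> {..<k} \<Longrightarrow> Z \<subseteq> {..<k} \<Longrightarrow> T \<inter> Z = {} \<Longrightarrow> card T = t \<Longrightarrow> card Z = z \<Longrightarrow>
      \<exists>S\<in>F. T \<subseteq> S \<and> S \<inter> Z = {}"
    "\<And>T. T \<subseteq> {..<k} \<Longrightarrow> card T = t \<Longrightarrow>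
      real (card {S \<in> F. T \<subseteq> S}) \<le> 13 * k * (real ((k - t) choose m) / real ((k - t - z) choose m))"
    "\<And>Z. Z \<subseteq> {..<k} \<Longrightarrow> card Z = z \<Longrightarrow>
      real (card {S \<in> F. S \<inter> Z = {}}) \<le> 13 * k * (real ((k - z) choose (t + m)) / real ((k - t - z) choose m))"
proof -
  define A where "A = {S. S \<subseteq> {..<k} \<and> card S = t + m}"
  define N0 where "N0 = real (k choose (t + m))"
  define c0 where "c0 = real ((k - t - z) choose m)"
  define c1 where "c1 = real ((k - t) choose m)"
  define c2 where "c2 = real ((k - z) choose (t + m))"
  have cA: "real (card A) = N0" unfolding A_def N0_def by (subst n_subsets) auto
  have zk: "{t..<t + z} \<subseteq> {..<k}" using le by auto
  have pos: "N0 > 0" "c0 > 0" "c1 > 0" "c2 > 0"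
    using le unfolding N0_def c0_def c1_def c2_def by auto
  have finA: "finite A" unfolding A_def by (rule finite_subset[of _ "Pow {..<k}"]) auto
  have neA: "A \<noteq> {}" using cA pos by auto
  define p where "p = c0 / N0"
  define q1 where "q1 = c1 / N0"
  define q2 where "q2 = c2 / N0"
  have cnt: "real (card {S \<in> A. T \<subseteq> S \<and> S \<inter> Z = {}}) = real ((k - card T - card Z) choose (t + m - card T))"
    if "T \<subseteq> {..<k}" "Z \<subseteq> {..<k}" "T \<inter> Z = {}" "card T \<le> t + m" for T Z
  proof -
    have "{S \<in> A. T \<subseteq> S \<and> S \<inter> Z = {}} =
      {S. S \<subseteq> {..<k} \<and> card S = card T + (t + m - card T) \<and> T \<subseteq> S \<and> S \<inter> Z = {}}"
      using that(4) by (auto simp: A_def)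
    then show ?thesis using card_sandwiched_sets[OF that(1-3)] by simp
  qed
  have cnt_le: "real (card {S \<in> A. P S}) \<le> N0" for P
    unfolding cA[symmetric] using finA by (auto intro: card_mono)
  have p: "0 < p" "p \<le> 1"
  proof -
    have "{..<t} \<inter> {t..<t + z} = {}" by auto
    then have "c0 \<le> N0" using cnt[of "{..<t}" "{t..<t+z}"] cnt_le[of "\<lambda>S. {..<t} \<subseteq> S \<and> S \<inter> {t..<t+z} = {}"] le zk
      unfolding c0_def by simp
    then show "0 < p" "p \<le> 1" using pos by (auto simp: p_def)
  qed
  have c01: "c0 \<le> c1" unfolding c0_def c1_def by (simp add: binomial_right_mono)
  have c02: "c0 \<le> c2"
  proof -
    have "{..<t} \<inter> {t..<t + z} = {}" by auto
    then have "c0 = real (card {S \<in> A. {..<t} \<subseteq> S \<and> S \<inter> {t..<t+z} = {}})"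
      using cnt[of "{..<t}" "{t..<t+z}"] le zk unfolding c0_def by simp
    also have "\<dots> \<le> real (card {S \<in> A. {} \<subseteq> S \<and> S \<inter> {t..<t+z} = {}})"
      using finA by (intro of_nat_mono card_mono) auto
    also have "\<dots> = c2" using cnt[of "{}" "{t..<t+z}"] le zk unfolding c2_def by (simp add: add.commute)
    finally show ?thesis .
  qed
  have c1N: "c1 \<le> N0" using cnt[of "{..<t}" "{}"] cnt_le[of "\<lambda>S. {..<t} \<subseteq> S \<and> S \<inter> {} = {}"] le zk
    unfolding c1_def by simp
  have c2N: "c2 \<le> N0" using cnt[of "{}" "{t..<t+z}"] cnt_le[of "\<lambda>S. {} \<subseteq> S \<and> S \<inter> {t..<t+z} = {}"] le zk
    unfolding c2_def by simp
  \<comment> \<open>A random member separates a given pair with probability \<open>p\<close>. After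
    \<open>N\<close> members each of the at most \<open>4 ^ k\<close> pairs remains with probability
    at most exp(-(2k + 2)), which makes an expected number of at most exp(-2) remaining pairs.
    Rounding up turns \<open>2 * k + 2\<close> into the \<open>2 * k + 3\<close> of
    \<open>load_bound\<close>.\<close>
  define N where "N = nat \<lceil>(2 * k + 2) / p\<rceil>"
  have N: "(2 * k + 2) / p \<le> N" "N \<le> (2 * k + 2) / p + 1"
    using p unfolding N_def by (auto simp: of_nat_nat)
  define C where "C = ((\<lambda>(T, Z). (0::nat, T, Z)) ` {(T, Z). T \<subseteq> {..<k} \<and> Z \<subseteq> {..<k} \<and> T \<inter> Z = {} \<and> card T = t \<and> card Z = z})
     \<union> (\<lambda>T. (1, T, {})) ` {T. T \<subseteq> {..<k} \<and> card T = t} \<union> (\<lambda>Z. (2, {}, Z)) ` {Z. Z \<subseteq> {..<k} \<and> card Z = z}"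
    (is "C = ?C0 \<union> ?C1 \<union> ?C2")
  define f :: "nat \<times> nat set \<times> nat set \<Rightarrow> nat set \<Rightarrow> real" where
    "f = (\<lambda>(i, T, Z) S. if i = 0 then (if T \<subseteq> S \<and> S \<inter> Z = {} then 0 else 1)
       else (if T \<subseteq> S \<and> S \<inter> Z = {} then 2 else 1))"
  define b :: "nat \<times> nat set \<times> nat set \<Rightarrow> real" where
    "b = (\<lambda>(i, T, Z). if i = 0 then 1 - p else if i = 1 then 1 + q1 else 1 + q2)"
  \<comment> \<open>There are at most \<open>2 ^ k\<close> sets of twos and as many sets of zeros;
    the normalisation lets each kind contribute at most 1/4. With less than 1/2 from the pairs the
    total is below 1, hence so is every single term: no pair keeps its weight 1, and no set is hit
    too often.\<close>
  define a :: "nat \<times> nat set \<times> nat set \<Rightarrow> real" where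
    "a = (\<lambda>(i, T, Z). if i = 0 then 1 else if i = 1 then 1 / (4 * 2 ^ k * (1 + q1) ^ N) else 1 / (4 * 2 ^ k * (1 + q2) ^ N))"
  have q0: "0 \<le> q1" "0 \<le> q2" using pos by (auto simp: q1_def q2_def)
  have f0: "0 \<le> f c S" for c S by (auto simp: f_def split: prod.split)
  have a0: "0 \<le> a c" for c using q0 by (auto simp: a_def split: prod.split)
  have avg: "(\<Sum>S\<in>A. f c S) = b c * real (card A)" if "c \<in> C" for c
  proof -
    have s0: "(\<Sum>S\<in>A. (if P S then x else (1::real))) = N0 + (x - 1) * real (card {S \<in> A. P S})" for P and x :: real
    proof -
      have "(\<Sum>S\<in>A. (if P S then x else (1::real))) = (\<Sum>S\<in>A. 1 + (x - 1) * (if P S then 1 else 0))"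
        by (intro sum.cong) auto
      also have "\<dots> = N0 + (x - 1) * (\<Sum>S\<in>A. (if P S then 1 else 0))"
        by (simp add: sum.distrib cA flip: sum_distrib_left)
      also have "(\<Sum>S\<in>A. (if P S then 1 else (0::real))) = real (card {S \<in> A. P S})"
        using finA by (simp add: sum.If_cases Int_def)
      finally show ?thesis .
    qed
    from that consider (0) T Z where "c = (0, T, Z)" "T \<subseteq> {..<k}" "Z \<subseteq> {..<k}" "T \<inter> Z = {}" "card T = t" "card Z = z"
      | (1) T where "c = (1, T, {})" "T \<subseteq> {..<k}" "card T = t"
      | (2) Z where "c = (2, {}, Z)" "Z \<subseteq> {..<k}" "card Z = z"
      unfolding C_def by auto
    then show ?thesis
    proof cases
      case 0
      have "(\<Sum>S\<in>A. f c S) = (\<Sum>S\<in>A. if T \<subseteq> S \<and> S \<inter> Z = {} then 0 else 1)"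
        by (simp add: f_def 0(1))
      also have "\<dots> = N0 + (0 - 1) * real (card {S \<in> A. T \<subseteq> S \<and> S \<inter> Z = {}})" by (rule s0)
      also have "real (card {S \<in> A. T \<subseteq> S \<and> S \<inter> Z = {}}) = c0"
        using cnt[of "T" "Z"] 0 by (simp add: c0_def add.commute)
      also have "N0 + (0 - 1) * c0 = b c * real (card A)"
        using pos(1) by (simp add: b_def 0(1) p_def cA field_simps)
      finally show ?thesis .
    next
      case 1
      have "(\<Sum>S\<in>A. f c S) = (\<Sum>S\<in>A. if T \<subseteq> S \<and> S \<inter> {} = {} then 2 else 1)"
        by (simp add: f_def 1(1))
      also have "\<dots> = N0 + (2 - 1) * real (card {S \<in> A. T \<subseteq> S \<and> S \<inter> {} = {}})" by (rule s0)
      also have "real (card {S \<in> A. T \<subseteq> S \<and> S \<inter> {} = {}}) = c1"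
        using cnt[of "T" "{}"] 1 by (simp add: c1_def add.commute)
      also have "N0 + (2 - 1) * c1 = b c * real (card A)"
        using pos(1) by (simp add: b_def 1(1) q1_def cA field_simps)
      finally show ?thesis .
    next
      case 2
      have "(\<Sum>S\<in>A. f c S) = (\<Sum>S\<in>A. if {} \<subseteq> S \<and> S \<inter> Z = {} then 2 else 1)"
        by (simp add: f_def 2(1))
      also have "\<dots> = N0 + (2 - 1) * real (card {S \<in> A. {} \<subseteq> S \<and> S \<inter> Z = {}})" by (rule s0)
      also have "real (card {S \<in> A. {} \<subseteq> S \<and> S \<inter> Z = {}}) = c2"
        using cnt[of "{}" "Z"] 2 by (simp add: c2_def add.commute)
      also have "N0 + (2 - 1) * c2 = b c * real (card A)"
        using pos(1) by (simp add: b_def 2(1) q2_def cA field_simps)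
      finally show ?thesis .
    qed
  qed
  have "\<exists>Ls. set Ls \<subseteq> A \<and> length Ls = N \<and> (\<Sum>c\<in>C. a c * prod_list (map (f c) Ls)) \<le> (\<Sum>c\<in>C. a c * b c ^ N)"
    by (rule greedy_list[OF finA neA]) (use f0 avg a0 in simp_all)
  then obtain Ls where Ls: "set Ls \<subseteq> A" "(\<Sum>c\<in>C. a c * prod_list (map (f c) Ls)) \<le> (\<Sum>c\<in>C. a c * b c ^ N)"
    by (elim exE conjE)
  have "finite {(T, Z). T \<subseteq> {..<k} \<and> Z \<subseteq> {..<k} \<and> T \<inter> Z = {} \<and> card T = t \<and> card Z = z}"
    by (rule finite_subset[of _ "Pow {..<k} \<times> Pow {..<k}"]) auto
  then have finC: "finite ?C0" "finite ?C1" "finite ?C2"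
    by simp_all
  have finCC: "finite C" using finC unfolding C_def by simp
  have "(\<Sum>c\<in>C. a c * b c ^ N) = (\<Sum>c\<in>?C0. a c * b c ^ N) + (\<Sum>c\<in>?C1. a c * b c ^ N) + (\<Sum>c\<in>?C2. a c * b c ^ N)"
  proof -
    have "?C0 \<inter> ?C1 = {}" "(?C0 \<union> ?C1) \<inter> ?C2 = {}" by auto
    then show ?thesis unfolding C_def using finC by (simp add: sum.union_disjoint)
  qed
  also have "(\<Sum>c\<in>?C0. a c * b c ^ N) < 1 / 2"
  proof -
    have "(\<Sum>c\<in>?C0. a c * b c ^ N) = (\<Sum>c\<in>?C0. (1 - p) ^ N)"
      by (intro sum.cong) (auto simp: a_def b_def)
    also have "\<dots> = real (card ?C0) * (1 - p) ^ N" by simp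
    also have "\<dots> \<le> 4 ^ k * (1 - p) ^ N"
    proof (rule mult_right_mono)
      have "card ?C0 \<le> card (Pow {..<k} \<times> Pow {..<k})"
        by (rule order.trans[OF card_image_le card_mono]) (auto intro: finite_subset[of _ "Pow {..<k} \<times> Pow {..<k}"])
      also have "\<dots> = 4 ^ k"
        by (simp add: card_cartesian_product card_Pow flip: power_mult_distrib)
      finally have "real (card ?C0) \<le> real (4 ^ k)" by (rule of_nat_mono)
      then show "real (card ?C0) \<le> 4 ^ k" by simp
    qed (use p in simp)
    finally have s1: "(\<Sum>c\<in>?C0. a c * b c ^ N) \<le> 4 ^ k * (1 - p) ^ N" .
    have "(1 - p) ^ N \<le> exp (- p) ^ N" using p exp_ge_add_one_self[of "-p"] by (intro power_mono) auto
    also have "\<dots> = exp (- (p * N))" by (simp flip: exp_of_nat_mult add: mult.commute)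
    also have "\<dots> \<le> exp (- (2 * real k + 2))" using N(1) p by (simp add: field_simps)
    finally have s2: "4 ^ k * (1 - p) ^ N \<le> 4 ^ k * exp (- (2 * real k + 2))" by simp
    have "exp (- (2 * real k + 2)) = exp (real k * (- 2)) * exp (- 2)" by (simp flip: exp_add)
    also have "exp (real k * (- 2)) = exp (- 2) ^ k" by (rule exp_of_nat_mult)
    finally have s3: "4 ^ k * exp (- (2 * real k + 2)) = (4 * exp (- 2)) ^ k * exp (- 2)"
      by (simp add: power_mult_distrib)
    have "2 \<le> exp (1::real)" using exp_ge_add_one_self[of "1::real"] by simp
    then have "4 \<le> exp (1::real) * exp 1" using mult_mono[of 2 "exp (1::real)" 2 "exp 1"] by simp
    then have "4 \<le> exp (2::real)" by (simp flip: exp_add)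
    then have e: "4 * exp (- 2) \<le> (1::real)" by (simp add: exp_minus field_simps)
    then have "(4 * exp (- 2)) ^ k \<le> (1::real)" by (intro power_le_one) auto
    then have "(4 * exp (- 2)) ^ k * exp (- 2) \<le> 1 * exp (- (2::real))" by (rule mult_right_mono) simp
    then show ?thesis using s1 s2 s3 e by linarith
  qed
  also have "(\<Sum>c\<in>?C1. a c * b c ^ N) \<le> 1 / 4"
  proof -
    have "(\<Sum>c\<in>?C1. a c * b c ^ N) = (\<Sum>c\<in>?C1. 1 / (4 * 2 ^ k))"
      using q0 by (intro sum.cong) (auto simp: a_def b_def add_pos_nonneg[THEN less_imp_neq, symmetric])
    also have "\<dots> = real (card ?C1) / (4 * 2 ^ k)" by simp
    also have "\<dots> \<le> 2 ^ k / (4 * 2 ^ k)"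
    proof (rule divide_right_mono)
      have "card ?C1 \<le> card (Pow {..<k})"
        by (rule order.trans[OF card_image_le card_mono]) (auto intro: finite_subset[of _ "Pow {..<k}"])
      then have "real (card ?C1) \<le> real (2 ^ k)" by (simp only: card_Pow finite_lessThan card_lessThan of_nat_le_iff)
      then show "real (card ?C1) \<le> 2 ^ k" by simp
    qed simp
    finally show ?thesis by simp
  qed
  also have "(\<Sum>c\<in>?C2. a c * b c ^ N) \<le> 1 / 4"
  proof -
    have "(\<Sum>c\<in>?C2. a c * b c ^ N) = (\<Sum>c\<in>?C2. 1 / (4 * 2 ^ k))"
      using q0 by (intro sum.cong) (auto simp: a_def b_def add_pos_nonneg[THEN less_imp_neq, symmetric])
    also have "\<dots> = real (card ?C2) / (4 * 2 ^ k)" by simp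
    also have "\<dots> \<le> 2 ^ k / (4 * 2 ^ k)"
    proof (rule divide_right_mono)
      have "card ?C2 \<le> card (Pow {..<k})"
        by (rule order.trans[OF card_image_le card_mono]) (auto intro: finite_subset[of _ "Pow {..<k}"])
      then have "real (card ?C2) \<le> real (2 ^ k)" by (simp only: card_Pow finite_lessThan card_lessThan of_nat_le_iff)
      then show "real (card ?C2) \<le> 2 ^ k" by simp
    qed simp
    finally show ?thesis by simp
  qed
  finally have lt1: "(\<Sum>c\<in>C. a c * prod_list (map (f c) Ls)) < 1" using Ls(2) by simp
  have pl0: "0 \<le> prod_list (map (f c) Ls)" for c
    by (induction Ls) (simp_all add: f0)
  have term1: "a c * prod_list (map (f c) Ls) < 1" if "c \<in> C" for c
  proof -
    have "a c * prod_list (map (f c) Ls) \<le> (\<Sum>c\<in>C. a c * prod_list (map (f c) Ls))"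
      by (rule member_le_sum[OF that _ finCC]) (simp only: a0 pl0 mult_nonneg_nonneg)
    then show ?thesis using lt1 by linarith
  qed
  have card_le: "card {S \<in> set Ls. P S} \<le> length (filter P Ls)" for P
    by (metis card_length set_filter)
  have load: "real (length (filter P Ls)) \<le> 13 * k * (c / c0)"
    if "2 ^ length (filter P Ls) < 4 * 2 ^ k * (1 + c / N0) ^ N" "c0 \<le> c" "c \<le> N0" for c P
  proof -
    have "c / N0 * N \<le> c / N0 * ((2 * k + 2) / p + 1)" using N(2) that pos by (intro mult_left_mono) auto
    also have "\<dots> = (2 * k + 2) * (c / c0) + c / N0" using pos by (simp add: p_def field_simps)
    also have "c / N0 \<le> 1 * (c / c0)" using that pos p by (simp add: p_def field_simps)
    finally have "c / N0 * real N \<le> real (2 * k + 3) * (c / c0)" by (simp add: algebra_simps)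
    moreover have "0 \<le> c / N0" "1 \<le> c / c0" using that pos by auto
    ultimately show ?thesis using load_bound[OF that(1)] k by blast
  qed
  show ?thesis
  proof (rule that[of "set Ls"])
    show "set Ls \<subseteq> Pow {..<k}" using Ls(1) by (auto simp: A_def)
    fix T Z assume TZ: "T \<subseteq> {..<k}" "Z \<subseteq> {..<k}" "T \<inter> Z = {}" "card T = t" "card Z = z"
    then have "(0, T, Z) \<in> C" unfolding C_def by auto
    from term1[OF this] have "prod_list (map (f (0, T, Z)) Ls) < 1" by (simp add: a_def)
    moreover have "prod_list (map (f (0, T, Z)) Ls) = 1" if "\<not> (\<exists>S\<in>set Ls. T \<subseteq> S \<and> S \<inter> Z = {})"
    proof -
      have "map (f (0, T, Z)) Ls = map (\<lambda>_. 1) Ls" using that by (auto simp: f_def)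
      then show ?thesis by (simp add: map_replicate_const)
    qed
    ultimately show "\<exists>S\<in>set Ls. T \<subseteq> S \<and> S \<inter> Z = {}" by fastforce
  next
    fix T assume T: "T \<subseteq> {..<k}" "card T = t"
    then have "(1, T, {}) \<in> C" unfolding C_def by auto
    from term1[OF this] have "2 ^ length (filter (\<lambda>S. T \<subseteq> S) Ls) / (4 * 2 ^ k * (1 + q1) ^ N) < (1::real)"
      by (simp add: a_def f_def prod_list_two_power)
    moreover have "0 < 4 * 2 ^ k * (1 + q1) ^ N" using q0 by (simp add: add_pos_nonneg)
    ultimately have "2 ^ length (filter (\<lambda>S. T \<subseteq> S) Ls) < 4 * 2 ^ k * (1 + c1 / N0) ^ N"
      unfolding q1_def by (simp only: divide_less_eq_1_pos)
    from load[OF this c01 c1N] show "real (card {S \<in> set Ls. T \<subseteq> S}) \<le> 13 * k * (real ((k - t) choose m) / real ((k - t - z) choose m))"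
      using card_le[of "\<lambda>S. T \<subseteq> S"] unfolding c0_def c1_def by linarith
  next
    fix Z assume Z: "Z \<subseteq> {..<k}" "card Z = z"
    then have "(2, {}, Z) \<in> C" unfolding C_def by auto
    from term1[OF this] have "2 ^ length (filter (\<lambda>S. S \<inter> Z = {}) Ls) / (4 * 2 ^ k * (1 + q2) ^ N) < (1::real)"
      by (simp add: a_def f_def prod_list_two_power)
    moreover have "0 < 4 * 2 ^ k * (1 + q2) ^ N" using q0 by (simp add: add_pos_nonneg)
    ultimately have "2 ^ length (filter (\<lambda>S. S \<inter> Z = {}) Ls) < 4 * 2 ^ k * (1 + c2 / N0) ^ N"
      unfolding q2_def by (simp only: divide_less_eq_1_pos)
    from load[OF this c02 c2N] show "real (card {S \<in> set Ls. S \<inter> Z = {}}) \<le> 13 * k * (real ((k - z) choose (t + m)) / real ((k - t - z) choose m))"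
      using card_le[of "\<lambda>S. S \<inter> Z = {}"] unfolding c0_def c2_def by linarith
  qed
qed

section \<open>Tables of separating families\<close>

definition twos :: "nat \<Rightarrow> nat \<Rightarrow> nat set" where
  "twos k u = {i \<in> {..<k}. u div 3 ^ i mod 3 = 2}"

definition zeros :: "nat \<Rightarrow> nat \<Rightarrow> nat set" where
  "zeros k u = {i \<in> {..<k}. u div 3 ^ i mod 3 = 0}"

definition agree :: "nat \<Rightarrow> nat \<Rightarrow> nat \<Rightarrow> bool" where
  "agree k u v \<longleftrightarrow> twos k u \<inter> zeros k v = {} \<and> twos k v \<inter> zeros k u = {}"

text \<open>The bounds of \<open>sparse_separating_family\<close>: \<open>load1\<close> for the
  members containing a given set of twos, \<open>load2\<close> for those avoiding a given set of
  zeros. The argument \<open>m\<close> is the number of further elements of a member.\<close>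

definition load1 :: "nat \<Rightarrow> nat \<Rightarrow> nat \<Rightarrow> nat \<Rightarrow> real" where
  "load1 k t z m = 13 * k * (real ((k - t) choose m) / real ((k - t - z) choose m))"

definition load2 :: "nat \<Rightarrow> nat \<Rightarrow> nat \<Rightarrow> nat \<Rightarrow> real" where
  "load2 k t z m = 13 * k * (real ((k - z) choose (t + m)) / real ((k - t - z) choose m))"

definition radix :: "nat \<Rightarrow> nat \<Rightarrow> nat \<Rightarrow> nat \<Rightarrow> nat \<Rightarrow> nat" where
  "radix b D x \<rho> s = digit D x (((\<rho> * D + b) * D + s) * D) + 1"

definition letter :: "nat \<Rightarrow> nat \<Rightarrow> nat \<Rightarrow> nat \<Rightarrow> nat \<Rightarrow> nat \<Rightarrow> nat" where
  "letter D x \<rho> y s i = digit D x (((\<rho> * D + y) * D + s) * D + i)"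

section \<open>Coding tables as numbers\<close>

lemma digits_exist:
  fixes D :: nat
  assumes "\<And>i. i < n \<Longrightarrow> G i < D"
  shows "\<exists>x<D ^ n. \<forall>i<n. digit D x i = G i"
  using assms
proof (induction n arbitrary: G)
  case (Suc n)
  have "\<exists>x<D ^ n. \<forall>i<n. digit D x i = G (Suc i)" by (rule Suc.IH) (use Suc.prems in simp)
  then obtain x where x: "x < D ^ n" "\<And>i. i < n \<Longrightarrow> digit D x i = G (Suc i)" by blast
  have g: "G 0 < D" using Suc.prems by simp
  have "x * D + G 0 < (x + 1) * D" using g by simp
  also have "\<dots> \<le> D ^ n * D" using x(1) by (intro mult_le_mono1) simp
  finally have "x * D + G 0 < D ^ Suc n" by (simp add: mult.commute)
  moreover have "digit D (x * D + G 0) i = G i" if "i < Suc n" for i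
  proof (cases i)
    case 0
    then show ?thesis using g by (simp add: digit_def)
  next
    case (Suc j)
    have "(x * D + G 0) div D ^ Suc j = (x * D + G 0) div D div D ^ j"
      by (simp add: div_mult2_eq)
    also have "(x * D + G 0) div D = x" using g by simp
    finally show ?thesis using x(2)[of j] that Suc by (simp add: digit_def)
  qed
  ultimately show ?case by blast
qed simp

lemma table_exists:
  fixes D :: nat
  assumes "\<And>\<rho> y s i. f \<rho> y s i < D"
  obtains x where "x < D ^ (2 * D ^ 3)"
    "\<And>\<rho> y s i. \<rho> < 2 \<Longrightarrow> y < D \<Longrightarrow> s < D \<Longrightarrow> i < D \<Longrightarrow> letter D x \<rho> y s i = f \<rho> y s i"
proof -
  define G where "G n = f (n div D div D div D) (n div D div D mod D) (n div D mod D) (n mod D)" for n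
  obtain x where x: "x < D ^ (2 * D ^ 3)" "\<And>i. i < 2 * D ^ 3 \<Longrightarrow> digit D x i = G i"
    using digits_exist[of "2 * D ^ 3" G D] assms unfolding G_def by blast
  show ?thesis
  proof (rule that[OF x(1)])
    fix \<rho> y s i :: nat assume a: "\<rho> < 2" "y < D" "s < D" "i < D"
    let ?n = "((\<rho> * D + y) * D + s) * D + i"
    have "\<rho> * D + y + 1 \<le> (\<rho> + 1) * D" using a by simp
    also have "\<dots> \<le> 2 * D" using a by (intro mult_le_mono1) simp
    finally have "(\<rho> * D + y + 1) * D \<le> 2 * D * D" by (rule mult_le_mono1)
    then have "(\<rho> * D + y) * D + s + 1 \<le> 2 * D * D" using a by simp
    then have "((\<rho> * D + y) * D + s + 1) * D \<le> 2 * D * D * D" by (rule mult_le_mono1)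
    then have "?n < 2 * D ^ 3" using a by (simp add: power3_eq_cube)
    then have "digit D x ?n = G ?n" by (rule x(2))
    moreover have "?n div D = (\<rho> * D + y) * D + s" "?n mod D = i" using a by auto
    moreover have "((\<rho> * D + y) * D + s) div D = \<rho> * D + y" "((\<rho> * D + y) * D + s) mod D = s" using a by auto
    moreover have "(\<rho> * D + y) div D = \<rho>" "(\<rho> * D + y) mod D = y" using a by auto
    ultimately show "letter D x \<rho> y s i = f \<rho> y s i" by (simp add: letter_def G_def)
  qed
qed

lemma power_swap: "((a :: nat) ^ k) ^ n = (a ^ n) ^ k"
  by (simp add: mult.commute flip: power_mult)

text \<open>Everything is compared with \<open>3 ^ 16 = 43046721\<close>:
  \<open>k + 9 \<le> 10 ^ k\<close> takes care of the sixth power, and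
  \<open>(k + 1) ^ 6 * 4 ^ k \<le> 256 ^ k\<close>, where the additive 2 costs another factor
  \<open>3 ^ k\<close>. An exponent that is a power of two lets \<open>D\<close> be computed by
  squaring alone.\<close>

lemma size_bounds:
  assumes "1 \<le> k"
  shows "(k + 9) ^ 6 \<le> ((3::nat) ^ k) ^ 16" "(k + 1) ^ 6 * 4 ^ k + 2 \<le> ((3::nat) ^ k) ^ 16"
    "(3::nat) ^ k < (3 ^ k) ^ 16" "4 ^ k \<le> ((3::nat) ^ k) ^ 16"
proof -
  have e: "((3::nat) ^ k) ^ 16 = 43046721 ^ k" by (subst power_swap) simp
  have "k + 9 \<le> 10 ^ k" using assms by (induction k rule: dec_induct) auto
  then have "(k + 9) ^ 6 \<le> (10 ^ k) ^ 6" by (intro power_mono) auto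
  also have "\<dots> = 1000000 ^ k" by (subst power_swap) simp
  also have "\<dots> \<le> 43046721 ^ k" by (rule power_mono) auto
  finally show "(k + 9) ^ 6 \<le> ((3::nat) ^ k) ^ 16" using e by simp
  have "k < 2 ^ k" by (rule less_exp)
  then have "k + 1 \<le> 2 ^ k" by linarith
  then have "(k + 1) ^ 6 \<le> (2 ^ k) ^ 6" by (intro power_mono) auto
  also have "\<dots> = 64 ^ k" by (subst power_swap) simp
  finally have "(k + 1) ^ 6 * 4 ^ k \<le> 64 ^ k * 4 ^ k" by (rule mult_le_mono1)
  also have "\<dots> = 256 ^ k" by (simp flip: power_mult_distrib)
  finally have 1: "(k + 1) ^ 6 * 4 ^ k \<le> 256 ^ k" .
  have "(256::nat) ^ 1 \<le> 256 ^ k" using assms by (intro power_increasing) auto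
  then have "(k + 1) ^ 6 * 4 ^ k + 2 \<le> 3 ^ 1 * 256 ^ k" using 1 by simp
  also have "\<dots> \<le> 3 ^ k * 256 ^ k" using assms by (intro mult_le_mono1 power_increasing) auto
  also have "\<dots> = 768 ^ k" by (simp flip: power_mult_distrib)
  also have "\<dots> \<le> 43046721 ^ k" by (rule power_mono) auto
  finally show "(k + 1) ^ 6 * 4 ^ k + 2 \<le> ((3::nat) ^ k) ^ 16" using e by simp
  show "(3::nat) ^ k < (3 ^ k) ^ 16" using assms unfolding e by (intro power_strict_mono) auto
  show "4 ^ k \<le> ((3::nat) ^ k) ^ 16" unfolding e by (rule power_mono) auto
qed

lemma enumerate_finite:
  assumes "finite A"
  shows "\<exists>g. bij_betw g {..<card A} A"
  using ex_bij_betw_nat_finite[OF assms] by (simp add: lessThan_atLeast0)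

lemma inj_into_interval:
  assumes "finite A" "card A + l \<le> n"
  shows "\<exists>g. inj_on g A \<and> g ` A \<subseteq> {l..<n}"
proof -
  obtain g where g: "bij_betw g A {0..<card A}" using ex_bij_betw_finite_nat[OF assms(1)] by blast
  have "inj_on (\<lambda>x. g x + l) A" using g by (auto simp: bij_betw_def inj_on_def)
  moreover have "g x < card A" if "x \<in> A" for x using bij_betwE[OF g] that by simp
  then have "(\<lambda>x. g x + l) ` A \<subseteq> {l..<n}" using assms(2) by fastforce
  ultimately show ?thesis by blast
qed

text \<open>
A profile pairs a family separating the twos of $u$ from the zeros of $v$ with one for the twos of $v$ and the zeros of $u$.
Genuine entries are coded by numbers from 2 on; the fillers 0 for $A$ and 1 for $B$ never collide.
\<close>

lemma good_table_exists:
  fixes k :: nat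
  assumes k: "1 \<le> k"
  defines "b \<equiv> 3 ^ k" and "S \<equiv> (k + 9) ^ 6"
  defines "D \<equiv> b ^ 16"
  obtains x where "x < D ^ (2 * D ^ 3)"
    "\<And>u v s s' i i'. u < b \<Longrightarrow> v < b \<Longrightarrow> s < S \<Longrightarrow> s' < S \<Longrightarrow> i < D \<Longrightarrow> i' < D \<Longrightarrow>
       letter D x 0 u s i = letter D x 1 v s' i' \<Longrightarrow> agree k u v"
    "\<And>t1 z1 m1 t2 z2 m2. t1 + z1 + m1 \<le> k \<Longrightarrow> t2 + z2 + m2 \<le> k \<Longrightarrow>
       \<exists>s<S. real (radix b D x 0 s) \<le> load1 k t1 z1 m1 * load2 k t2 z2 m2 \<and>
         real (radix b D x 1 s) \<le> load2 k t1 z1 m1 * load1 k t2 z2 m2 \<and>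
         (\<forall>u<b. \<forall>v<b. agree k u v \<longrightarrow> card (twos k u) = t1 \<longrightarrow> card (zeros k v) = z1 \<longrightarrow>
            card (twos k v) = t2 \<longrightarrow> card (zeros k u) = z2 \<longrightarrow>
            (\<exists>i<radix b D x 0 s. \<exists>i'<radix b D x 1 s. letter D x 0 u s i = letter D x 1 v s i'))"
proof -
  have sz: "S \<le> D" "(k + 1) ^ 6 * 4 ^ k + 2 \<le> D" "b < D" "4 ^ k \<le> D"
    using size_bounds[OF k] by (auto simp: S_def D_def b_def)
  define good where "good = (\<lambda>(t, z, m) F. F \<subseteq> Pow {..<k} \<and>
     (\<forall>T Z. T \<subseteq> {..<k} \<longrightarrow> Z \<subseteq> {..<k} \<longrightarrow> T \<inter> Z = {} \<longrightarrow> card T = t \<longrightarrow> card Z = z \<longrightarrow> (\<exists>S\<in>F. T \<subseteq> S \<and> S \<inter> Z = {})) \<and>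
     (\<forall>T. T \<subseteq> {..<k} \<longrightarrow> card T = t \<longrightarrow> real (card {S \<in> F. T \<subseteq> S}) \<le> load1 k t z m) \<and>
     (\<forall>Z. Z \<subseteq> {..<k} \<longrightarrow> card Z = z \<longrightarrow> real (card {S \<in> F. S \<inter> Z = {}}) \<le> load2 k t z m))"
  define Ty where "Ty = {((t1, z1, m1), (t2, z2, m2)) | t1 z1 m1 t2 z2 m2. t1 + z1 + m1 \<le> k \<and> t2 + z2 + m2 \<le> (k::nat)}"
  have ex: "\<exists>F. good (t, z, m) F" if "t + z + m \<le> k" for t z m
  proof (rule sparse_separating_family[OF k that])
    fix F :: "nat set set" assume "F \<subseteq> Pow {..<k}"
      "\<And>T Z. T \<subseteq> {..<k} \<Longrightarrow> Z \<subseteq> {..<k} \<Longrightarrow> T \<inter> Z = {} \<Longrightarrow> card T = t \<Longrightarrow> card Z = z \<Longrightarrow> \<exists>S\<in>F. T \<subseteq> S \<and> S \<inter> Z = {}"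
      "\<And>T. T \<subseteq> {..<k} \<Longrightarrow> card T = t \<Longrightarrow> real (card {S \<in> F. T \<subseteq> S}) \<le> 13 * k * (real ((k - t) choose m) / real ((k - t - z) choose m))"
      "\<And>Z. Z \<subseteq> {..<k} \<Longrightarrow> card Z = z \<Longrightarrow> real (card {S \<in> F. S \<inter> Z = {}}) \<le> 13 * k * (real ((k - z) choose (t + m)) / real ((k - t - z) choose m))"
    then show "\<exists>F. good (t, z, m) F" unfolding good_def load1_def load2_def by (intro exI[of _ F]) simp
  qed
  define Fam where "Fam \<tau> = (SOME F. good \<tau> F)" for \<tau>
  have Fam: "good (t, z, m) (Fam (t, z, m))" if "t + z + m \<le> k" for t z m
    unfolding Fam_def by (rule someI_ex) (rule ex[OF that])
  have TyS: "Ty \<subseteq> ({..k} \<times> {..k} \<times> {..k}) \<times> ({..k} \<times> {..k} \<times> {..k})" by (auto simp: Ty_def)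
  have finTy: "finite Ty" by (rule finite_subset[OF TyS]) simp
  have cardTy: "card Ty \<le> (k + 1) ^ 6"
    using card_mono[OF _ TyS] by (simp add: card_cartesian_product power_eq_if numeral_eq_Suc algebra_simps)
  have "(k + 1) ^ 6 \<le> S" unfolding S_def by (rule power_mono) auto
  then obtain enc where enc: "inj_on enc Ty" "enc ` Ty \<subseteq> {0..<S}"
    using inj_into_interval[OF finTy, of 0 S] cardTy by auto
  \<comment> \<open>A letter records the profile and both members. As \<open>lab\<close> is
    injective, equal letters mean the same witnesses, whatever entries they were read from.\<close>
  define Lb where "Lb = Ty \<times> Pow {..<k} \<times> Pow {..<k}"
  have finLb: "finite Lb" using finTy by (simp add: Lb_def)
  have "card Lb = card Ty * (2 ^ k * 2 ^ k)" by (simp add: Lb_def card_cartesian_product card_Pow)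
  also have "(2::nat) ^ k * 2 ^ k = 4 ^ k" by (simp flip: power_mult_distrib)
  finally have "card Lb \<le> (k + 1) ^ 6 * 4 ^ k" using cardTy by simp
  then obtain lab where lab: "inj_on lab Lb" "lab ` Lb \<subseteq> {2..<D}"
    using inj_into_interval[OF finLb, of 2 D] sz by auto
  \<comment> \<open>A pair of members available to \<open>u\<close> in role 0 and to
    \<open>v\<close> in role 1 separates the twos of each from the zeros of the other, which is
    agreement. Contents whose digit counts do not fit the profile get no members, so the load bounds
    hold for every content.\<close>
  define A where "A \<rho> u = (\<lambda>(\<tau>1, \<tau>2). if (\<rho>::nat) = 0
      then (if card (twos k u) = fst \<tau>1 \<and> card (zeros k u) = fst (snd \<tau>2)
        then {S \<in> Fam \<tau>1. twos k u \<subseteq> S} \<times> {S \<in> Fam \<tau>2. S \<inter> zeros k u = {}} else {})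
      else (if card (twos k u) = fst \<tau>2 \<and> card (zeros k u) = fst (snd \<tau>1)
        then {S \<in> Fam \<tau>1. S \<inter> zeros k u = {}} \<times> {S \<in> Fam \<tau>2. twos k u \<subseteq> S} else {}))" for \<rho> u
  have famP: "Fam \<tau>1 \<subseteq> Pow {..<k}" "Fam \<tau>2 \<subseteq> Pow {..<k}" if \<tau>: "(\<tau>1, \<tau>2) \<in> Ty" for \<tau>1 \<tau>2
  proof -
    obtain t1 z1 m1 t2 z2 m2 where e: "\<tau>1 = (t1, z1, m1)" "\<tau>2 = (t2, z2, m2)" "t1 + z1 + m1 \<le> k" "t2 + z2 + m2 \<le> k"
      using \<tau> by (auto simp: Ty_def)
    show "Fam \<tau>1 \<subseteq> Pow {..<k}" "Fam \<tau>2 \<subseteq> Pow {..<k}"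
      using Fam[OF e(3)] Fam[OF e(4)] unfolding e good_def by simp_all
  qed
  have AP: "A \<rho> u \<tau> \<subseteq> Pow {..<k} \<times> Pow {..<k}" if "\<tau> \<in> Ty" for \<rho> u \<tau>
    using that famP[of "fst \<tau>" "snd \<tau>"] by (auto simp: A_def split: prod.splits if_splits)
  have finA: "finite (A \<rho> u \<tau>)" if "\<tau> \<in> Ty" for \<rho> u \<tau> by (rule finite_subset[OF AP[OF that]]) simp
  have cardA: "card (A \<rho> u \<tau>) \<le> 4 ^ k" if "\<tau> \<in> Ty" for \<rho> u \<tau>
    using card_mono[OF _ AP[OF that, of \<rho> u]] by (simp add: card_cartesian_product card_Pow flip: power_mult_distrib)
  define g where "g \<rho> u \<tau> = (SOME g. bij_betw g {..<card (A \<rho> u \<tau>)} (A \<rho> u \<tau>))" for \<rho> u \<tau>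
  have g: "bij_betw (g \<rho> u \<tau>) {..<card (A \<rho> u \<tau>)} (A \<rho> u \<tau>)" if "\<tau> \<in> Ty" for \<rho> u \<tau>
    unfolding g_def by (rule someI_ex[OF enumerate_finite[OF finA[OF that]]])
  \<comment> \<open>The radix is shared by all contents, as the program reads it before it looks at
    the block. Inserting 1 makes it positive, so that it can be stored diminished by 1 and fits
    below \<open>D\<close>.\<close>
  define rad where "rad \<rho> \<tau> = Max (insert 1 ((\<lambda>u. card (A \<rho> u \<tau>)) ` {..<b}))" for \<rho> \<tau>
  have rad_ge: "1 \<le> rad \<rho> \<tau>" "u < b \<Longrightarrow> card (A \<rho> u \<tau>) \<le> rad \<rho> \<tau>" for \<rho> u \<tau>
    unfolding rad_def by (auto intro: Max_ge)
  have rad_le: "real (rad \<rho> \<tau>) \<le> c" if "1 \<le> c" "\<And>u. u < b \<Longrightarrow> real (card (A \<rho> u \<tau>)) \<le> c" for \<rho> \<tau> c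
  proof -
    have "rad \<rho> \<tau> \<in> insert 1 ((\<lambda>u. card (A \<rho> u \<tau>)) ` {..<b})" unfolding rad_def by (rule Max_in) auto
    then show ?thesis using that by auto
  qed
  have radD: "rad \<rho> \<tau> \<le> D" if "\<tau> \<in> Ty" for \<rho> \<tau>
  proof -
    have "real (rad \<rho> \<tau>) \<le> real D"
    proof (rule rad_le)
      show "1 \<le> real D" using sz(2) by simp
      show "real (card (A \<rho> u \<tau>)) \<le> real D" for u
        using cardA[OF that, of \<rho> u] sz(4) by simp
    qed
    then show ?thesis by simp
  qed
  \<comment> \<open>The filler is written \<open>\<rho> mod 2\<close> because
    \<open>table_exists\<close> wants entries below \<open>D\<close> for every number
    \<open>\<rho>\<close>, not just for the two roles.\<close>
  define f where "f \<rho> y s i = (if s \<in> enc ` Ty then let \<tau> = the_inv_into Ty enc s in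
      (if y = b then rad \<rho> \<tau> - 1 else if i < card (A \<rho> y \<tau>) then lab (\<tau>, g \<rho> y \<tau> i) else \<rho> mod 2)
      else \<rho> mod 2)" for \<rho> y s i :: nat
  have inv: "the_inv_into Ty enc (enc \<tau>) = \<tau>" if "\<tau> \<in> Ty" for \<tau>
    by (rule the_inv_into_f_f[OF enc(1) that])
  have inA: "g \<rho> y \<tau> i \<in> A \<rho> y \<tau>" if "\<tau> \<in> Ty" "i < card (A \<rho> y \<tau>)" for \<rho> y \<tau> i
    using g[OF that(1), of \<rho> y] that(2) by (auto simp: bij_betw_def)
  have inLb: "(\<tau>, p) \<in> Lb" if "\<tau> \<in> Ty" "p \<in> A \<rho> y \<tau>" for \<tau> p \<rho> y
    using that AP[OF that(1), of \<rho> y] unfolding Lb_def by blast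
  have D2: "2 \<le> D" using sz by linarith
  have fD: "f \<rho> y s i < D" for \<rho> y s i
  proof (cases "s \<in> enc ` Ty")
    case True
    then obtain \<tau> where \<tau>: "\<tau> \<in> Ty" "s = enc \<tau>" by blast
    have rl: "rad \<rho> \<tau> - 1 < D" using radD[OF \<tau>(1), of \<rho>] rad_ge(1)[of \<rho> \<tau>] D2 by linarith
    show ?thesis
    proof (cases "i < card (A \<rho> y \<tau>)")
      case True
      then have "lab (\<tau>, g \<rho> y \<tau> i) < D" using inLb[OF \<tau>(1) inA[OF \<tau>(1) True]] lab(2) by auto
      then show ?thesis using \<tau> inv rl True by (simp add: f_def)
    next
      case False
      have "\<rho> mod 2 < D" using D2 by (meson less_le_trans mod_less_divisor zero_less_numeral)
      then show ?thesis using \<tau> inv rl False by (simp add: f_def)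
    qed
  next
    case False
    have "\<rho> mod 2 < D" using D2 by (meson less_le_trans mod_less_divisor zero_less_numeral)
    then show ?thesis using False by (simp add: f_def)
  qed
  obtain x where x: "x < D ^ (2 * D ^ 3)"
    "\<And>\<rho> y s i. \<rho> < 2 \<Longrightarrow> y < D \<Longrightarrow> s < D \<Longrightarrow> i < D \<Longrightarrow> letter D x \<rho> y s i = f \<rho> y s i"
    using table_exists[of f D] fD by blast
  have real_letter: "\<exists>\<tau>\<in>Ty. \<exists>p\<in>A \<rho> y \<tau>. f \<rho> y s i = lab (\<tau>, p)" if "f \<rho> y s i \<noteq> \<rho> mod 2" "y < b" for \<rho> y s i
  proof -
    have s: "s \<in> enc ` Ty" by (rule ccontr) (use that(1) in \<open>simp add: f_def\<close>)
    then obtain \<tau> where \<tau>: "\<tau> \<in> Ty" "s = enc \<tau>" by blast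
    have "i < card (A \<rho> y \<tau>)"
      by (rule ccontr) (use that \<tau> inv[OF \<tau>(1)] in \<open>simp add: f_def\<close>)
    then show ?thesis using \<tau> inv inA[OF \<tau>(1)] that(2) by (intro bexI[of _ \<tau>] bexI[of _ "g \<rho> y \<tau> i"]) (auto simp: f_def)
  qed
  have lab2: "2 \<le> lab (\<tau>, p)" if "\<tau> \<in> Ty" "p \<in> A \<rho> y \<tau>" for \<tau> p \<rho> y
    using inLb[OF that] lab(2) by auto
  show ?thesis
  proof (rule that[OF x(1)])
    fix u v s s' i i' assume a: "u < b" "v < b" "s < S" "s' < S" "i < D" "i' < D"
      and eq: "letter D x 0 u s i = letter D x 1 v s' i'"
    have e: "f 0 u s i = f 1 v s' i'" using x(2)[of 0 u s i] x(2)[of 1 v s' i'] a sz eq by simp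
    \<comment> \<open>A filler on one side would have to equal the different filler or a code of at
      least 2 on the other side.\<close>
    have ne: "f 0 u s i \<noteq> 0 mod 2" "f 1 v s' i' \<noteq> 1 mod 2"
    proof -
      have "f 0 u s i = 0 \<Longrightarrow> False"
        using real_letter[of 1 v s' i'] lab2 e a by fastforce
      then show "f 0 u s i \<noteq> 0 mod 2" by auto
      have "f 1 v s' i' = 1 \<Longrightarrow> False"
        using real_letter[of 0 u s i] lab2 e a by fastforce
      then show "f 1 v s' i' \<noteq> 1 mod 2" by auto
    qed
    obtain \<tau> p where p: "\<tau> \<in> Ty" "p \<in> A 0 u \<tau>" "f 0 u s i = lab (\<tau>, p)" using real_letter[OF ne(1) a(1)] by blast
    obtain \<tau>' p' where p': "\<tau>' \<in> Ty" "p' \<in> A 1 v \<tau>'" "f 1 v s' i' = lab (\<tau>', p')" using real_letter[OF ne(2) a(2)] by blast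
    have "(\<tau>, p) = (\<tau>', p')"
      using inj_onD[OF lab(1) _ inLb[OF p(1,2)] inLb[OF p'(1,2)]] p(3) p'(3) e by simp
    then have pp: "p \<in> A 0 u \<tau>" "p \<in> A 1 v \<tau>" using p p' by auto
    show "agree k u v" using pp unfolding A_def agree_def by (auto split: prod.splits if_splits)
  next
    fix t1 z1 m1 t2 z2 m2 assume v: "t1 + z1 + m1 \<le> k" "t2 + z2 + m2 \<le> k"
    let ?\<tau> = "((t1, z1, m1), (t2, z2, m2))"
    have T: "?\<tau> \<in> Ty" using v by (auto simp: Ty_def)
    define s where "s = enc ?\<tau>"
    have s: "s < S" "s < D" using enc(2) T sz unfolding s_def by auto
    have rx: "radix b D x \<rho> s = rad \<rho> ?\<tau>" if "\<rho> < 2" for \<rho>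
    proof -
      have "radix b D x \<rho> s = letter D x \<rho> b s 0 + 1" by (simp add: radix_def letter_def)
      also have "letter D x \<rho> b s 0 = f \<rho> b s 0" using x(2) that sz s by simp
      also have "\<dots> = rad \<rho> ?\<tau> - 1" using T inv[OF T] unfolding f_def s_def by simp
      finally show ?thesis using rad_ge(1)[of \<rho> ?\<tau>] by simp
    qed
    note G1 = Fam[OF v(1), unfolded good_def, simplified] and G2 = Fam[OF v(2), unfolded good_def, simplified]
    have sub: "twos k u \<subseteq> {..<k}" "zeros k u \<subseteq> {..<k}" for u by (auto simp: twos_def zeros_def)
    \<comment> \<open>The load bounds must also dominate the default value 1 of \<open>rad\<close>.
      For \<open>load2\<close> this follows from a single term of Vandermonde's identity.\<close>
    have l1: "1 \<le> load1 k t z m" "1 \<le> load2 k t z m" if w: "t + z + m \<le> k" for t z m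
    proof -
      have c: "0 < ((k - t - z) choose m)" using w by simp
      have le1: "(k - t - z) choose m \<le> (k - t) choose m" by (rule binomial_right_mono) simp
      have le2: "(k - t - z) choose m \<le> (k - z) choose (t + m)"
      proof -
        have "((k - t - z) choose m) * (t choose t) \<le> (k - t - z + t) choose (m + t)"
        proof -
          have "((k - t - z) choose m) * (t choose t) \<le> (\<Sum>i\<le>m + t. ((k - t - z) choose i) * (t choose (m + t - i)))"
            using member_le_sum[of m "{..m + t}" "\<lambda>i. ((k - t - z) choose i) * (t choose (m + t - i))"] by simp
          then show ?thesis by (simp add: vandermonde)
        qed
        moreover have "k - t - z + t = k - z" using w by simp
        ultimately show ?thesis by (simp add: add.commute)
      qed
      have k1: "(1::real) \<le> 13 * real k" using k by simp
      have "1 \<le> real ((k - t) choose m) / real ((k - t - z) choose m)" using c le1 by simp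
      from mult_mono[OF k1 this] show "1 \<le> load1 k t z m" using k by (simp add: load1_def)
      have "1 \<le> real ((k - z) choose (t + m)) / real ((k - t - z) choose m)" using c le2 by simp
      from mult_mono[OF k1 this] show "1 \<le> load2 k t z m" using k by (simp add: load2_def)
    qed
    have "real (rad 0 ?\<tau>) \<le> load1 k t1 z1 m1 * load2 k t2 z2 m2"
    proof (rule rad_le)
      show "1 \<le> load1 k t1 z1 m1 * load2 k t2 z2 m2"
        using mult_mono[OF l1(1)[OF v(1)] l1(2)[OF v(2)]] l1[OF v(1)] by simp
      fix u assume "u < b"
      show "real (card (A 0 u ?\<tau>)) \<le> load1 k t1 z1 m1 * load2 k t2 z2 m2"
      proof (cases "card (twos k u) = t1 \<and> card (zeros k u) = z2")
        case True
        then have "real (card (A 0 u ?\<tau>)) = real (card {S \<in> Fam (t1, z1, m1). twos k u \<subseteq> S}) * real (card {S \<in> Fam (t2, z2, m2). S \<inter> zeros k u = {}})"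
          by (simp add: A_def card_cartesian_product)
        also have "\<dots> \<le> load1 k t1 z1 m1 * load2 k t2 z2 m2"
          using G1 G2 sub[of u] True l1[OF v(1)] by (intro mult_mono) auto
        finally show ?thesis .
      next
        case False
        then have "A 0 u ?\<tau> = {}" by (auto simp: A_def)
        then show ?thesis using l1[OF v(1)] l1[OF v(2)] by simp
      qed
    qed
    moreover have "real (rad 1 ?\<tau>) \<le> load2 k t1 z1 m1 * load1 k t2 z2 m2"
    proof (rule rad_le)
      show "1 \<le> load2 k t1 z1 m1 * load1 k t2 z2 m2"
        using mult_mono[OF l1(2)[OF v(1)] l1(1)[OF v(2)]] l1[OF v(1)] by simp
      fix u assume "u < b"
      show "real (card (A 1 u ?\<tau>)) \<le> load2 k t1 z1 m1 * load1 k t2 z2 m2"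
      proof (cases "card (twos k u) = t2 \<and> card (zeros k u) = z1")
        case True
        then have "real (card (A 1 u ?\<tau>)) = real (card {S \<in> Fam (t1, z1, m1). S \<inter> zeros k u = {}}) * real (card {S \<in> Fam (t2, z2, m2). twos k u \<subseteq> S})"
          by (simp add: A_def card_cartesian_product)
        also have "\<dots> \<le> load2 k t1 z1 m1 * load1 k t2 z2 m2"
          using G1 G2 sub[of u] True l1[OF v(1)] by (intro mult_mono) auto
        finally show ?thesis .
      next
        case False
        then have "A 1 u ?\<tau> = {}" by (auto simp: A_def)
        then show ?thesis using l1[OF v(1)] l1[OF v(2)] by simp
      qed
    qed
    moreover have "\<exists>i<rad 0 ?\<tau>. \<exists>i'<rad 1 ?\<tau>. letter D x 0 u s i = letter D x 1 v s i'"
      if h: "u < b" "v < b" "agree k u v" "card (twos k u) = t1" "card (zeros k v) = z1"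
         "card (twos k v) = t2" "card (zeros k u) = z2" for u v
    proof -
      have dj: "twos k u \<inter> zeros k v = {}" "twos k v \<inter> zeros k u = {}" using h(3) by (simp_all add: agree_def)
      note cov1 = Fam[OF v(1), unfolded good_def prod.case, THEN conjunct2, THEN conjunct1, rule_format]
      note cov2 = Fam[OF v(2), unfolded good_def prod.case, THEN conjunct2, THEN conjunct1, rule_format]
      obtain S1 where S1: "S1 \<in> Fam (t1, z1, m1)" "twos k u \<subseteq> S1" "S1 \<inter> zeros k v = {}"
        using cov1[OF sub(1) sub(2) dj(1) h(4,5)] by (elim bexE conjE)
      obtain S2 where S2: "S2 \<in> Fam (t2, z2, m2)" "twos k v \<subseteq> S2" "S2 \<inter> zeros k u = {}"
        using cov2[OF sub(1) sub(2) dj(2) h(6,7)] by (elim bexE conjE)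
      have a0: "(S1, S2) \<in> A 0 u ?\<tau>" and a1: "(S1, S2) \<in> A 1 v ?\<tau>"
        using S1 S2 h by (auto simp: A_def)
      have im: "(S1, S2) \<in> g 0 u ?\<tau> ` {..<card (A 0 u ?\<tau>)}" "(S1, S2) \<in> g 1 v ?\<tau> ` {..<card (A 1 v ?\<tau>)}"
        using a0 a1 g[OF T, of 0 u] g[OF T, of 1 v] by (simp_all add: bij_betw_def)
      obtain i where "(S1, S2) = g 0 u ?\<tau> i" "i \<in> {..<card (A 0 u ?\<tau>)}" using im(1) by (rule imageE)
      then have i: "i < card (A 0 u ?\<tau>)" "g 0 u ?\<tau> i = (S1, S2)" by simp_all
      obtain i' where "(S1, S2) = g 1 v ?\<tau> i'" "i' \<in> {..<card (A 1 v ?\<tau>)}" using im(2) by (rule imageE)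
      then have i': "i' < card (A 1 v ?\<tau>)" "g 1 v ?\<tau> i' = (S1, S2)" by simp_all
      have r: "i < rad 0 ?\<tau>" "i' < rad 1 ?\<tau>"
        using less_le_trans[OF i(1) rad_ge(2)[OF h(1)]] less_le_trans[OF i'(1) rad_ge(2)[OF h(2)]] by auto
      then have iD: "i < D" "i' < D" using radD[OF T, of 0] radD[OF T, of 1] by auto
      have "f 0 u s i = lab (?\<tau>, (S1, S2))" "f 1 v s i' = lab (?\<tau>, (S1, S2))"
        using T inv[OF T] i i' h unfolding f_def s_def by simp_all
      then have "letter D x 0 u s i = letter D x 1 v s i'"
        using x(2)[of 0 u s i] x(2)[of 1 v s i'] iD h s sz by simp
      then show ?thesis using r by blast
    qed
    ultimately show "\<exists>s<S. real (radix b D x 0 s) \<le> load1 k t1 z1 m1 * load2 k t2 z2 m2 \<and>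
         real (radix b D x 1 s) \<le> load2 k t1 z1 m1 * load1 k t2 z2 m2 \<and>
         (\<forall>u<b. \<forall>v<b. agree k u v \<longrightarrow> card (twos k u) = t1 \<longrightarrow> card (zeros k v) = z1 \<longrightarrow>
            card (twos k v) = t2 \<longrightarrow> card (zeros k u) = z2 \<longrightarrow>
            (\<exists>i<radix b D x 0 s. \<exists>i'<radix b D x 1 s. letter D x 0 u s i = letter D x 1 v s i'))"
      using s(1) rx by (intro exI[of _ s]) simp
  qed
qed

section \<open>Products of binomial coefficients\<close>

lemma prod_binomial_le:
  "(\<Prod>j<q. (n j choose m j)) \<le> (\<Sum>j<(q::nat). n j) choose (\<Sum>j<q. m j)"
proof (induction q)
  case (Suc q)
  have two: "(a choose x) * (c choose y) \<le> (a + c) choose (x + y)" for a c x y :: nat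
  proof -
    have "(a choose x) * (c choose (x + y - x)) \<le> (\<Sum>i\<le>x + y. (a choose i) * (c choose (x + y - i)))"
      by (rule member_le_sum[of x "{..x + y}" "\<lambda>i. (a choose i) * (c choose (x + y - i))"]) auto
    also have "\<dots> = (a + c) choose (x + y)" by (rule vandermonde)
    finally show ?thesis by simp
  qed
  have "(\<Prod>j<Suc q. (n j choose m j)) \<le> ((\<Sum>j<q. n j) choose (\<Sum>j<q. m j)) * (n q choose m q)"
    using Suc by simp
  also have "\<dots> \<le> (\<Sum>j<Suc q. n j) choose (\<Sum>j<Suc q. m j)" using two by simp
  finally show ?case .
qed simp

text \<open>Split off the last block: Vandermonde's identity has at most
  \<open>\<phi> q + 1 \<le> k + 1\<close> nonzero terms, so the largest carries a share of at least
  1 / (k + 1). Its index becomes \<open>m q\<close>, and the induction hypothesis distributes the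
  remainder.\<close>

lemma binomial_split_pigeonhole:
  fixes \<phi> :: "nat \<Rightarrow> nat"
  assumes "\<And>j. j < q \<Longrightarrow> \<phi> j \<le> k" "t \<le> (\<Sum>j<q. \<phi> j)"
  shows "\<exists>m. (\<forall>j<q. m j \<le> \<phi> j) \<and> (\<Sum>j<q. m j) = t \<and>
    (\<Sum>j<q. \<phi> j) choose t \<le> (k + 1) ^ q * (\<Prod>j<q. (\<phi> j choose m j))"
  using assms
proof (induction q arbitrary: t)
  case (Suc q)
  define \<Phi> where "\<Phi> = (\<Sum>j<q. \<phi> j)"
  have k: "\<phi> q \<le> k" and tle: "t \<le> \<phi> q + \<Phi>" using Suc.prems by (auto simp: \<Phi>_def)
  define h where "h i = (\<phi> q choose i) * (\<Phi> choose (t - i))" for i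
  have tot: "(\<phi> q + \<Phi>) choose t = (\<Sum>i\<le>t. h i)" unfolding h_def by (rule vandermonde[symmetric])
  have "\<exists>i\<le>t. i \<le> \<phi> q \<and> (\<phi> q + \<Phi>) choose t \<le> (k + 1) * h i"
  proof (rule ccontr)
    assume "\<not> ?thesis"
    then have lt: "(k + 1) * h i < (\<phi> q + \<Phi>) choose t" if "i \<le> t" "i \<le> \<phi> q" for i using that by force
    have "(\<Sum>i\<le>t. h i) = (\<Sum>i\<in>{..t} \<inter> {..\<phi> q}. h i)"
      by (rule sum.mono_neutral_right) (auto simp: h_def)
    moreover have "{..t} \<inter> {..\<phi> q} = {..min t (\<phi> q)}" by auto
    ultimately have s: "(\<Sum>i\<le>t. h i) = (\<Sum>i\<le>min t (\<phi> q). h i)" by simp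
    have "(k + 1) * ((\<phi> q + \<Phi>) choose t) = (\<Sum>i\<le>min t (\<phi> q). (k + 1) * h i)"
      unfolding tot s by (simp add: sum_distrib_left)
    also have "\<dots> < (\<Sum>i\<le>min t (\<phi> q). (\<phi> q + \<Phi>) choose t)"
      by (rule sum_strict_mono) (use lt in auto)
    also have "\<dots> = (min t (\<phi> q) + 1) * ((\<phi> q + \<Phi>) choose t)" by simp
    also have "\<dots> \<le> (k + 1) * ((\<phi> q + \<Phi>) choose t)" using k by (intro mult_le_mono1) simp
    finally show False by simp
  qed
  then obtain i where i: "i \<le> t" "i \<le> \<phi> q" "(\<phi> q + \<Phi>) choose t \<le> (k + 1) * h i" by blast
  have "0 < (\<phi> q + \<Phi>) choose t" using tle by simp
  then have "0 < h i" using i(3) by (metis gr0I mult_0_right not_less0 le_zero_eq)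
  then have "t - i \<le> \<Phi>" unfolding h_def by (metis binomial_eq_0 mult_is_0 not_le less_irrefl)
  from Suc.IH[OF _ this[unfolded \<Phi>_def]] Suc.prems(1) obtain m where
    m: "\<forall>j<q. m j \<le> \<phi> j" "(\<Sum>j<q. m j) = t - i" "\<Phi> choose (t - i) \<le> (k + 1) ^ q * (\<Prod>j<q. (\<phi> j choose m j))"
    unfolding \<Phi>_def by auto
  define m' where "m' = m(q := i)"
  have p: "(\<Prod>j<q. (\<phi> j choose m' j)) = (\<Prod>j<q. (\<phi> j choose m j))" "(\<Sum>j<q. m' j) = t - i"
    using m(2) by (auto simp: m'_def)
  have "(\<phi> q + \<Phi>) choose t \<le> (k + 1) * h i" by (fact i(3))
  also have "\<dots> \<le> (k + 1) * ((\<phi> q choose i) * ((k + 1) ^ q * (\<Prod>j<q. (\<phi> j choose m j))))"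
    unfolding h_def using m(3) by (intro mult_le_mono2)
  also have "\<dots> = (k + 1) ^ Suc q * (\<Prod>j<Suc q. (\<phi> j choose m' j))"
    using p by (simp only: prod.lessThan_Suc power_Suc mult_ac) (simp add: m'_def)
  finally have "(\<Sum>j<Suc q. \<phi> j) choose t \<le> (k + 1) ^ Suc q * (\<Prod>j<Suc q. (\<phi> j choose m' j))"
    by (simp only: sum.lessThan_Suc \<Phi>_def add.commute)
  moreover have "(\<Sum>j<Suc q. m' j) = t" using p i by (simp add: m'_def)
  moreover have "\<forall>j<Suc q. m' j \<le> \<phi> j" using m(1) i(2) by (simp add: m'_def less_Suc_eq)
  ultimately show ?case by blast
qed simp

section \<open>Entropy estimates for binomial coefficients\<close>

lemma binomial_power_le:
  fixes n m :: nat
  assumes "m \<le> n"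
  shows "(n choose m) * (m ^ m * (n - m) ^ (n - m)) \<le> n ^ n"
proof -
  have "(n choose m) * m ^ m * (n - m) ^ (n - m) \<le> (\<Sum>i\<le>n. (n choose i) * m ^ i * (n - m) ^ (n - i))"
    using assms by (intro member_le_sum[of m "{..n}" "\<lambda>i. (n choose i) * m ^ i * (n - m) ^ (n - i)"]) auto
  also have "\<dots> = (m + (n - m)) ^ n" by (simp add: binomial_ring[of m "n - m" n])
  finally show ?thesis using assms by (simp add: mult_ac)
qed

text \<open>In the expansion of \<open>(m + (n - m)) ^ n\<close> the term with index
  \<open>m\<close> is the largest of \<open>n + 1\<close>, being the mode of the binomial
  distribution. The quotients of consecutive terms show that they increase up to \<open>m\<close>
  and decrease afterwards.\<close>

lemma binomial_power_ge:
  fixes n m :: nat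
  assumes m: "m \<le> n"
  shows "n ^ n \<le> (n + 1) * ((n choose m) * (m ^ m * (n - m) ^ (n - m)))"
proof -
  define h where "h i = (n choose i) * m ^ i * (n - m) ^ (n - i)" for i
  have ratio: "(i + 1) * (n - m) * h (Suc i) = (n - i) * m * h i" if "i < n" for i
  proof -
    have c: "Suc i * (n choose Suc i) = (n - i) * (n choose i)"
      using binomial_absorb_comp[of n i] binomial_absorption[of i n] by simp
    have e: "(n - m) ^ (n - i) = (n - m) * (n - m) ^ (n - Suc i)" using that by (metis Suc_diff_Suc power_Suc)
    have "(i + 1) * (n - m) * h (Suc i) = (Suc i * (n choose Suc i)) * m ^ Suc i * ((n - m) * (n - m) ^ (n - Suc i))"
      unfolding h_def by (simp only: mult_ac Suc_eq_plus1)
    also have "\<dots> = (n - i) * m * h i" unfolding c e[symmetric] h_def by (simp add: mult_ac)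
    finally show ?thesis .
  qed
  have up: "h i \<le> h (Suc i)" if "i < m" for i
  proof (cases "m = n")
    case True
    then have "h i = 0" using that by (simp add: h_def)
    then show ?thesis by simp
  next
    case False
    then have pos: "0 < (i + 1) * (n - m)" using m by simp
    have "(i + 1) * (n - m) \<le> (n - i) * m"
    proof -
      define x where "x = m - (i + 1)"
      have x: "m = i + 1 + x" using that by (simp add: x_def)
      define y where "y = n - m"
      have y: "n = m + y" using m by (simp add: y_def)
      show ?thesis unfolding y by (simp add: x algebra_simps)
    qed
    then have "(i + 1) * (n - m) * h i \<le> (n - i) * m * h i" by (rule mult_le_mono1)
    also have "\<dots> = (i + 1) * (n - m) * h (Suc i)" using ratio[of i] that m by simp
    finally show ?thesis using pos by (simp only: mult_le_cancel1)
  qed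
  have down: "h (Suc i) \<le> h i" if "m \<le> i" "i < n" for i
  proof (cases "m = n")
    case False
    then have pos: "0 < (i + 1) * (n - m)" using m by simp
    have "(n - i) * m \<le> (i + 1) * (n - m)"
    proof -
      define x where "x = i - m"
      have x: "i = m + x" using that by (simp add: x_def)
      define y where "y = n - i"
      have y: "n = i + y" using that by (simp add: y_def)
      show ?thesis unfolding y x by (simp add: algebra_simps)
    qed
    then have "(n - i) * m * h i \<le> (i + 1) * (n - m) * h i" by (rule mult_le_mono1)
    then have "(i + 1) * (n - m) * h (Suc i) \<le> (i + 1) * (n - m) * h i" using ratio[of i] that by simp
    then show ?thesis using pos by (simp only: mult_le_cancel1)
  qed (use that in simp)
  have "h i \<le> h m" if "i \<le> n" for i
  proof (cases "i \<le> m")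
    case True
    then show ?thesis by (induction rule: inc_induct) (auto intro: up order.trans)
  next
    case False
    then have "m \<le> i" by simp
    then show ?thesis using that
      by (induction rule: dec_induct) (auto intro: order.trans[OF down])
  qed
  then have "(\<Sum>i\<le>n. h i) \<le> (n + 1) * h m"
    using sum_bounded_above[of "{..n}" h "h m"] by simp
  moreover have "(\<Sum>i\<le>n. h i) = (m + (n - m)) ^ n" unfolding h_def by (simp add: binomial_ring[of m "n - m" n])
  ultimately show ?thesis using m by (simp add: h_def mult_ac)
qed

text \<open>While \<open>2 * m \<le> N\<close>, the two summands of Pascal's rule are ordered, so
  increasing \<open>N\<close> by 1 at most doubles the coefficient. This pays for rounding the
  dimension up to a multiple of the block length.\<close>

lemma binomial_add_le:
  fixes n m p :: nat
  assumes "2 * m \<le> n"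
  shows "(n + p) choose m \<le> 2 ^ p * (n choose m)"
proof (induction p)
  case (Suc p)
  have one: "Suc N choose m \<le> 2 * (N choose m)" if "2 * m \<le> N" for N
  proof (cases m)
    case (Suc l)
    have "(N choose l) \<le> (N choose Suc l)" using that Suc by (intro binomial_mono) auto
    then show ?thesis using Suc by simp
  qed simp
  have "(n + Suc p) choose m \<le> 2 * ((n + p) choose m)" using one[of "n + p"] assms by simp
  then show ?case using Suc by simp
qed simp

text \<open>Upper entropy bounds for the numerator and a lower one for the denominator. The powers
  of 2 from \<open>(2 * (h - t)) ^ (2 * (h - t))\<close> and \<open>(2 * t) ^ (2 * t)\<close>
  combine to \<open>4 ^ h\<close> and turn the square of \<open>h ^ h\<close> into
  \<open>(2 * h) ^ (2 * h)\<close>. What remains are the five self-powers that the program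
  evaluates.\<close>

lemma entropy_binomial_bound:
  fixes t h q k :: nat
  assumes h: "2 * t \<le> h" and q: "2 * h \<le> q * k" "q * k \<le> 2 * h + k"
  shows "real ((q * k - t) choose t) * real ((h + t) choose (2 * t)) / (real (h choose t))\<^sup>2
    \<le> 2 ^ k * ((real (h + 1))\<^sup>2 * (real ((2 * h - t) ^ (2 * h - t)) * real ((h + t) ^ (h + t)) /
        (real (t ^ t) * real ((h - t) ^ (h - t)) * real ((2 * h) ^ (2 * h)))))"
proof -
  define a1 where "a1 = (2 * h - t) choose t"
  define a2 where "a2 = (h + t) choose (2 * t)"
  define a3 where "a3 = h choose t"
  define T where "T = real (t ^ t)"
  define U where "U = real ((h - t) ^ (h - t))"
  define N1 where "N1 = real ((2 * h - t) ^ (2 * h - t))"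
  define N2 where "N2 = real ((h + t) ^ (h + t))"
  define H where "H = real (h ^ h)"
  have pos: "0 < T" "0 < U" "0 < N1" "0 < N2" "0 < H"
    using h by (auto simp: T_def U_def N1_def N2_def H_def zero_less_power_eq)
  have a3: "0 < real a3" using h by (simp add: a3_def)
  have A0: "real ((q * k - t) choose t) \<le> 2 ^ k * real a1"
  proof -
    obtain p where p: "q * k = 2 * h + p" using q(1) le_Suc_ex by blast
    have "q * k - t = (2 * h - t) + p" using h p by simp
    then have "(q * k - t) choose t \<le> 2 ^ p * a1" using binomial_add_le[of t "2 * h - t" p] h by (simp add: a1_def)
    also have "\<dots> \<le> 2 ^ k * a1" using p q(2) by (intro mult_le_mono1 power_increasing) auto
    finally have "real ((q * k - t) choose t) \<le> real (2 ^ k * a1)" by (rule of_nat_mono)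
    then show ?thesis by simp
  qed
  have e1: "2 * h - t - t = 2 * (h - t)" "h + t - 2 * t = h - t" by auto
  have "a1 * (t ^ t * (2 * (h - t)) ^ (2 * (h - t))) \<le> (2 * h - t) ^ (2 * h - t)"
    using binomial_power_le[of t "2 * h - t"] h unfolding e1 a1_def by simp
  then have "real (a1 * (t ^ t * (2 * (h - t)) ^ (2 * (h - t)))) \<le> N1" unfolding N1_def by (rule of_nat_mono)
  moreover have "real (a1 * (t ^ t * (2 * (h - t)) ^ (2 * (h - t)))) = real a1 * T * (4 ^ (h - t) * U\<^sup>2)"
    unfolding T_def U_def power_mult power_mult_distrib by (simp add: power2_eq_square power_mult_distrib)
  ultimately have A1: "real a1 * T * (4 ^ (h - t) * U\<^sup>2) \<le> N1" by (simp only:)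
  have "a2 * ((2 * t) ^ (2 * t) * (h - t) ^ (h - t)) \<le> (h + t) ^ (h + t)"
    using binomial_power_le[of "2 * t" "h + t"] h unfolding e1 a2_def by simp
  then have "real (a2 * ((2 * t) ^ (2 * t) * (h - t) ^ (h - t))) \<le> N2" unfolding N2_def by (rule of_nat_mono)
  moreover have "real (a2 * ((2 * t) ^ (2 * t) * (h - t) ^ (h - t))) = real a2 * (4 ^ t * T\<^sup>2) * U"
    unfolding T_def U_def power_mult power_mult_distrib by (simp add: power2_eq_square power_mult_distrib)
  ultimately have A2: "real a2 * (4 ^ t * T\<^sup>2) * U \<le> N2" by (simp only:)
  have "h ^ h \<le> (h + 1) * (a3 * (t ^ t * (h - t) ^ (h - t)))"
    unfolding a3_def by (rule binomial_power_ge) (use h in simp)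
  then have "H \<le> real ((h + 1) * (a3 * (t ^ t * (h - t) ^ (h - t))))" unfolding H_def by (rule of_nat_mono)
  then have A3: "H \<le> real (h + 1) * (real a3 * T * U)" unfolding T_def U_def by (simp only: of_nat_mult mult.assoc)
  define hp where "hp = real (h + 1)"
  have HH: "real ((2 * h) ^ (2 * h)) = 4 ^ h * H\<^sup>2"
    unfolding H_def power_mult power_mult_distrib by (simp add: power2_eq_square power_mult_distrib)
  have four: "(4::real) ^ h = 4 ^ (h - t) * 4 ^ t" using h by (simp flip: power_add)
  have "real a1 * real a2 * T * U * (4 ^ h * H\<^sup>2) \<le> real a1 * real a2 * T * U * (4 ^ h * (hp * (real a3 * T * U))\<^sup>2)"
    using A3 pos unfolding hp_def by (intro mult_left_mono power_mono) auto
  also have "\<dots> = (real a1 * T * (4 ^ (h - t) * U\<^sup>2)) * (real a2 * (4 ^ t * T\<^sup>2) * U) * (hp\<^sup>2 * (real a3)\<^sup>2)"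
    unfolding four by algebra
  also have "\<dots> \<le> N1 * N2 * (hp\<^sup>2 * (real a3)\<^sup>2)"
    using A1 A2 pos by (intro mult_right_mono mult_mono) auto
  finally have main: "real a1 * real a2 * (T * U * (4 ^ h * H\<^sup>2)) \<le> N1 * N2 * (hp\<^sup>2 * (real a3)\<^sup>2)"
    by (simp only: mult.assoc)
  define E where "E = T * U * (4 ^ h * H\<^sup>2)"
  have E: "0 < E" using pos by (simp add: E_def)
  define g where "g = (real a3)\<^sup>2"
  have g: "0 < g" using a3 by (simp add: g_def)
  have "real a1 * real a2 / g \<le> hp\<^sup>2 * (N1 * N2 / E)"
    using main[folded E_def g_def] E g by (simp add: field_simps)
  then have "2 ^ k * (real a1 * real a2 / g) \<le> 2 ^ k * (hp\<^sup>2 * (N1 * N2 / E))"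
    by (rule mult_left_mono) simp
  moreover have "real ((q * k - t) choose t) * real a2 / g \<le> 2 ^ k * real a1 * real a2 / g"
    using A0 g by (intro divide_right_mono mult_right_mono) auto
  ultimately have "real ((q * k - t) choose t) * real a2 / g \<le> 2 ^ k * (hp\<^sup>2 * (N1 * N2 / E))"
    by simp
  then show ?thesis
    by (simp only: E_def g_def hp_def HH[symmetric] T_def U_def N1_def N2_def a2_def a3_def)
qed

section \<open>Labels and compatibility\<close>

lemma label_Suc:
  "label b S D x \<rho> (Suc j) w u L = label b S D x \<rho> j (w div S div radix b D x \<rho> (w mod S)) (u div b)
     (L * D + letter D x \<rho> (u mod b) (w mod S) (w div S mod radix b D x \<rho> (w mod S)))"
  by (simp add: Let_def radix_def letter_def)

text \<open>The \<open>j\<close> letters appended are single digits in base \<open>D\<close> and can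
  be stripped off. This recovers the table code from an address and permits comparing labels letter
  by letter.\<close>

lemma label_div:
  assumes "0 < D"
  shows "label b S D x \<rho> j w u L div D ^ j = L"
proof (induction j arbitrary: w u L)
  case (Suc j)
  let ?e = "letter D x \<rho> (u mod b) (w mod S) (w div S mod radix b D x \<rho> (w mod S))"
  have e: "?e < D" using assms by (simp add: letter_def digit_def)
  have "label b S D x \<rho> (Suc j) w u L div D ^ Suc j = label b S D x \<rho> (Suc j) w u L div D ^ j div D"
    by (simp only: power_Suc2 div_mult2_eq)
  also have "\<dots> = (L * D + ?e) div D" unfolding label_Suc Suc.IH ..
  also have "\<dots> = L" using e by simp
  finally show ?case .
qed simp

locale table =
  fixes k b S D x :: nat
  assumes k: "1 \<le> k" and b: "b = 3 ^ k" and S: "S = (k + 9) ^ 6" and D: "D = b ^ 16"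
    and sound: "\<And>u v s s' i i'. u < b \<Longrightarrow> v < b \<Longrightarrow> s < S \<Longrightarrow> s' < S \<Longrightarrow> i < D \<Longrightarrow> i' < D \<Longrightarrow>
       letter D x 0 u s i = letter D x 1 v s' i' \<Longrightarrow> agree k u v"
    and covering: "\<And>t1 z1 m1 t2 z2 m2. t1 + z1 + m1 \<le> k \<Longrightarrow> t2 + z2 + m2 \<le> k \<Longrightarrow>
       \<exists>s<S. real (radix b D x 0 s) \<le> load1 k t1 z1 m1 * load2 k t2 z2 m2 \<and>
         real (radix b D x 1 s) \<le> load2 k t1 z1 m1 * load1 k t2 z2 m2 \<and>
         (\<forall>u<b. \<forall>v<b. agree k u v \<longrightarrow> card (twos k u) = t1 \<longrightarrow> card (zeros k v) = z1 \<longrightarrow>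
            card (twos k v) = t2 \<longrightarrow> card (zeros k u) = z2 \<longrightarrow>
            (\<exists>i<radix b D x 0 s. \<exists>i'<radix b D x 1 s. letter D x 0 u s i = letter D x 1 v s i'))"
begin

lemma pos: "0 < b" "0 < S" "0 < D"
  by (simp_all add: b S D)

lemma radix_le: "radix b D x \<rho> s \<le> D" "0 < radix b D x \<rho> s"
  using pos by (simp_all add: radix_def digit_def Suc_le_eq)

text \<open>By \<open>label_div\<close> equal labels have equal letters in each block. The visit
  numbers are arbitrary and may select different profiles, which is why the table is required to be
  sound across profiles \<open>s\<close> and \<open>s'\<close>.\<close>

lemma label_sound:
  assumes "label b S D x 0 q w u L = label b S D x 1 q w' v L" "j < q"
  shows "agree k (u div b ^ j mod b) (v div b ^ j mod b)"
  using assms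
proof (induction q arbitrary: w w' u v L j)
  case (Suc q)
  let ?i = "w div S mod radix b D x 0 (w mod S)" and ?i' = "w' div S mod radix b D x 1 (w' mod S)"
  let ?e = "letter D x 0 (u mod b) (w mod S) ?i" and ?e' = "letter D x 1 (v mod b) (w' mod S) ?i'"
  note eq = Suc.prems(1)[unfolded label_Suc]
  have "L * D + ?e = L * D + ?e'"
    using arg_cong[OF eq, of "\<lambda>y. y div D ^ q"] unfolding label_div[OF pos(3)] .
  then have e: "?e = ?e'" by simp
  show ?case
  proof (cases j)
    case 0
    have "?i < D" "?i' < D" using radix_le pos by (meson mod_less_divisor less_le_trans)+
    then have "agree k (u mod b) (v mod b)" using e pos by (intro sound[of _ _ "w mod S" "w' mod S" ?i ?i']) auto
    then show ?thesis using 0 by simp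
  next
    case (Suc i)
    have "agree k (u div b div b ^ i mod b) (v div b div b ^ i mod b)"
      by (rule Suc.IH[OF eq[folded e]]) (use Suc Suc.prems in simp)
    then show ?thesis using Suc by (simp add: div_mult2_eq)
  qed
qed simp

text \<open>The visit number is assembled in mixed radix: profile code, member index, then the
  number for the remaining blocks. The radices depend on the role, so the common label generally has
  different visit numbers on the two sides.\<close>

lemma label_complete:
  assumes "\<And>j. j < q \<Longrightarrow> s j < S"
    and "\<And>j. j < q \<Longrightarrow> \<exists>i<radix b D x 0 (s j). \<exists>i'<radix b D x 1 (s j).
       letter D x 0 (u div b ^ j mod b) (s j) i = letter D x 1 (v div b ^ j mod b) (s j) i'"
  shows "\<exists>w<(\<Prod>j<q. S * radix b D x 0 (s j)). \<exists>w'<(\<Prod>j<q. S * radix b D x 1 (s j)).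
     label b S D x 0 q w u L = label b S D x 1 q w' v L"
  using assms
proof (induction q arbitrary: s u v L)
  case (Suc q)
  obtain i i' where i: "i < radix b D x 0 (s 0)" "i' < radix b D x 1 (s 0)"
    "letter D x 0 (u mod b) (s 0) i = letter D x 1 (v mod b) (s 0) i'"
    using Suc.prems(2)[of 0] by auto
  let ?e = "letter D x 0 (u mod b) (s 0) i"
  have "\<exists>w<(\<Prod>j<q. S * radix b D x 0 (s (Suc j))). \<exists>w'<(\<Prod>j<q. S * radix b D x 1 (s (Suc j))).
     label b S D x 0 q w (u div b) (L * D + ?e) = label b S D x 1 q w' (v div b) (L * D + ?e)"
  proof (rule Suc.IH)
    fix j assume "j < q"
    then show "s (Suc j) < S" using Suc.prems(1) by simp
    show "\<exists>i<radix b D x 0 (s (Suc j)). \<exists>i'<radix b D x 1 (s (Suc j)).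
       letter D x 0 (u div b div b ^ j mod b) (s (Suc j)) i = letter D x 1 (v div b div b ^ j mod b) (s (Suc j)) i'"
      using Suc.prems(2)[of "Suc j"] \<open>j < q\<close> by (simp add: div_mult2_eq)
  qed
  then obtain w w' where w: "w < (\<Prod>j<q. S * radix b D x 0 (s (Suc j)))" "w' < (\<Prod>j<q. S * radix b D x 1 (s (Suc j)))"
     "label b S D x 0 q w (u div b) (L * D + ?e) = label b S D x 1 q w' (v div b) (L * D + ?e)" by blast
  have s0: "s 0 < S" using Suc.prems(1) by simp
  have bound: "s 0 + S * (i + r * w) < S * r * P" if "i < r" "w < P" for i r w P :: nat
  proof -
    have "i + r * w < r * (w + 1)" using that by simp
    also have "\<dots> \<le> r * P" using that by (intro mult_le_mono2) simp
    finally have "i + r * w + 1 \<le> r * P" by simp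
    then have "S * (i + r * w + 1) \<le> S * (r * P)" by (rule mult_le_mono2)
    then show ?thesis using s0 by (simp add: algebra_simps)
  qed
  have dec: "(s 0 + S * (i + r * w)) mod S = s 0" "(s 0 + S * (i + r * w)) div S = i + r * w"
    "(i + r * w) mod r = i" "(i + r * w) div r = w" if "i < r" for i r w :: nat
    using s0 that by auto
  define W W' where "W = s 0 + S * (i + radix b D x 0 (s 0) * w)" and "W' = s 0 + S * (i' + radix b D x 1 (s 0) * w')"
  have "label b S D x 0 (Suc q) W u L = label b S D x 0 q w (u div b) (L * D + ?e)"
    unfolding label_Suc W_def dec(1,2)[OF i(1)] dec(3,4)[OF i(1)] ..
  moreover have "label b S D x 1 (Suc q) W' v L = label b S D x 1 q w' (v div b) (L * D + ?e)"
    unfolding label_Suc W'_def dec(1,2)[OF i(2)] dec(3,4)[OF i(2)] i(3) ..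
  moreover have "W < (\<Prod>j<Suc q. S * radix b D x 0 (s j))" "W' < (\<Prod>j<Suc q. S * radix b D x 1 (s j))"
    unfolding prod.lessThan_Suc_shift W_def W'_def using bound[OF i(1) w(1)] bound[OF i(2) w(2)] by simp_all
  ultimately show ?case using w(3) by (intro exI[of _ W] conjI exI[of _ W']) simp_all
qed simp

end

section \<open>Blocks and ternary digits\<close>

lemma digit_block:
  assumes "l < k"
  shows "(u div (3 ^ k) ^ j mod 3 ^ k) div 3 ^ l mod 3 = u div 3 ^ (j * k + l) mod (3::nat)"
proof -
  define a where "a = u div (3 ^ k) ^ j"
  have k: "(3::nat) ^ k = 3 ^ l * 3 ^ (k - l)" using assms by (simp flip: power_add)
  have "(a mod 3 ^ k) div 3 ^ l = a div 3 ^ l mod 3 ^ (k - l)"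
    unfolding k mod_mult2_eq by simp
  moreover have "(3::nat) dvd 3 ^ (k - l)" using assms by (intro dvd_power) auto
  ultimately have "(a mod 3 ^ k) div 3 ^ l mod 3 = a div 3 ^ l mod 3" by (simp add: mod_mod_cancel)
  also have "a div 3 ^ l = u div ((3 ^ k) ^ j * 3 ^ l)" unfolding a_def by (rule div_mult2_eq[symmetric])
  also have "(3 ^ k) ^ j * 3 ^ l = (3::nat) ^ (j * k + l)" by (simp only: power_add power_mult mult.commute[of j k])
  finally show ?thesis unfolding a_def .
qed

lemma clash_zero_iff:
  "clash d u v = 0 \<longleftrightarrow> (\<forall>i<d. \<not> (u div 3 ^ i mod 3 = 0 \<and> v div 3 ^ i mod 3 = 2) \<and>
     \<not> (u div 3 ^ i mod 3 = 2 \<and> v div 3 ^ i mod 3 = 0))"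
proof (induction d arbitrary: u v)
  case (Suc d)
  have c: "((c - e) + (e - c)) div 2 = 0 \<longleftrightarrow> \<not> (c = 0 \<and> e = 2) \<and> \<not> (c = 2 \<and> e = 0)"
    if "c < 3" "e < 3" for c e :: nat
  proof -
    have "c = 0 \<or> c = 1 \<or> c = 2" "e = 0 \<or> e = 1 \<or> e = 2" using that by linarith+
    then show ?thesis by (elim disjE) simp_all
  qed
  have m3: "u mod 3 < 3" "v mod 3 < 3" by simp_all
  have sh: "(\<forall>i<Suc d. P i) \<longleftrightarrow> P 0 \<and> (\<forall>i<d. P (Suc i))" for P by (rule All_less_Suc2)
  have "clash (Suc d) u v = 0 \<longleftrightarrow> ((u mod 3 - v mod 3) + (v mod 3 - u mod 3)) div 2 = 0 \<and> clash d (u div 3) (v div 3) = 0"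
    by simp
  then show ?case
    unfolding Suc.IH c[OF m3] sh by (simp add: div_mult2_eq)
qed simp

lemma twos_block: "twos k (u div (3 ^ k) ^ j mod 3 ^ k) = {l \<in> {..<k}. u div 3 ^ (j * k + l) mod 3 = 2}"
  unfolding twos_def by (intro Collect_cong conj_cong refl) (simp only: digit_block lessThan_iff)

lemma zeros_block: "zeros k (u div (3 ^ k) ^ j mod 3 ^ k) = {l \<in> {..<k}. u div 3 ^ (j * k + l) mod 3 = 0}"
  unfolding zeros_def by (intro Collect_cong conj_cong refl) (simp only: digit_block lessThan_iff)

lemma agree_iff:
  "agree k (u div (3 ^ k) ^ j mod 3 ^ k) (v div (3 ^ k) ^ j mod 3 ^ k) \<longleftrightarrow>
    (\<forall>l<k. \<not> (u div 3 ^ (j * k + l) mod 3 = 0 \<and> v div 3 ^ (j * k + l) mod 3 = 2) \<and>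
      \<not> (u div 3 ^ (j * k + l) mod 3 = 2 \<and> v div 3 ^ (j * k + l) mod 3 = 0))"
proof -
  have aux: "{l \<in> {..<k}. A l} \<inter> {l \<in> {..<k}. B l} = {} \<and> {l \<in> {..<k}. C l} \<inter> {l \<in> {..<k}. E l} = {} \<longleftrightarrow>
    (\<forall>l<k. \<not> (E l \<and> C l) \<and> \<not> (A l \<and> B l))" for A B C E
    by auto
  show ?thesis unfolding agree_def twos_block zeros_block by (rule aux)
qed

lemma clash_zero_if_agree:
  assumes "\<And>j. j < q \<Longrightarrow> agree k (u div (3 ^ k) ^ j mod 3 ^ k) (v div (3 ^ k) ^ j mod 3 ^ k)"
    and "d \<le> q * k" "0 < k"
  shows "clash d u v = 0"
  unfolding clash_zero_iff
proof (intro allI impI)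
  fix i assume "i < d"
  then have "i div k < q" using assms(2,3) by (simp add: div_less_iff_less_mult)
  moreover have "i mod k < k" "i div k * k + i mod k = i" using assms(3) by auto
  ultimately show "\<not> (u div 3 ^ i mod 3 = 0 \<and> v div 3 ^ i mod 3 = 2) \<and> \<not> (u div 3 ^ i mod 3 = 2 \<and> v div 3 ^ i mod 3 = 0)"
    using assms(1)[of "i div k"] unfolding agree_iff by metis
qed

text \<open>Positions from \<open>d\<close> on carry the digit 0 in both numbers and cannot clash,
  so a last incomplete block needs no special treatment.\<close>

lemma agree_if_clash_zero:
  assumes "clash d u v = 0" "u < 3 ^ d" "v < 3 ^ d"
  shows "agree k (u div (3 ^ k) ^ j mod 3 ^ k) (v div (3 ^ k) ^ j mod 3 ^ k)"
  unfolding agree_iff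
proof (intro allI impI)
  fix l
  let ?i = "j * k + l"
  show "\<not> (u div 3 ^ ?i mod 3 = 0 \<and> v div 3 ^ ?i mod 3 = 2) \<and> \<not> (u div 3 ^ ?i mod 3 = 2 \<and> v div 3 ^ ?i mod 3 = 0)"
  proof (cases "?i < d")
    case True
    show ?thesis by (rule mp[OF spec[OF assms(1)[unfolded clash_zero_iff]] True])
  next
    case False
    then have "(3::nat) ^ d \<le> 3 ^ ?i" by (intro power_increasing) auto
    then have "u < 3 ^ ?i" "v < 3 ^ ?i" using assms(2,3) by linarith+
    then have "u div 3 ^ ?i = 0" "v div 3 ^ ?i = 0" by (simp_all only: div_less)
    then show ?thesis by simp
  qed
qed

lemma card_blocks:
  "(\<Sum>j<q. card {l \<in> {..<k}. P (j * k + l)}) = card {i \<in> {..<q * k}. P (i :: nat)}"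
proof (induction q)
  case (Suc q)
  have "{i \<in> {..<Suc q * k}. P i} = {i \<in> {..<q * k}. P i} \<union> (\<lambda>l. q * k + l) ` {l \<in> {..<k}. P (q * k + l)}"
  proof (intro equalityI subsetI)
    fix i assume i: "i \<in> {i \<in> {..<Suc q * k}. P i}"
    show "i \<in> {i \<in> {..<q * k}. P i} \<union> (\<lambda>l. q * k + l) ` {l \<in> {..<k}. P (q * k + l)}"
    proof (cases "i < q * k")
      case False
      then show ?thesis using i by (intro UnI2 image_eqI[of _ _ "i - q * k"]) auto
    qed (use i in auto)
  qed auto
  moreover have "card ({i \<in> {..<q * k}. P i} \<union> (\<lambda>l. q * k + l) ` {l \<in> {..<k}. P (q * k + l)}) =
      card {i \<in> {..<q * k}. P i} + card ((\<lambda>l. q * k + l) ` {l \<in> {..<k}. P (q * k + l)})"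
    by (rule card_Un_disjoint) auto
  moreover have "card ((\<lambda>l. q * k + l) ` {l \<in> {..<k}. P (q * k + l)}) = card {l \<in> {..<k}. P (q * k + l)}"
    by (rule card_image) (simp add: inj_on_def)
  ultimately show ?case using Suc by simp
qed simp

text \<open>The leading zeros beyond the length of \<open>xs\<close> are also counted on the left,
  hence \<open>c \<noteq> 0\<close>. Zeros are later counted as the complement, padding
  included.\<close>

lemma card_ternary_digits:
  assumes "set xs \<subseteq> {0, 1, 2}" "length xs \<le> n" "c \<noteq> 0"
  shows "card {i \<in> {..<n}. ternary_value xs div 3 ^ i mod 3 = c} = count_list xs c"
  using assms
proof (induction xs arbitrary: n rule: rev_induct)
  case Nil
  then show ?case by (simp add: ternary_value_def)
next
  case (snoc x xs)
  then obtain n' where n: "n = Suc n'" "length xs \<le> n'" by (cases n) auto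
  have x: "x < 3" using snoc.prems by auto
  have d: "ternary_value (xs @ [x]) div 3 ^ Suc i mod 3 = ternary_value xs div 3 ^ i mod 3" for i
    using x by (simp add: ternary_value_snoc div_mult2_eq)
  have "{i \<in> {..<n}. ternary_value (xs @ [x]) div 3 ^ i mod 3 = c} =
     (if x = c then {0} else {}) \<union> Suc ` {i \<in> {..<n'}. ternary_value xs div 3 ^ i mod 3 = c}"
    (is "?L = _ \<union> Suc ` ?R")
  proof (intro set_eqI)
    fix i
    show "i \<in> ?L \<longleftrightarrow> i \<in> (if x = c then {0} else {}) \<union> Suc ` ?R"
    proof (cases i)
      case 0
      then show ?thesis using x n by (auto simp: ternary_value_snoc)
    next
      case (Suc j)
      have "Suc j \<in> ?L \<longleftrightarrow> j \<in> ?R" unfolding mem_Collect_eq d n by simp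
      then show ?thesis unfolding Suc by auto
    qed
  qed
  moreover have "card ((if x = c then {0} else {}) \<union> Suc ` ?R) = card (if x = c then {0::nat} else {}) + card (Suc ` ?R)"
    by (rule card_Un_disjoint) auto
  moreover have "card (Suc ` ?R) = card ?R" by (rule card_image) simp
  moreover have "card ?R = count_list xs c" using snoc.prems n by (intro snoc.IH) auto
  ultimately show ?case by simp
qed

lemma clash_list_iff:
  assumes "length xs = d" "length ys = d" "set xs \<subseteq> {0, 1, 2}" "set ys \<subseteq> {0, 1, 2}"
  shows "clash d (ternary_value xs) (ternary_value ys) = 0 \<longleftrightarrow> compatible d xs ys"
  using assms
proof (induction d arbitrary: xs ys)
  case 0
  then show ?case by (simp add: compatible_def)
next
  case (Suc d)
  obtain xs' x where xs: "xs = xs' @ [x]" using Suc.prems(1) by (metis length_Suc_conv_rev)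
  obtain ys' y where ys: "ys = ys' @ [y]" using Suc.prems(2) by (metis length_Suc_conv_rev)
  have len: "length xs' = d" "length ys' = d" "x \<in> {0, 1, 2}" "y \<in> {0, 1, 2}" using Suc.prems xs ys by auto
  have IH: "clash d (ternary_value xs') (ternary_value ys') = 0 \<longleftrightarrow> compatible d xs' ys'"
    using Suc.prems xs ys by (intro Suc.IH) auto
  have x3: "x < 3" "y < 3" using len by auto
  have m: "ternary_value xs mod 3 = x" "ternary_value xs div 3 = ternary_value xs'"
    "ternary_value ys mod 3 = y" "ternary_value ys div 3 = ternary_value ys'"
    using x3 by (auto simp: xs ys ternary_value_snoc)
  have "clash (Suc d) (ternary_value xs) (ternary_value ys) = 0 \<longleftrightarrow>
     ((x - y) + (y - x)) div 2 = 0 \<and> clash d (ternary_value xs') (ternary_value ys') = 0"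
    by (simp add: m)
  also have "((x - y) + (y - x)) div 2 = 0 \<longleftrightarrow> int x - int y \<in> {-1, 0, 1}" using len(3,4) by auto
  also have "int x - int y \<in> {-1, 0, 1} \<and> clash d (ternary_value xs') (ternary_value ys') = 0 \<longleftrightarrow> compatible (Suc d) xs ys"
    unfolding IH compatible_def xs ys using len by (auto simp: nth_append less_Suc_eq)
  finally show ?case .
qed

section \<open>The number of labels per vector\<close>

text \<open>The free positions of the blocks add up to \<open>h\<close>, and the pigeonhole argument
  spreads \<open>t0\<close> further elements over them such that the common denominator loses at
  most \<open>(k + 1) ^ q\<close> against \<open>h choose t0\<close>. For the numerators the sums of
  \<open>k - t j\<close>, \<open>k - z j\<close> and \<open>t j + m j\<close> are
  \<open>q * k - t0\<close>, \<open>h + t0\<close> and \<open>2 * t0\<close>.\<close>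

lemma prod_loads:
  fixes t z :: "nat \<Rightarrow> nat"
  assumes k: "1 \<le> k" and le: "\<And>j. j < q \<Longrightarrow> t j + z j \<le> k"
    and st: "(\<Sum>j<q. t j) = t0" and sz: "(\<Sum>j<q. z j) + h + t0 = q * k" and th: "t0 \<le> h"
  shows "\<exists>m. (\<forall>j<q. t j + z j + m j \<le> k) \<and>
    (\<Prod>j<q. load1 k (t j) (z j) (m j)) \<le> (13 * real k * real (k + 1)) ^ q * (real ((q * k - t0) choose t0) / real (h choose t0)) \<and>
    (\<Prod>j<q. load2 k (t j) (z j) (m j)) \<le> (13 * real k * real (k + 1)) ^ q * (real ((h + t0) choose (2 * t0)) / real (h choose t0))"
proof -
  define \<phi> where "\<phi> j = k - t j - z j" for j
  have le': "t j \<le> k" "z j \<le> k" "k - (t j + z j) + t j + z j = k" if "j < q" for j using le[OF that] by simp_all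
  have "(\<Sum>j<q. \<phi> j) + (\<Sum>j<q. t j) + (\<Sum>j<q. z j) = (\<Sum>j<q. \<phi> j + t j + z j)"
    by (simp add: sum.distrib)
  also have "\<dots> = (\<Sum>j<q. k)" by (rule sum.cong) (simp_all add: \<phi>_def le')
  finally have s\<phi>: "(\<Sum>j<q. \<phi> j) = h" using st sz by simp
  have "\<exists>m. (\<forall>j<q. m j \<le> \<phi> j) \<and> (\<Sum>j<q. m j) = t0 \<and>
    (\<Sum>j<q. \<phi> j) choose t0 \<le> (k + 1) ^ q * (\<Prod>j<q. (\<phi> j choose m j))"
    by (rule binomial_split_pigeonhole) (use s\<phi> th in \<open>auto simp: \<phi>_def\<close>)
  then obtain m where m: "\<And>j. j < q \<Longrightarrow> m j \<le> \<phi> j" "(\<Sum>j<q. m j) = t0"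
    "h choose t0 \<le> (k + 1) ^ q * (\<Prod>j<q. (\<phi> j choose m j))" unfolding s\<phi> by (elim exE conjE) blast
  define P where "P = real (\<Prod>j<q. (\<phi> j choose m j))"
  define H where "H = real (h choose t0)"
  have H: "0 < H" using th by (simp add: H_def)
  have "H \<le> real ((k + 1) ^ q * (\<Prod>j<q. (\<phi> j choose m j)))" unfolding H_def using m(3) by (rule of_nat_mono)
  then have HP: "H \<le> real (k + 1) ^ q * P" by (simp only: P_def of_nat_mult of_nat_power)
  have P: "0 < P" unfolding P_def of_nat_prod by (intro prod_pos) (simp add: m(1))
  have bound: "(\<Prod>j<q. 13 * real k * (real (n j choose l j) / real (\<phi> j choose m j)))
      \<le> (13 * real k * real (k + 1)) ^ q * (real (n0 choose l0) / H)"
    if "(\<Sum>j<q. n j) = n0" "(\<Sum>j<q. l j) = l0" for n l :: "nat \<Rightarrow> nat" and n0 l0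
  proof -
    define B where "B = real (n0 choose l0)"
    have "(\<Prod>j<q. (n j choose l j)) \<le> n0 choose l0" using prod_binomial_le[of n l q] that by simp
    then have "real (\<Prod>j<q. (n j choose l j)) \<le> B" unfolding B_def by (rule of_nat_mono)
    moreover have "(\<Prod>j<q. 13 * real k * (real (n j choose l j) / real (\<phi> j choose m j))) =
        (13 * real k) ^ q * (real (\<Prod>j<q. (n j choose l j)) / P)"
      unfolding P_def prod.distrib prod_dividef of_nat_prod by simp
    ultimately have "(\<Prod>j<q. 13 * real k * (real (n j choose l j) / real (\<phi> j choose m j))) \<le> (13 * real k) ^ q * (B / P)"
      using P by (simp add: mult_left_mono divide_right_mono)
    also have "B / P \<le> B * (real (k + 1) ^ q / H)"
    proof -
      have "H / P \<le> real (k + 1) ^ q" using HP P by (simp add: divide_le_eq)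
      then have "1 / P \<le> real (k + 1) ^ q / H" using H P by (simp add: field_simps)
      then have "B * (1 / P) \<le> B * (real (k + 1) ^ q / H)" by (rule mult_left_mono) (simp add: B_def)
      then show ?thesis by simp
    qed
    finally have "(\<Prod>j<q. 13 * real k * (real (n j choose l j) / real (\<phi> j choose m j)))
      \<le> (13 * real k) ^ q * (B * (real (k + 1) ^ q / H))" by (simp add: mult_left_mono)
    also have "\<dots> = (13 * real k * real (k + 1)) ^ q * (B / H)" unfolding power_mult_distrib by (simp add: field_simps)
    finally show ?thesis unfolding B_def .
  qed
  have "(\<Sum>j<q. k - t j) + (\<Sum>j<q. t j) = (\<Sum>j<q. k)"
    unfolding sum.distrib[symmetric] by (rule sum.cong) (simp_all add: le')
  then have s1: "(\<Sum>j<q. k - t j) = q * k - t0" using st by simp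
  have "(\<Sum>j<q. k - z j) + (\<Sum>j<q. z j) = (\<Sum>j<q. k)"
    unfolding sum.distrib[symmetric] by (rule sum.cong) (simp_all add: le')
  then have s2: "(\<Sum>j<q. k - z j) = h + t0" using sz by simp
  have s3: "(\<Sum>j<q. t j + m j) = 2 * t0" using st m(2) by (simp add: sum.distrib)
  show ?thesis
  proof (intro exI[of _ m] conjI allI impI)
    fix j assume "j < q"
    then show "t j + z j + m j \<le> k" using m(1)[of j] le[of j] by (simp add: \<phi>_def)
  next
    show "(\<Prod>j<q. load1 k (t j) (z j) (m j)) \<le> (13 * real k * real (k + 1)) ^ q * (real ((q * k - t0) choose t0) / real (h choose t0))"
      using bound[OF s1 m(2)] unfolding load1_def \<phi>_def H_def by simp
    show "(\<Prod>j<q. load2 k (t j) (z j) (m j)) \<le> (13 * real k * real (k + 1)) ^ q * (real ((h + t0) choose (2 * t0)) / real (h choose t0))"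
      using bound[OF s2 s3] unfolding load2_def \<phi>_def H_def by simp
  qed
qed

lemma less_div_Suc:
  fixes a c :: nat
  assumes "0 < c"
  shows "real a / real c \<le> real (a div c + 1)"
proof -
  have "a < c * (a div c + 1)" using dividend_less_times_div[OF assms, of a] by simp
  then have "real a \<le> real (c * (a div c + 1))" by (intro of_nat_mono) simp
  then have "real a \<le> real (a div c + 1) * real c" by (simp only: of_nat_mult mult.commute)
  then show ?thesis using assms by (simp only: divide_le_eq of_nat_0_less_iff if_True)
qed

context table begin

lemma block_counts:
  assumes "length xs = d" "set xs \<subseteq> {0, 1, 2}" "count_list xs 2 = t" "count_list xs 1 = h" "d \<le> q * k"
  shows "(\<Sum>j<q. card (twos k (ternary_value xs div b ^ j mod b))) = t"
    "(\<Sum>j<q. card (zeros k (ternary_value xs div b ^ j mod b))) + h + t = q * k"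
proof -
  define A where "A c = {i \<in> {..<q * k}. ternary_value xs div 3 ^ i mod 3 = c}" for c
  have c: "card (A 2) = t" "card (A 1) = h"
    unfolding A_def using card_ternary_digits[OF assms(2), of "q * k" 2] card_ternary_digits[OF assms(2), of "q * k" 1] assms by simp_all
  have fin: "finite (A c)" for c by (simp add: A_def)
  have "{..<q * k} = A 0 \<union> (A 1 \<union> A 2)"
  proof -
    have "y mod 3 = 0 \<or> y mod 3 = 1 \<or> y mod 3 = 2" for y :: nat by linarith
    then show ?thesis unfolding A_def by blast
  qed
  moreover have "A 0 \<inter> (A 1 \<union> A 2) = {}" "A 1 \<inter> A 2 = {}" by (auto simp: A_def)
  ultimately have "card {..<q * k} = card (A 0) + (card (A 1) + card (A 2))"
    using fin by (simp add: card_Un_disjoint)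
  then have z: "card (A 0) + h + t = q * k" using c by simp
  show "(\<Sum>j<q. card (twos k (ternary_value xs div b ^ j mod b))) = t"
    unfolding b twos_block using card_blocks[of k "\<lambda>i. ternary_value xs div 3 ^ i mod 3 = 2" q] c(1) unfolding A_def by simp
  show "(\<Sum>j<q. card (zeros k (ternary_value xs div b ^ j mod b))) + h + t = q * k"
    unfolding b zeros_block using card_blocks[of k "\<lambda>i. ternary_value xs div 3 ^ i mod 3 = 0" q] z unfolding A_def by simp
qed

text \<open>Each block contributes one factor of either load, and each of them costs
  \<open>13 * k * (k + 1)\<close>: the load constant times the pigeonhole loss.\<close>

lemma slack_le: "(13 * real k * real (k + 1))\<^sup>2 \<le> real S"
proof -
  have "13 * k * (k + 1) \<le> (k + 9)\<^sup>2 * (k + 9)"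
    by (rule mult_le_mono) (auto simp: power2_eq_square algebra_simps)
  then have "(13 * k * (k + 1))\<^sup>2 \<le> ((k + 9)\<^sup>2 * (k + 9))\<^sup>2" by (rule power_mono) simp
  also have "\<dots> = S" unfolding S by (simp only: power_mult_distrib flip: power_mult power_Suc2) simp
  finally have "real ((13 * k * (k + 1))\<^sup>2) \<le> real S" by (rule of_nat_mono)
  then show ?thesis by (simp only: of_nat_power of_nat_mult of_nat_numeral)
qed

text \<open>In each block the profile combines the twos of \<open>xs\<close> with the zeros of
  \<open>ys\<close> and vice versa. Either radix is bounded by a \<open>load1\<close> from one of
  the two families times a \<open>load2\<close> from the other, so over all blocks both roles obey
  the same bound \<open>R1 * R2\<close>, and one budget of visits serves A and B.\<close>

lemma visits_exist:
  assumes xs: "length xs = d" "set xs \<subseteq> {0, 1, 2}" "count_list xs 2 = t" "count_list xs 1 = h"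
    and ys: "length ys = d" "set ys \<subseteq> {0, 1, 2}" "count_list ys 2 = t" "count_list ys 1 = h"
    and comp: "compatible d xs ys" and d: "d = 2 * h" "2 * t \<le> h" and q: "q = d div k + 1"
    and x: "x < X" and Wc: "Wc = X * D * (d + 1)\<^sup>2 * (S * S) ^ q"
  shows "\<exists>w<visits_bound d h Wc t. \<exists>w'<visits_bound d h Wc t. w mod X = x \<and> w' mod X = x \<and>
    label b S D x 0 q (w div X) (ternary_value xs) x = label b S D x 1 q (w' div X) (ternary_value ys) x"
proof -
  define U where "U j = ternary_value xs div b ^ j mod b" for j
  define V where "V j = ternary_value ys div b ^ j mod b" for j
  have dk: "d \<le> q * k" "q * k \<le> d + k"
  proof -
    have "d = d div k * k + d mod k" by simp
    moreover have "d mod k < k" using k by simp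
    ultimately show "d \<le> q * k" "q * k \<le> d + k" unfolding q add_mult_distrib by linarith+
  qed
  have "clash d (ternary_value xs) (ternary_value ys) = 0"
    using clash_list_iff[OF xs(1) ys(1) xs(2) ys(2)] comp by simp
  then have ag: "agree k (U j) (V j)" for j
    unfolding U_def V_def b using ternary_value_less[OF xs(2)] ternary_value_less[OF ys(2)] xs(1) ys(1)
    by (intro agree_if_clash_zero) auto
  have UV: "U j < b" "V j < b" for j using pos by (auto simp: U_def V_def)
  have disj: "card (twos k u) + card (zeros k v) \<le> k" if "twos k u \<inter> zeros k v = {}" for u v
  proof -
    have "card (twos k u) + card (zeros k v) = card (twos k u \<union> zeros k v)"
      using that by (intro card_Un_disjoint[symmetric]) (auto simp: twos_def zeros_def)
    also have "\<dots> \<le> card {..<k}" by (rule card_mono) (auto simp: twos_def zeros_def)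
    finally show ?thesis by simp
  qed
  note bx = block_counts[OF xs dk(1), folded U_def] and bY = block_counts[OF ys dk(1), folded V_def]
  have th: "t \<le> h" using d by simp
  define R1 where "R1 = (13 * real k * real (k + 1)) ^ q * (real ((q * k - t) choose t) / real (h choose t))"
  define R2 where "R2 = (13 * real k * real (k + 1)) ^ q * (real ((h + t) choose (2 * t)) / real (h choose t))"
  have disj1: "card (twos k (U j)) + card (zeros k (V j)) \<le> k" "card (twos k (V j)) + card (zeros k (U j)) \<le> k" for j
    using ag[of j] disj unfolding agree_def by simp_all
  obtain m where m0: "\<forall>j<q. card (twos k (U j)) + card (zeros k (V j)) + m j \<le> k"
    and m: "(\<Prod>j<q. load1 k (card (twos k (U j))) (card (zeros k (V j))) (m j)) \<le> R1"
    "(\<Prod>j<q. load2 k (card (twos k (U j))) (card (zeros k (V j))) (m j)) \<le> R2"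
    using prod_loads[OF k disj1(1) bx(1) bY(2) th] unfolding R1_def[symmetric] R2_def[symmetric] by (elim exE conjE)
  note m = m0[rule_format] m
  obtain m' where m'0: "\<forall>j<q. card (twos k (V j)) + card (zeros k (U j)) + m' j \<le> k"
    and m': "(\<Prod>j<q. load1 k (card (twos k (V j))) (card (zeros k (U j))) (m' j)) \<le> R1"
    "(\<Prod>j<q. load2 k (card (twos k (V j))) (card (zeros k (U j))) (m' j)) \<le> R2"
    using prod_loads[OF k disj1(2) bY(1) bx(2) th] unfolding R1_def[symmetric] R2_def[symmetric] by (elim exE conjE)
  note m' = m'0[rule_format] m'
  let ?l1 = "\<lambda>j. load1 k (card (twos k (U j))) (card (zeros k (V j))) (m j)"
  let ?l2 = "\<lambda>j. load2 k (card (twos k (U j))) (card (zeros k (V j))) (m j)"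
  let ?n1 = "\<lambda>j. load1 k (card (twos k (V j))) (card (zeros k (U j))) (m' j)"
  let ?n2 = "\<lambda>j. load2 k (card (twos k (V j))) (card (zeros k (U j))) (m' j)"
  have "\<exists>s. \<forall>j. j < q \<longrightarrow> s j < S \<and> real (radix b D x 0 (s j)) \<le> ?l1 j * ?n2 j \<and> real (radix b D x 1 (s j)) \<le> ?l2 j * ?n1 j \<and>
     (\<exists>i<radix b D x 0 (s j). \<exists>i'<radix b D x 1 (s j). letter D x 0 (U j) (s j) i = letter D x 1 (V j) (s j) i')"
  proof (rule choice, intro allI)
    fix j
    show "\<exists>s. j < q \<longrightarrow> s < S \<and> real (radix b D x 0 s) \<le> ?l1 j * ?n2 j \<and> real (radix b D x 1 s) \<le> ?l2 j * ?n1 j \<and>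
     (\<exists>i<radix b D x 0 s. \<exists>i'<radix b D x 1 s. letter D x 0 (U j) s i = letter D x 1 (V j) s i')"
    proof (cases "j < q")
      case True
      obtain s where s: "s < S" "real (radix b D x 0 s) \<le> ?l1 j * ?n2 j" "real (radix b D x 1 s) \<le> ?l2 j * ?n1 j"
        and all: "\<forall>u<b. \<forall>v<b. agree k u v \<longrightarrow> card (twos k u) = card (twos k (U j)) \<longrightarrow> card (zeros k v) = card (zeros k (V j)) \<longrightarrow>
            card (twos k v) = card (twos k (V j)) \<longrightarrow> card (zeros k u) = card (zeros k (U j)) \<longrightarrow>
            (\<exists>i<radix b D x 0 s. \<exists>i'<radix b D x 1 s. letter D x 0 u s i = letter D x 1 v s i')"
        using covering[OF m(1)[OF True] m'(1)[OF True]] by (elim exE conjE)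
      have ex: "\<exists>i<radix b D x 0 s. \<exists>i'<radix b D x 1 s. letter D x 0 (U j) s i = letter D x 1 (V j) s i'"
        by (rule all[rule_format, OF UV(1) UV(2) ag refl refl refl refl])
      show ?thesis by (rule exI[of _ s], rule impI) (rule conjI[OF s(1) conjI[OF s(2) conjI[OF s(3) ex]]])
    qed simp
  qed
  then obtain s where s0: "\<forall>j. j < q \<longrightarrow> s j < S \<and> real (radix b D x 0 (s j)) \<le> ?l1 j * ?n2 j \<and> real (radix b D x 1 (s j)) \<le> ?l2 j * ?n1 j \<and>
     (\<exists>i<radix b D x 0 (s j). \<exists>i'<radix b D x 1 (s j). letter D x 0 (U j) (s j) i = letter D x 1 (V j) (s j) i')"
    by (rule exE)
  note s1 = s0[THEN spec, THEN mp]
  note s = s1[THEN conjunct1] s1[THEN conjunct2, THEN conjunct1] s1[THEN conjunct2, THEN conjunct2, THEN conjunct1]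
    s1[THEN conjunct2, THEN conjunct2, THEN conjunct2]
  \<comment> \<open>The quotient of self-powers, rounded up by the added 1; \<open>P\<close> is the
    part of the visit budget left for each table code.\<close>
  define F where "F = (d - t) ^ (d - t) * (h + t) ^ (h + t) div t ^ t div (h - t) ^ (h - t) div d ^ d + 1"
  define P where "P = (S * S) ^ q * D * (d + 1)\<^sup>2 * F"
  have l0: "0 \<le> load1 k a c e" "0 \<le> load2 k a c e" for a c e by (simp_all add: load1_def load2_def)
  have R0: "0 \<le> R1" "0 \<le> R2" by (simp_all add: R1_def R2_def)
  have RR: "real S ^ q * (R1 * R2) \<le> real P"
  proof -
    define c where "c = 13 * real k * real (k + 1)"
    define a1 where "a1 = real ((q * k - t) choose t)"
    define a2 where "a2 = real ((h + t) choose (2 * t))"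
    define a3 where "a3 = real (h choose t)"
    define E where "E = real ((2 * h - t) ^ (2 * h - t)) * real ((h + t) ^ (h + t)) /
        (real (t ^ t) * real ((h - t) ^ (h - t)) * real ((2 * h) ^ (2 * h)))"
    have EF: "E \<le> real F"
    proof -
      have "0 < n ^ n" for n :: nat by (cases n) auto
      then have "0 < t ^ t * (h - t) ^ (h - t) * d ^ d" by (simp only: nat_0_less_mult_iff)
      from less_div_Suc[OF this, of "(d - t) ^ (d - t) * (h + t) ^ (h + t)"]
      show ?thesis unfolding E_def F_def d(1) div_mult2_eq of_nat_mult .
    qed
    have E0: "0 \<le> E" by (simp add: E_def)
    have R: "R1 * R2 = (c ^ 2) ^ q * (a1 * a2 / a3\<^sup>2)"
      unfolding R1_def R2_def c_def[symmetric] a1_def[symmetric] a2_def[symmetric] a3_def[symmetric]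
      by (simp add: power2_eq_square power_mult_distrib)
    have "a1 * a2 / a3\<^sup>2 \<le> 2 ^ k * ((real (h + 1))\<^sup>2 * E)"
      unfolding a1_def a2_def a3_def E_def by (rule entropy_binomial_bound) (use d dk in auto)
    also have "\<dots> \<le> real D * ((real (d + 1))\<^sup>2 * real F)"
    proof (intro mult_mono)
      have "(2::nat) ^ k \<le> 4 ^ k" by (rule power_mono) auto
      also have "\<dots> \<le> D" using size_bounds(4)[OF k] by (simp add: D b)
      finally have "real (2 ^ k) \<le> real D" by (rule of_nat_mono)
      then show "2 ^ k \<le> real D" by simp
      show "(real (h + 1))\<^sup>2 \<le> (real (d + 1))\<^sup>2" using d by (intro power_mono) auto
    qed (use EF E0 in auto)
    finally have a: "a1 * a2 / a3\<^sup>2 \<le> real D * ((real (d + 1))\<^sup>2 * real F)" .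
    have "(c ^ 2) ^ q \<le> real S ^ q" unfolding c_def by (rule power_mono[OF slack_le]) simp
    then have "R1 * R2 \<le> real S ^ q * (real D * ((real (d + 1))\<^sup>2 * real F))"
      unfolding R using a by (rule mult_mono) (simp_all add: a1_def a2_def)
    then have "real S ^ q * (R1 * R2) \<le> real S ^ q * (real S ^ q * (real D * ((real (d + 1))\<^sup>2 * real F)))"
      by (rule mult_left_mono) simp
    also have "\<dots> = real P" unfolding P_def of_nat_mult of_nat_power power_mult_distrib by (simp only: mult.assoc)
    finally show ?thesis .
  qed
  have P0: "(\<Prod>j<q. S * radix b D x 0 (s j)) \<le> P"
  proof -
    have "(\<Prod>j<q. real (radix b D x 0 (s j))) \<le> (\<Prod>j<q. ?l1 j * ?n2 j)"
      by (rule prod_mono) (use s(2) in simp)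
    also have "\<dots> = (\<Prod>j<q. ?l1 j) * (\<Prod>j<q. ?n2 j)" by (rule prod.distrib)
    also have "\<dots> \<le> R1 * R2"
      by (rule mult_mono[OF m(2) m'(3) R0(1) prod_nonneg]) (rule l0)
    finally have "(\<Prod>j<q. real (radix b D x 0 (s j))) \<le> R1 * R2" by (simp only: mult.commute)
    then have "real S ^ q * (\<Prod>j<q. real (radix b D x 0 (s j))) \<le> real S ^ q * (R1 * R2)"
      by (rule mult_left_mono) simp
    also have "\<dots> \<le> real P" by (rule RR)
    also have "real S ^ q * (\<Prod>j<q. real (radix b D x 0 (s j))) = real (\<Prod>j<q. S * radix b D x 0 (s j))"
      by (simp add: prod.distrib)
    finally show ?thesis by (simp only: of_nat_le_iff)
  qed
  have P1: "(\<Prod>j<q. S * radix b D x 1 (s j)) \<le> P"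
  proof -
    have "(\<Prod>j<q. real (radix b D x 1 (s j))) \<le> (\<Prod>j<q. ?l2 j * ?n1 j)"
      by (rule prod_mono) (use s(3) in simp)
    also have "\<dots> = (\<Prod>j<q. ?l2 j) * (\<Prod>j<q. ?n1 j)" by (rule prod.distrib)
    also have "\<dots> \<le> R2 * R1"
      by (rule mult_mono[OF m(3) m'(2) R0(2) prod_nonneg]) (rule l0)
    finally have "(\<Prod>j<q. real (radix b D x 1 (s j))) \<le> R1 * R2" by (simp only: mult.commute)
    then have "real S ^ q * (\<Prod>j<q. real (radix b D x 1 (s j))) \<le> real S ^ q * (R1 * R2)"
      by (rule mult_left_mono) simp
    also have "\<dots> \<le> real P" by (rule RR)
    also have "real S ^ q * (\<Prod>j<q. real (radix b D x 1 (s j))) = real (\<Prod>j<q. S * radix b D x 1 (s j))"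
      by (simp add: prod.distrib)
    finally show ?thesis by (simp only: of_nat_le_iff)
  qed
  obtain w w' where w: "w < (\<Prod>j<q. S * radix b D x 0 (s j))" "w' < (\<Prod>j<q. S * radix b D x 1 (s j))"
    "label b S D x 0 q w (ternary_value xs) x = label b S D x 1 q w' (ternary_value ys) x"
    using label_complete[of q s "ternary_value xs" "ternary_value ys" x] s(1,4) unfolding U_def V_def by blast
  have XP: "X * P = visits_bound d h Wc t"
    unfolding visits_bound_def P_def F_def[symmetric] Wc by (simp only: mult_ac)
  \<comment> \<open>The visit number with code \<open>x\<close> as its last digit in base
    \<open>X\<close>, as \<open>label_com\<close> decodes it.\<close>
  have fit: "x + X * v < visits_bound d h Wc t" "(x + X * v) mod X = x" "(x + X * v) div X = v" if "v < P" for v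
  proof -
    have "x + X * v < X * (v + 1)" using x by simp
    also have "\<dots> \<le> X * P" using that by (intro mult_le_mono2) simp
    finally show "x + X * v < visits_bound d h Wc t" unfolding XP .
    show "(x + X * v) mod X = x" "(x + X * v) div X = v" using x by simp_all
  qed
  have "w < P" "w' < P" using w P0 P1 by linarith+
  then show ?thesis using fit[of w] fit[of w'] w(3)
    by (intro exI[of _ "x + X * w"] conjI exI[of _ "x + X * w'"]) simp_all
qed

end

section \<open>The exponent\<close>

text \<open>
Here \<open>xlog 0 = 0\<close>, which agrees with the convention for the entropy and with $0^0 = 1$.
\<close>

definition xlog :: "real \<Rightarrow> real" where "xlog x = x * log 2 x"

lemma binary_entropy_xlog:
  assumes "0 < n" "0 \<le> m" "m \<le> n"
  shows "n * binary_entropy (m / n) = xlog n - xlog m - xlog (n - m)"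
proof -
  have 1: "m * log 2 (m / n) = xlog m - m * log 2 n"
    using assms by (cases "m = 0") (auto simp: xlog_def log_divide algebra_simps)
  have 2: "(n - m) * log 2 ((n - m) / n) = xlog (n - m) - (n - m) * log 2 n"
    using assms by (cases "m = n") (auto simp: xlog_def log_divide algebra_simps)
  have "n * binary_entropy (m / n) = - (m * log 2 (m / n)) - (n - m) * log 2 ((n - m) / n)"
    using assms(1) by (simp add: binary_entropy_def field_simps)
  also have "\<dots> = xlog n - xlog m - xlog (n - m)" unfolding 1 2 by (simp add: xlog_def algebra_simps)
  finally show ?thesis .
qed

text \<open>The terms for \<open>2 * \<epsilon>\<close> and \<open>1 - 2 * \<epsilon>\<close> cancel
  between the three entropies. The four that remain correspond to the self-powers in
  \<open>entropy_binomial_bound\<close>.\<close>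

lemma exponent_xlog:
  assumes "0 \<le> \<epsilon>" "\<epsilon> \<le> 1 / 4"
  shows "exponent \<epsilon> = xlog (1 - \<epsilon>) + xlog (1 / 2 + \<epsilon>) - xlog \<epsilon> - xlog (1 / 2 - \<epsilon>)"
proof -
  have 1: "(1 - \<epsilon>) * binary_entropy (\<epsilon> / (1 - \<epsilon>)) = xlog (1 - \<epsilon>) - xlog \<epsilon> - xlog (1 - \<epsilon> - \<epsilon>)"
    by (rule binary_entropy_xlog) (use assms in auto)
  have 2: "(1 / 2 + \<epsilon>) * binary_entropy (2 * \<epsilon> / (1 / 2 + \<epsilon>)) = xlog (1 / 2 + \<epsilon>) - xlog (2 * \<epsilon>) - xlog (1 / 2 + \<epsilon> - 2 * \<epsilon>)"
    by (rule binary_entropy_xlog) (use assms in auto)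
  have e: "2 * \<epsilon> / (1 / 2 + \<epsilon>) = 4 * \<epsilon> / (1 + 2 * \<epsilon>)" using assms by (simp add: field_simps)
  have 3: "1 * binary_entropy (2 * \<epsilon> / 1) = xlog 1 - xlog (2 * \<epsilon>) - xlog (1 - 2 * \<epsilon>)"
    by (rule binary_entropy_xlog) (use assms in auto)
  have a: "1 - \<epsilon> - \<epsilon> = 1 - 2 * \<epsilon>" "1 / 2 + \<epsilon> - 2 * \<epsilon> = 1 / 2 - \<epsilon>" "xlog 1 = 0" by (auto simp: xlog_def)
  show ?thesis unfolding exponent_def using 1 2 3 unfolding e a by simp
qed

text \<open>Needed to absorb the added 1 of the rounded quotient into
  \<open>2 powr (exponent \<epsilon> * d)\<close>. Each logarithm is replaced by a bound linear in
  \<epsilon>.\<close>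

lemma exponent_nonneg:
  assumes "0 \<le> \<epsilon>" "\<epsilon> \<le> 1 / 4"
  shows "0 \<le> exponent \<epsilon>"
proof (cases "\<epsilon> = 0")
  case True
  then show ?thesis unfolding exponent_xlog[OF assms] by (simp add: xlog_def)
next
  case False
  then have e: "0 < \<epsilon>" using assms by simp
  define u v where "u = 1 / 2 + \<epsilon>" and "v = 1 / 2 - \<epsilon>"
  have uv: "0 < u" "0 < v" "u \<le> 3 / 4" using assms by (auto simp: u_def v_def)
  have 1: "- \<epsilon> \<le> (1 - \<epsilon>) * ln (1 - \<epsilon>)"
  proof -
    have "ln (1 / (1 - \<epsilon>)) \<le> 1 / (1 - \<epsilon>) - 1" using assms by (intro ln_le_minus_one) auto
    then have "- ln (1 - \<epsilon>) \<le> \<epsilon> / (1 - \<epsilon>)" using assms by (simp add: ln_div field_simps)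
    then have "(1 - \<epsilon>) * (- ln (1 - \<epsilon>)) \<le> (1 - \<epsilon>) * (\<epsilon> / (1 - \<epsilon>))" using assms by (intro mult_left_mono) auto
    then show ?thesis using assms by simp
  qed
  have 2: "\<epsilon> * ln 4 \<le> - (\<epsilon> * ln \<epsilon>)"
  proof -
    have "ln \<epsilon> \<le> ln (1 / 4)" using assms e by (intro ln_mono) auto
    then have "ln 4 \<le> - ln \<epsilon>" by (simp add: ln_div)
    then show ?thesis using e mult_left_mono[of "ln 4" "- ln \<epsilon>" \<epsilon>] by simp
  qed
  have 3: "8 / 3 * \<epsilon> \<le> ln u - ln v"
  proof -
    have "ln (v / u) \<le> v / u - 1" using uv by (intro ln_le_minus_one) auto
    moreover have "v / u - 1 = - (2 * \<epsilon> / u)"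
    proof -
      have "v / u - 1 = (v - u) / u" using uv by (simp add: diff_divide_distrib)
      also have "v - u = - (2 * \<epsilon>)" by (simp add: u_def v_def)
      finally show ?thesis by simp
    qed
    moreover have "8 / 3 * \<epsilon> \<le> 2 * \<epsilon> / u"
    proof -
      have "8 / 3 * \<epsilon> * u \<le> 8 / 3 * \<epsilon> * (3 / 4)" using uv e by (intro mult_left_mono) auto
      then show ?thesis using uv by (simp add: le_divide_eq)
    qed
    ultimately show ?thesis using uv by (simp add: ln_div)
  qed
  \<comment> \<open>The product \<open>u * v\<close> is 1/4 minus the square of \<epsilon>, which is
    at least 1/4 - 1/16.\<close>
  have 4: "\<epsilon> * ln (3 / 16) \<le> \<epsilon> * (ln u + ln v)"
  proof -
    have "\<epsilon> * \<epsilon> \<le> 1 / 4 * (1 / 4)" using assms by (intro mult_mono) auto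
    then have "3 / 16 \<le> u * v" by (simp add: u_def v_def algebra_simps)
    then have "ln (3 / 16) \<le> ln (u * v)" by (intro ln_mono) auto
    then show ?thesis using uv e by (simp add: ln_mult)
  qed
  have 5: "- (1 / 3) \<le> ln 4 + ln (3 / 16 :: real)"
  proof -
    have "ln (4 / 3) \<le> 4 / 3 - (1 :: real)" by (intro ln_le_minus_one) auto
    moreover have "ln 4 + ln (3 / 16) = ln (3 / 4 :: real)" using ln_mult[of 4 "3 / 16 :: real"] by simp
    moreover have "ln (4 / 3) = - ln (3 / 4 :: real)" using ln_inverse[of "3 / 4 :: real"] by simp
    ultimately show ?thesis by simp
  qed
  have 5: "- (1 / 3) * \<epsilon> \<le> \<epsilon> * ln 4 + \<epsilon> * ln (3 / 16)"
    using mult_left_mono[OF 5, of \<epsilon>] e by (simp add: algebra_simps)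
  have 6: "u * ln u - v * ln v = (ln u - ln v) / 2 + \<epsilon> * (ln u + ln v)"
  proof -
    have "(1 / 2 + \<epsilon>) * a - (1 / 2 - \<epsilon>) * b = (a - b) / 2 + \<epsilon> * (a + b)" for a b
      by (simp add: field_simps)
    then show ?thesis unfolding u_def v_def .
  qed
  \<comment> \<open>The linear bounds balance exactly: their coefficients of \<epsilon> are -1, 4/3
    and -1/3.\<close>
  have "0 \<le> a + P - E - Q"
    if "P - Q = L / 2 + M" "- \<epsilon> \<le> a" "F \<le> - E" "8 / 3 * \<epsilon> \<le> L" "G \<le> M" "- (1 / 3) * \<epsilon> \<le> F + G"
    for a P Q L M E F G :: real
    using that by linarith
  from this[OF 6 1 2 3 4 5] have "0 \<le> (1 - \<epsilon>) * ln (1 - \<epsilon>) + u * ln u - \<epsilon> * ln \<epsilon> - v * ln v" .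
  then have "0 \<le> ((1 - \<epsilon>) * ln (1 - \<epsilon>) + u * ln u - \<epsilon> * ln \<epsilon> - v * ln v) / ln 2" by simp
  also have "\<dots> = exponent \<epsilon>" unfolding exponent_xlog[OF assms]
    by (simp add: xlog_def log_def u_def v_def diff_divide_distrib add_divide_distrib)
  finally show ?thesis .
qed

lemma powr_xlog: "2 powr xlog (real n) = real (n ^ n)"
proof (cases "n = 0")
  case False
  have "2 powr xlog (real n) = (2 powr log 2 (real n)) powr real n"
    by (simp add: xlog_def powr_powr mult.commute)
  also have "\<dots> = real n ^ n" using False by (simp add: powr_realpow)
  finally show ?thesis by simp
qed (simp add: xlog_def)

lemma xlog_scale:
  assumes "0 < d" "0 \<le> x"
  shows "xlog (d * x) = d * xlog x + d * x * log 2 d"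
  using assms by (cases "x = 0") (auto simp: xlog_def log_mult algebra_simps)

text \<open>By \<open>xlog_scale\<close> each self-power contributes a multiple of
  \<open>d * log 2 d\<close>; the signed coefficients add up to 1 and cancel against
  \<open>xlog d\<close>.\<close>

lemma powr_exponent:
  fixes d h t :: nat
  assumes \<epsilon>: "0 \<le> \<epsilon>" "\<epsilon> \<le> 1 / 4" and d: "0 < d" "d = 2 * h" and t: "real t = \<epsilon> * real d"
  shows "2 powr (exponent \<epsilon> * real d) = real ((d - t) ^ (d - t)) * real ((h + t) ^ (h + t)) /
     (real (t ^ t) * real ((h - t) ^ (h - t)) * real (d ^ d))"
proof -
  have "real t \<le> 1 / 4 * real d" unfolding t using \<epsilon> by (intro mult_right_mono) auto
  then have "real t \<le> real h" using d by simp
  then have th: "t \<le> h" by simp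
  have r: "real (d - t) = real d * (1 - \<epsilon>)" "real (h + t) = real d * (1 / 2 + \<epsilon>)" "real t = real d * \<epsilon>"
    "real (h - t) = real d * (1 / 2 - \<epsilon>)"
    using th d t by (auto simp: of_nat_diff algebra_simps)
  have d0: "0 < real d" using d by simp
  have "xlog (real (d - t)) + xlog (real (h + t)) - xlog (real t) - xlog (real (h - t)) - xlog (real d)
     = exponent \<epsilon> * real d"
    unfolding r exponent_xlog[OF \<epsilon>]
    using xlog_scale[OF d0, of "1 - \<epsilon>"] xlog_scale[OF d0, of "1 / 2 + \<epsilon>"] xlog_scale[OF d0, of \<epsilon>] xlog_scale[OF d0, of "1 / 2 - \<epsilon>"] \<epsilon>
    by (simp add: xlog_def[of "real d"] algebra_simps)
  then have "2 powr (exponent \<epsilon> * real d) =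
      2 powr (xlog (real (d - t)) + xlog (real (h + t)) - xlog (real t) - xlog (real (h - t)) - xlog (real d))" by simp
  also have "\<dots> = 2 powr xlog (real (d - t)) * 2 powr xlog (real (h + t)) / (2 powr xlog (real t) * 2 powr xlog (real (h - t)) * 2 powr xlog (real d))"
    by (simp add: powr_add powr_diff)
  finally show ?thesis unfolding powr_xlog .
qed

text \<open>
The block length grows so slowly that the number of tables has polylogarithmic length, yet it is unbounded, so that a
factor polynomial in it per block is still $2^{o(d)}$ in total.
\<close>

definition blk :: "nat \<Rightarrow> nat" where "blk d = floorlog 2 (floorlog 2 d) + 1"
definition dig_base :: "nat \<Rightarrow> nat" where "dig_base d = (3 ^ blk d) ^ 16"
definition tables :: "nat \<Rightarrow> nat" where "tables d = dig_base d ^ (2 * dig_base d ^ 3)"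
text \<open>The exponents 4 and 5 add up three contributions: one factor \<open>tables d\<close> and
  one \<open>d + 2\<close> for the steps of a visit, two of each from \<open>Wc\<close>, where
  \<open>dig_base d\<close> is bounded by \<open>tables d\<close>, and one and two from the number
  of bits.\<close>

definition overhead :: "nat \<Rightarrow> nat" where
  "overhead d = tables d ^ 4 * (d + 2) ^ 5 * ((blk d + 9) ^ 6 * (blk d + 9) ^ 6) ^ (d div blk d + 1)"

section \<open>The overhead is subexponential\<close>

lemma filterlim_floorlog: "filterlim (floorlog 2) at_top at_top"
  unfolding filterlim_at_top
proof
  fix Z :: nat
  show "\<forall>\<^sub>F n in at_top. Z \<le> floorlog 2 n"
    using eventually_ge_at_top[of "2 ^ Z"]
  proof eventually_elim
    case (elim n)
    have "(2::nat) ^ (Z - 1) \<le> 2 ^ Z" by (rule power_increasing) auto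
    then have "2 ^ (Z - 1) \<le> n" using elim by (rule order.trans)
    then show ?case by (rule floorlog_geI) simp
  qed
qed

lemma filterlim_blk: "filterlim blk at_top at_top"
proof -
  have "filterlim (\<lambda>d. floorlog 2 (floorlog 2 d)) at_top at_top"
    by (rule filterlim_compose[OF filterlim_floorlog filterlim_floorlog])
  then show ?thesis unfolding blk_def by (rule filterlim_at_top_mono) simp
qed

lemma power_floorlog_le: "1 \<le> n \<Longrightarrow> 2 ^ floorlog 2 n \<le> 2 * n"
  using floorlog_bounds[of n 2] by (cases "floorlog 2 n") auto

lemma floorlog_le_log: "1 \<le> n \<Longrightarrow> real (floorlog 2 n) \<le> log 2 (real n) + 1"
proof -
  assume n: "1 \<le> n"
  have "real (2 ^ floorlog 2 n) \<le> real (2 * n)" using power_floorlog_le[OF n] by (rule of_nat_mono)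
  then have "2 powr real (floorlog 2 n) \<le> 2 * real n" by (simp add: powr_realpow)
  then have "log 2 (2 powr real (floorlog 2 n)) \<le> log 2 (2 * real n)" using n by (subst log_le_cancel_iff) auto
  then show ?thesis using n by (simp add: log_mult)
qed

text \<open>With \<open>k\<close> the block length, \<open>2 ^ k\<close> is at most four times the
  bit length of \<open>d\<close>. As \<open>3 ^ 16 \<le> 2 ^ 32\<close>, the base is at most
  \<open>(2 ^ k) ^ 32\<close>, and twice its cube times its logarithm has degree 3 * 32 + 1 = 97 in
  \<open>2 ^ k\<close>.\<close>

lemma log_tables_le: "2 \<le> d \<Longrightarrow> log 2 (real (tables d)) \<le> 64 * (4 * (log 2 (real d) + 1)) ^ 98"
proof -
  assume d: "2 \<le> d"
  define k where "k = blk d"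
  define L where "L = floorlog 2 d"
  have L: "1 \<le> L" unfolding L_def using d floorlog_geI[of 2 1 d] by simp
  have "2 ^ k \<le> 4 * L" using power_floorlog_le[OF L] by (simp add: k_def blk_def L_def)
  then have "real (2 ^ k) \<le> real (4 * L)" by (rule of_nat_mono)
  also have "\<dots> \<le> 4 * (log 2 (real d) + 1)" using floorlog_le_log[of d] d by (simp add: L_def)
  finally have k2: "2 ^ k \<le> 4 * (log 2 (real d) + 1)" by simp
  have D: "real (dig_base d) = (3 ^ 16) ^ k" unfolding dig_base_def k_def
    by (simp only: of_nat_power of_nat_numeral power_mult[symmetric] mult.commute)
  have D0: "0 < real (dig_base d)" by (simp add: dig_base_def)
  have "real (dig_base d) \<le> (2 ^ 32) ^ k" unfolding D by (rule power_mono) auto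
  also have "(2 ^ 32) ^ k = ((2::real) ^ k) ^ 32" by (simp only: power_mult[symmetric] mult.commute)
  finally have D2: "real (dig_base d) \<le> (2 ^ k) ^ 32" .
  have "log 2 (real (dig_base d)) \<le> log 2 ((2 ^ k) ^ 32)" using D0 D2 by (subst log_le_cancel_iff) auto
  also have "\<dots> = 32 * real k" by (simp add: log_nat_power)
  also have "\<dots> \<le> 32 * 2 ^ k" using less_exp[of k] by (simp add: of_nat_less_two_power less_imp_le)
  finally have l: "log 2 (real (dig_base d)) \<le> 32 * 2 ^ k" .
  have "log 2 (real (tables d)) = 2 * real (dig_base d) ^ 3 * log 2 (real (dig_base d))"
    using D0 by (simp add: tables_def log_nat_power)
  also have "\<dots> \<le> 2 * ((2 ^ k) ^ 32) ^ 3 * (32 * 2 ^ k)"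
    using D2 l D0 by (intro mult_mono power_mono) (auto simp: dig_base_def)
  also have "\<dots> = 64 * (2 ^ k) ^ 97" by (simp add: power_mult[symmetric] power_add[symmetric] algebra_simps)
  also have "\<dots> \<le> 64 * (4 * (log 2 (real d) + 1)) ^ 97"
    using k2 by (intro mult_left_mono power_mono) auto
  also have "\<dots> \<le> 64 * (4 * (log 2 (real d) + 1)) ^ 98"
    using d by (intro mult_left_mono power_increasing) (auto simp: zero_le_log_cancel_iff add_increasing)
  finally show ?thesis .
qed

text \<open>\<open>f1\<close> collects the tables and the powers of \<open>d + 2\<close>,
  \<open>f2\<close> the d / k blocks at \<open>12 * log 2 (k + 9)\<close> each, and
  \<open>f3\<close> the one additional block. It is \<open>f2\<close> that requires the block length
  to tend to infinity.\<close>

lemma overhead_subexponential: "(\<lambda>d. log 2 (real (overhead d)) / real d) \<longlonglongrightarrow> 0"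
proof -
  define f1 where "f1 = (\<lambda>d::nat. (256 * (4 * (log 2 (real d) + 1)) ^ 98 + 5 * log 2 (real d + 2)) / real d)"
  define f2 where "f2 = (\<lambda>d::nat. 12 * log 2 (real (blk d) + 9) * (1 / real (blk d)))"
  define f3 where "f3 = (\<lambda>d::nat. 12 * log 2 (real d + 12) / real d)"
  have upper: "\<forall>\<^sub>F d in sequentially. log 2 (real (overhead d)) / real d \<le> f1 d + f2 d + f3 d"
    using eventually_ge_at_top[of "2::nat"]
  proof eventually_elim
    case (elim d)
    define k where "k = blk d"
    have k: "1 \<le> k" "k \<le> d + 1"
    proof -
      have "floorlog 2 x \<le> x" for x by (simp add: floorlog_le_iff less_exp)
      from this[of d] this[of "floorlog 2 d"] show "1 \<le> k" "k \<le> d + 1" by (auto simp: k_def blk_def)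
    qed
    have X: "0 < tables d" by (simp add: tables_def dig_base_def)
    have "log 2 (real (overhead d)) = 4 * log 2 (real (tables d)) + 5 * log 2 (real d + 2) + real (d div k + 1) * (12 * log 2 (real k + 9))"
    proof -
      have "real (overhead d) = real (tables d) ^ 4 * (real d + 2) ^ 5 * (real k + 9) ^ (12 * (d div k + 1))"
      proof -
        have "(c ^ 6 * c ^ 6) ^ n = c ^ (12 * n)" for c n :: nat by (simp add: power_mult power_add[symmetric])
        then have "overhead d = tables d ^ 4 * (d + 2) ^ 5 * (k + 9) ^ (12 * (d div k + 1))"
          by (simp only: overhead_def k_def)
        then show ?thesis by (simp only: of_nat_mult of_nat_power of_nat_add of_nat_numeral)
      qed
      then show ?thesis using X by (simp add: log_mult log_nat_power)
    qed
    also have "\<dots> \<le> 4 * (64 * (4 * (log 2 (real d) + 1)) ^ 98) + 5 * log 2 (real d + 2) + (real d / real k + 1) * (12 * log 2 (real k + 9))"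
    proof -
      have "real (d div k) \<le> real d / real k" by (simp add: of_nat_div_le_of_nat)
      moreover have "0 \<le> log 2 (real k + 9)" by simp
      ultimately have "real (d div k + 1) * (12 * log 2 (real k + 9)) \<le> (real d / real k + 1) * (12 * log 2 (real k + 9))"
        by (intro mult_right_mono) auto
      then show ?thesis using log_tables_le[OF elim] by linarith
    qed
    finally have "log 2 (real (overhead d)) / real d \<le> (4 * (64 * (4 * (log 2 (real d) + 1)) ^ 98) + 5 * log 2 (real d + 2) + (real d / real k + 1) * (12 * log 2 (real k + 9))) / real d"
      by (rule divide_right_mono) simp
    also have "\<dots> = f1 d + f2 d + 12 * log 2 (real k + 9) / real d"
      using elim k by (simp add: f1_def f2_def k_def add_divide_distrib distrib_right)
    also have "12 * log 2 (real k + 9) / real d \<le> f3 d"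
      unfolding f3_def using k by (intro divide_right_mono mult_left_mono) auto
    finally show ?case by simp
  qed
  have "f1 \<longlonglongrightarrow> 0" unfolding f1_def by real_asymp
  moreover have "f3 \<longlonglongrightarrow> 0" unfolding f3_def by real_asymp
  moreover have "f2 \<longlonglongrightarrow> 0"
  proof -
    have "((\<lambda>n::nat. 12 * log 2 (real n + 9) * (1 / real n)) \<longlongrightarrow> 0) at_top" by real_asymp
    from filterlim_compose[OF this filterlim_blk] show ?thesis unfolding f2_def .
  qed
  ultimately have lim: "(\<lambda>d. f1 d + f2 d + f3 d) \<longlonglongrightarrow> 0" by (auto intro!: tendsto_eq_intros)
  have lower: "\<forall>\<^sub>F d in sequentially. 0 \<le> log 2 (real (overhead d)) / real d"
  proof (intro always_eventually allI)
    fix d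
    have "1 \<le> overhead d" by (simp add: overhead_def tables_def dig_base_def Suc_le_eq)
    then have "1 \<le> real (overhead d)" by simp
    then show "0 \<le> log 2 (real (overhead d)) / real d" by simp
  qed
  show ?thesis by (rule tendsto_sandwich[OF lower upper tendsto_const lim])
qed

section \<open>Correctness and running time of the search\<close>

lemma nth_concat_blocks:
  assumes "\<And>v. v \<in> set vs \<Longrightarrow> length v = d" "i < length vs" "j < d"
  shows "concat vs ! (i * d + j) = vs ! i ! j"
  using assms
proof (induction vs arbitrary: i)
  case (Cons v vs)
  have v: "length v = d" using Cons.prems by simp
  show ?case
  proof (cases i)
    case 0
    then show ?thesis using v Cons.prems by (simp add: nth_append)
  next
    case (Suc i')
    have "concat vs ! (i' * d + j) = vs ! i' ! j" by (rule Cons.IH) (use Cons.prems Suc in auto)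
    then show ?thesis using v Suc by (simp add: nth_append)
  qed
qed simp

lemma length_concat_blocks:
  "(\<And>v. v \<in> set vs \<Longrightarrow> length v = d) \<Longrightarrow> length (concat vs) = length vs * d"
  by (induction vs) auto

text \<open>As duplicates are excluded, the size of the input is bounded in terms of
  \<open>d\<close>, and the word length can be as well.\<close>

lemma length_ternary_le:
  assumes "distinct vs" "set vs \<subseteq> ternary_vectors d"
  shows "length vs \<le> 3 ^ d"
proof -
  have e: "ternary_vectors d = {xs. set xs \<subseteq> {0, 1, 2} \<and> length xs = d}"
    by (auto simp: ternary_vectors_def)
  have "length vs = card (set vs)" using assms(1) by (simp add: distinct_card)
  also have "\<dots> \<le> card (ternary_vectors d)"
    by (rule card_mono[OF _ assms(2)]) (unfold e, rule finite_lists_length_eq, simp)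
  also have "\<dots> = 3 ^ d" unfolding e by (subst card_lists_length_eq) (simp_all add: numeral_3_eq_3)
  finally show ?thesis .
qed

text \<open>Since \<open>2 * D ^ 3 < X\<close>, a factor \<open>X\<close> covers the table look-ups
  of one letter. The maxima keep the bound a product when there are no vectors and only
  initialisation and output cost time.\<close>

lemma (in search_setup) search_cost_le: "search_cost \<le> 1000 * max 1 N * (X * (d + 2)) * max 1 Wm"
proof -
  define Y where "Y = X * (d + 2)"
  have X2: "2 * D ^ 3 \<le> X" "1 \<le> X" using X_ge by simp_all
  have Yd: "X * (d + 1) \<le> Y" "X \<le> Y" unfolding Y_def by simp_all
  have "1 * (d + 2) \<le> Y" unfolding Y_def using X2 by (intro mult_le_mono1) simp
  then have Y2: "d + 2 \<le> Y" by simp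
  have q: "q \<le> d + 1" using qk by simp
  have "q * (label_cost + 1) \<le> (d + 1) * (163 * X)"
    using q X2 by (intro mult_le_mono) (simp_all add: label_cost_def)
  also have "\<dots> = 163 * (X * (d + 1))" by (simp only: mult_ac)
  also have "\<dots> \<le> 163 * Y" using Yd(1) by (rule mult_le_mono2)
  finally have v: "visit_cost + 10 \<le> 239 * Y" using Y2 unfolding visit_cost_def by linarith
  define W where "W = max 1 Wm"
  have W: "Wm \<le> W" "1 \<le> W" by (simp_all add: W_def)
  have YW: "Y \<le> Y * W" using W by simp
  have "Wm * (visit_cost + 10) \<le> W * (239 * Y)" using W v by (intro mult_le_mono)
  then have "Wm * (visit_cost + 10) \<le> 239 * (Y * W)" by (simp add: mult_ac)
  then have vc: "vector_cost + 2 \<le> 415 * (Y * W)" using Y2 YW unfolding vector_cost_def by linarith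
  define n where "n = max 1 N"
  have "N * (vector_cost + 2) \<le> n * (415 * (Y * W))" using vc by (intro mult_le_mono) (simp_all add: n_def)
  moreover have "Y * W \<le> n * (Y * W)" by (simp add: n_def)
  moreover have "init_cost + 30 * d + 60 \<le> 186 * Y" using X2 Yd Y2 q unfolding init_cost_def by linarith
  ultimately have "search_cost \<le> 1000 * (n * (Y * W))" using YW unfolding search_cost_def by linarith
  then show ?thesis unfolding n_def Y_def W_def by (simp only: mult_ac)
qed

text \<open>The word length \<open>\<beta>\<close> enters the running time only linearly, so crude
  estimates like \<open>x \<le> 2 ^ x\<close> suffice. All numbers are brought into the form
  \<open>2 ^ i\<close>, and the exponents are compared with
  \<open>4 * X * (d + 2)\<^sup>2\<close>.\<close>

lemma parameter_bounds:
  fixes d N :: nat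
  defines "X \<equiv> tables d" and "D \<equiv> dig_base d" and "S \<equiv> (blk d + 9) ^ 6" and "q \<equiv> d div blk d + 1"
  defines "Wc \<equiv> X * D * (d + 1)\<^sup>2 * (S * S) ^ q" and "\<beta> \<equiv> 4 * X * (d + 2)\<^sup>2"
  assumes N: "N \<le> 2 * 3 ^ d"
  shows "0 < (3 :: nat) ^ blk d" "(3 :: nat) ^ blk d < D" "0 < S" "S \<le> D" "3 + N * d + X * D ^ q < 2 ^ \<beta>" "3 ^ (d + 1) < (2::nat) ^ \<beta>"
    "q < 2 ^ \<beta>" "((d + 1) ^ (2 * d) + 1) * Wc < 2 ^ \<beta>" "0 < Wc" "N < 2 ^ \<beta>" "d < 2 ^ \<beta>" "3 < (2::nat) ^ \<beta>"
    "Wc \<le> X\<^sup>2 * (d + 2)\<^sup>2 * (S * S) ^ q"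
proof -
  have k: "1 \<le> blk d" by (simp add: blk_def)
  show b: "0 < (3 :: nat) ^ blk d" "(3 :: nat) ^ blk d < D" and S: "0 < S" "S \<le> D"
    using size_bounds[OF k] by (simp_all add: D_def dig_base_def S_def)
  have D1: "1 < D" using b by linarith
  have "D ^ 1 \<le> D ^ (2 * D ^ 3)" using D1 by (intro power_increasing) auto
  then have DX: "D \<le> X" by (simp add: X_def tables_def D_def)
  have SX: "S \<le> X" using S DX by simp
  have "(3::nat) ^ 1 \<le> 3 ^ blk d" using k by (intro power_increasing) auto
  then have X3: "3 \<le> X" using b DX by simp
  have X0: "0 < X" using X3 by simp
  have q: "q \<le> d + 1" by (simp add: q_def)
  have le2: "x \<le> 2 ^ x" for x :: nat using less_exp[of x] by (rule less_imp_le)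
  define e where "e = d + 2"
  have e: "2 \<le> e" "d \<le> e" "e = d + 2" by (simp_all add: e_def)
  have Xe: "X \<le> X * e" "X * e * 2 \<le> X * e * e" "3 * e \<le> X * e" "3 * e * e \<le> X * e * e"
    using e(1,2) X3 by (auto intro: mult_le_mono)
  have \<beta>: "\<beta> = 4 * (X * e * e)" by (simp add: \<beta>_def e_def power2_eq_square algebra_simps)
  have e24: "24 * e \<le> \<beta>" using Xe unfolding \<beta> by linarith
  have up: "(2::nat) ^ i < 2 ^ \<beta>" if "i < \<beta>" for i using that by simp
  have three: "(3::nat) ^ d \<le> 2 ^ (2 * d)" by (simp add: power_mult power_mono)
  have Nl: "N \<le> 2 ^ (2 * d + 1)" using N three by simp
  have "2 * d + 1 < \<beta>" using e24 unfolding e_def by simp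
  then show "N < 2 ^ \<beta>" using Nl up le_less_trans by blast
  have "d < 2 ^ d" by (rule less_exp)
  moreover have "d < \<beta>" using \<open>2 * d + 1 < \<beta>\<close> by simp
  ultimately show "d < 2 ^ \<beta>" using up less_trans by blast
  have "2 < \<beta>" using e24 unfolding e_def by simp
  then have "(2::nat) ^ 2 < 2 ^ \<beta>" by (rule up)
  then show "3 < (2::nat) ^ \<beta>" by simp
  have "q < 2 ^ q" by (rule less_exp)
  moreover have "q < \<beta>" using q e24 unfolding e_def by simp
  ultimately show "q < 2 ^ \<beta>" using up less_trans by blast
  have "(3::nat) ^ (d + 1) \<le> 2 ^ (2 * (d + 1))" unfolding power_mult by (intro power_mono) auto
  moreover have "2 * (d + 1) < \<beta>" using e24 unfolding e_def by simp
  ultimately show "3 ^ (d + 1) < (2::nat) ^ \<beta>" using up le_less_trans by blast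
  have "X * D ^ q \<le> X ^ 1 * X ^ q" using DX by (intro mult_le_mono power_mono) auto
  also have "\<dots> = X ^ (q + 1)" by simp
  also have "\<dots> \<le> (2 ^ X) ^ (q + 1)" by (rule power_mono[OF le2]) simp
  also have "\<dots> = 2 ^ (X * (q + 1))" by (simp only: power_mult)
  also have "\<dots> \<le> 2 ^ (X * e)" using q by (intro power_increasing mult_le_mono2) (auto simp: e_def)
  finally have XD: "X * D ^ q \<le> 2 ^ (X * e)" .
  have "N * d \<le> 2 ^ (2 * d + 1) * 2 ^ d" using Nl le2 by (rule mult_le_mono)
  also have "\<dots> = 2 ^ (3 * d + 1)" by (simp flip: power_add)
  finally have "N * d \<le> 2 ^ (3 * d + 1)" .
  moreover have "(2::nat) ^ (3 * d + 3) = 4 * 2 ^ (3 * d + 1)" by (simp add: power_add)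
  moreover have "(1::nat) \<le> 2 ^ (3 * d + 1)" by simp
  ultimately have "3 + N * d \<le> 2 ^ (3 * d + 3)" by linarith
  also have "\<dots> \<le> 2 ^ (X * e)" using Xe by (intro power_increasing) (auto simp: e_def)
  finally have "3 + N * d + X * D ^ q \<le> 2 * 2 ^ (X * e)" using XD by linarith
  then have "3 + N * d + X * D ^ q \<le> 2 ^ (X * e + 1)" by simp
  moreover have "X * e + 1 < \<beta>" using e Xe X3 unfolding \<beta> by linarith
  ultimately show "3 + N * d + X * D ^ q < 2 ^ \<beta>" using up le_less_trans by blast
  have SS: "(S * S) ^ q \<le> 2 ^ (2 * X * (d + 1))"
  proof -
    have "(S * S) ^ q \<le> (2 ^ X * 2 ^ X) ^ q" using order.trans[OF SX le2[of X]] by (intro power_mono mult_le_mono) auto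
    also have "\<dots> = 2 ^ (2 * X * q)" by (simp add: power_mult mult_2 power_add)
    also have "\<dots> \<le> 2 ^ (2 * X * (d + 1))" using q by (intro power_increasing mult_le_mono2) auto
    finally show ?thesis .
  qed
  have "Wc \<le> 2 ^ X * 2 ^ X * (2 ^ (d + 1))\<^sup>2 * 2 ^ (2 * X * (d + 1))"
    unfolding Wc_def by (intro mult_le_mono power_mono le2 order.trans[OF DX le2] SS) simp
  also have "\<dots> = 2 ^ (2 * X + 2 * (d + 1) + 2 * X * (d + 1))"
    by (simp only: mult_2 power2_eq_square flip: power_add)
  finally have W: "Wc \<le> 2 ^ (2 * X + 2 * (d + 1) + 2 * X * (d + 1))" .
  have "(d + 1) ^ (2 * d) \<le> (2 ^ (d + 1)) ^ (2 * d)" by (rule power_mono[OF le2]) simp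
  then have "(d + 1) ^ (2 * d) \<le> 2 ^ ((d + 1) * (2 * d))" by (simp only: power_mult)
  moreover have "(1::nat) \<le> 2 ^ ((d + 1) * (2 * d))" by simp
  moreover have "(2::nat) ^ ((d + 1) * (2 * d) + 1) = 2 * 2 ^ ((d + 1) * (2 * d))" by simp
  ultimately have "(d + 1) ^ (2 * d) + 1 \<le> 2 ^ ((d + 1) * (2 * d) + 1)" by linarith
  from mult_le_mono[OF this W] have "((d + 1) ^ (2 * d) + 1) * Wc \<le> 2 ^ ((d + 1) * (2 * d) + 1 + (2 * X + 2 * (d + 1) + 2 * X * (d + 1)))"
    by (simp only: power_add)
  moreover have "(d + 1) * (2 * d) + 1 + (2 * X + 2 * (d + 1) + 2 * X * (d + 1)) < \<beta>"
  proof -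
    have sum: "p + (2 * x + r + u) < 4 * y"
      if "p \<le> 2 * ee" "r \<le> 2 * e" "u \<le> 2 * v" "3 * ee \<le> y" "x \<le> v" "v * 2 \<le> y" "24 * e \<le> 4 * y"
      for p r u v x y ee :: nat
      using that e(1) by linarith
    have "(d + 1) * (2 * d) + 1 \<le> 2 * (e * e)" by (simp add: e_def algebra_simps)
    moreover have "2 * (d + 1) \<le> 2 * e" by (simp add: e_def)
    moreover have "2 * X * (d + 1) \<le> 2 * (X * e)" by (simp add: e_def)
    ultimately show ?thesis unfolding \<beta>
      by (rule sum) (use Xe e24 \<beta> in \<open>simp_all only: mult.assoc\<close>)
  qed
  ultimately show "((d + 1) ^ (2 * d) + 1) * Wc < 2 ^ \<beta>" using up le_less_trans by blast
  show "0 < Wc" unfolding Wc_def using X0 D1 S by simp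
  show "Wc \<le> X\<^sup>2 * (d + 2)\<^sup>2 * (S * S) ^ q"
    unfolding Wc_def power2_eq_square[of X] using DX by (intro mult_le_mono power_mono) auto
qed

lemma table_exists_block:
  assumes "1 \<le> k" "b = 3 ^ k" "S = (k + 9) ^ 6" "D = b ^ 16"
  shows "\<exists>x<D ^ (2 * D ^ 3). table k b S D x"
proof (rule good_table_exists[OF assms(1)], goal_cases)
  case (1 x)
  have "table k (3 ^ k) ((k + 9) ^ 6) ((3 ^ k) ^ 16) x"
    by (rule table.intro; (rule assms(1) | rule refl | (rule 1(2); assumption) | (rule 1(3); assumption)))
  then show ?case using 1(1) unfolding assms(4) assms(3) assms(2) by blast
qed

text \<open>Suppose a compatible pair exists but none is reported. For a good table the two vectors
  share a label, and by \<open>vc_search_com\<close> some vector of A with the same label clashes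
  with the vector of B. Soundness of the table excludes this clash, so overwriting marks does no
  harm.\<close>

lemma search_correct:
  fixes d t h :: nat and as bs :: "nat list list"
  defines "Wc \<equiv> tables d * dig_base d * (d + 1)\<^sup>2 * ((blk d + 9) ^ 6 * (blk d + 9) ^ 6) ^ (d div blk d + 1)"
  assumes vecs: "\<And>v. v \<in> set (as @ bs) \<Longrightarrow> v \<in> ternary_vectors d" "\<And>v. v \<in> set (as @ bs) \<Longrightarrow> count_list v 2 = t"
      "\<And>v. v \<in> set (as @ bs) \<Longrightarrow> count_list v 1 = h"
    and dh: "as @ bs \<noteq> [] \<Longrightarrow> d = 2 * h" "as @ bs \<noteq> [] \<Longrightarrow> 2 * t \<le> h" and h: "h = d div 2"
    and dist: "distinct as" "distinct bs"
  shows "\<exists>R' M' m \<tau>. run m (initial search_com (encode d as bs)) = return_pmf ([], R', M', \<tau>) \<and>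
    \<tau> \<le> 1000 * max 1 (length as + length bs) * (tables d * (d + 2)) * max 1 (visits_bound d h Wc t) * (2 * (4 * tables d * (d + 2)\<^sup>2) + 1) \<and>
    (M' 0 = 0 \<and> \<not> (\<exists>a\<in>set as. \<exists>b\<in>set bs. compatible d a b) \<or>
     (\<exists>a\<in>set as. \<exists>b\<in>set bs. compatible d a b \<and> reported_pair d M' = Some (a, b)))"
proof -
  define X where "X = tables d"
  define D where "D = dig_base d"
  define k where "k = blk d"
  define S where "S = (k + 9) ^ 6"
  define q where "q = d div k + 1"
  define b :: nat where "b = 3 ^ k"
  define \<beta> where "\<beta> = 4 * X * (d + 2)\<^sup>2"
  define N where "N = length as + length bs"
  define nA where "nA = length as"
  define vec where "vec i = (as @ bs) ! i" for i
  define w where "w = encode d as bs"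
  define M0 where "M0 = (\<lambda>i. if i < length w then w ! i else 0)"
  define off where "off = 3 + N * d"
  have Wc: "Wc = X * D * (d + 1)\<^sup>2 * (S * S) ^ q" by (simp add: Wc_def X_def D_def S_def k_def q_def)
  have N: "N \<le> 2 * 3 ^ d"
    using length_ternary_le[OF dist(1), of d] length_ternary_le[OF dist(2), of d] vecs(1) by (auto simp: N_def subset_iff)
  note pb = parameter_bounds[OF N, folded k_def X_def D_def, folded S_def q_def b_def, folded Wc \<beta>_def]
  have lenv: "\<And>v. v \<in> set (as @ bs) \<Longrightarrow> length v = d" using vecs(1) by (auto simp: ternary_vectors_def)
  have inv: "vec i \<in> set (as @ bs)" if "i < N" for i using that unfolding vec_def N_def by (intro nth_mem) simp
  have lw: "length w = off" using length_concat_blocks[of "as @ bs" d] lenv by (simp add: w_def encode_def off_def N_def)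
  have w3: "w = [d, length as, length bs] @ concat (as @ bs)" by (simp add: w_def encode_def)
  have M0v: "M0 (3 + i * d + j) = vec i ! j" if "i < N" "j < d" for i j
  proof -
    have "Suc i * d \<le> N * d" using that by (intro mult_le_mono1) simp
    then have "3 + i * d + j < length w" using that by (simp add: lw off_def)
    then have "M0 (3 + i * d + j) = w ! (3 + (i * d + j))" by (simp add: M0_def add.assoc)
    also have "\<dots> = concat (as @ bs) ! (i * d + j)" unfolding w3 by (simp add: nth_append)
    also have "\<dots> = vec i ! j" unfolding vec_def by (rule nth_concat_blocks) (use lenv that in \<open>auto simp: N_def\<close>)
    finally show ?thesis .
  qed
  have M0b: "M0 a < 2 ^ \<beta>" for a
  proof (cases "a < length w")
    case True
    then have "w ! a \<in> set w" by simp
    moreover have "y < 2 ^ \<beta>" if "y \<in> set w" for y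
    proof -
      from that consider "y = d" | "y \<le> N" | v where "v \<in> set (as @ bs)" "y \<in> set v" by (auto simp: w_def encode_def N_def)
      then show ?thesis
      proof cases
        case 3
        then have "y \<le> 3" using vecs(1)[OF 3(1)] by (auto simp: ternary_vectors_def)
        then show ?thesis using pb(12) by linarith
      qed (use pb(10,11) in linarith)+
    qed
    ultimately show ?thesis using True by (simp add: M0_def)
  qed (simp add: M0_def)
  have M0h: "M0 0 = d" "M0 1 = nA" "M0 2 = N - nA" using lw by (simp_all add: M0_def w3 off_def nA_def N_def)
  interpret m: search_setup d off b q D X S Wc h \<beta> N nA t vec M0 k
  proof unfold_locales
    show "0 < b" "b < D" "0 < S" "S \<le> D" by (fact pb)+
    show "X = D ^ (2 * D ^ 3)" by (simp add: X_def D_def tables_def)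
    show "off + X * D ^ q < 2 ^ \<beta>" using pb(5) by (simp add: off_def)
    show "3 ^ (d + 1) < (2::nat) ^ \<beta>" "q < 2 ^ \<beta>" "((d + 1) ^ (2 * d) + 1) * Wc < 2 ^ \<beta>" "0 < Wc" by (fact pb)+
    show "3 \<le> off" by (simp add: off_def)
    show "2 * h \<le> d" using h by simp
    show "\<And>i. i < N \<Longrightarrow> length (vec i) = d" using lenv inv by blast
    show "\<And>i. i < N \<Longrightarrow> set (vec i) \<subseteq> {0, 1, 2}" using vecs(1)[OF inv] by (simp add: ternary_vectors_def)
    show "\<And>i. i < N \<Longrightarrow> count_list (vec i) 2 = t" using vecs(2) inv by blast
    show "t \<le> h" if "0 < N" using dh(2) that by (auto simp: N_def)
    show "nA \<le> N" by (simp add: nA_def N_def)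
    show "off = 3 + N * d" by (simp add: off_def)
    show "N < 2 ^ \<beta>" by (fact pb)
    show "\<And>i j. i < N \<Longrightarrow> j < d \<Longrightarrow> M0 (3 + i * d + j) = vec i ! j" by (rule M0v)
    show "\<And>a. off \<le> a \<Longrightarrow> M0 a = 0" by (simp add: M0_def lw)
    show "\<And>a. M0 a < 2 ^ \<beta>" by (rule M0b)
    show "k = floorlog 2 (floorlog 2 d) + 1" by (simp add: k_def blk_def)
    show "b = 3 ^ k" "q = d div k + 1" "S = (k + 9) ^ 6" by (simp_all add: b_def q_def S_def)
    show "D = b ^ 16" by (simp add: D_def dig_base_def b_def k_def)
    show "Wc = X * D * (d + 1)\<^sup>2 * (S * S) ^ q" by (rule Wc)
    show "h = d div 2" by (rule h)
    show "M0 0 = d" "M0 1 = nA" "M0 2 = N - nA" by (fact M0h)+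
  qed
  define good where "good M' \<longleftrightarrow> (M' 0 = 0 \<and> \<not> (\<exists>a\<in>set as. \<exists>b\<in>set bs. compatible d a b) \<or>
     (\<exists>a\<in>set as. \<exists>b\<in>set bs. compatible d a b \<and> reported_pair d M' = Some (a, b)))" for M' :: "nat \<Rightarrow> nat"
  have vecA: "vec i \<in> set as" if "i < nA" for i using that by (simp add: vec_def nA_def nth_append)
  have vecB: "vec j \<in> set bs" if "nA \<le> j" "j < N" for j using that by (simp add: vec_def nA_def N_def nth_append)
  have compat: "clash d (m.val i) (m.val j) = 0 \<longleftrightarrow> compatible d (vec i) (vec j)" if "i < N" "j < N" for i j
    unfolding m.val_def using that m.vec by (intro clash_list_iff) auto
  have iN: "i < N" if "i < nA" for i using that by (simp add: nA_def N_def)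
  have k1: "1 \<le> k" by (simp add: k_def blk_def)
  have "vc search_com \<beta> (\<lambda>R' M' n'. n' \<le> m.search_cost \<and> good M') (\<lambda>_. 0) M0 0"
  proof (rule m.vc_search_com, goal_cases)
    case (1 n' R' M')
    have "\<not> (\<exists>a\<in>set as. \<exists>b\<in>set bs. compatible d a b)"
    proof
      assume "\<exists>a\<in>set as. \<exists>b\<in>set bs. compatible d a b"
      then obtain u v where uv: "u \<in> set as" "v \<in> set bs" "compatible d u v" by blast
      obtain i where i: "i < nA" "u = vec i" using uv(1) by (auto simp: in_set_conv_nth vec_def nA_def nth_append)
      obtain j0 where j0: "j0 < length bs" "v = bs ! j0" using uv(2) by (auto simp: in_set_conv_nth)
      define j where "j = nA + j0"
      have j: "nA \<le> j" "j < N" "v = vec j" using j0 by (simp_all add: j_def nA_def N_def vec_def nth_append)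
      have ne: "as @ bs \<noteq> []" using uv(1) by auto
      obtain x where x: "x < X" and tab: "table k b S D x"
        using table_exists_block[OF k1 m.bk m.Sk m.Db] unfolding m.X by (elim exE conjE)
      interpret tb: table k b S D x by (rule tab)
      have tv: "length u = d" "set u \<subseteq> {0, 1, 2}" "count_list u 2 = t" "count_list u 1 = h"
        "length v = d" "set v \<subseteq> {0, 1, 2}" "count_list v 2 = t" "count_list v 1 = h"
        using vecs[of u] vecs[of v] uv by (simp_all add: ternary_vectors_def)
      obtain w w' where ww: "w < m.Wm" "w' < m.Wm" "w mod X = x" "w' mod X = x"
        "label b S D x 0 q (w div X) (ternary_value u) x = label b S D x 1 q (w' div X) (ternary_value v) x"
        using tb.visits_exist[OF tv uv(3) dh(1)[OF ne] dh(2)[OF ne] m.qk x Wc] unfolding m.Wm_def by blast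
      have "m.address 0 (m.val i) w = m.address 1 (m.val j) w'"
        unfolding m.address_def m.val_def ww(3,4) i(2)[symmetric] j(3)[symmetric] using ww(5) by simp
      from 1(3)[OF i(1) j(1,2) ww(1,2) this] obtain i' w'' where
        i': "i' < nA" "m.address 0 (m.val i') w'' = m.address 1 (m.val j) w'" "clash d (m.val i') (m.val j) \<noteq> 0" by blast
      have eq: "label b S D (w'' mod X) 0 q (w'' div X) (m.val i') (w'' mod X) = label b S D x 1 q (w' div X) (m.val j) x"
        using i'(2) unfolding m.address_def ww(4) by simp
      \<comment> \<open>The leading part of a label is its table code, so the clashing vector used
        the same good table.\<close>
      have "w'' mod X = x"
        using arg_cong[OF eq, of "\<lambda>y. y div D ^ q"] unfolding label_div[OF tb.pos(3)] .
      note eq = eq[unfolded this]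
      have "clash d (m.val i') (m.val j) = 0"
      proof (rule clash_zero_if_agree[of q k])
        show "0 < k" using k1 by simp
        have "d = d div k * k + d mod k" by simp
        moreover have "d mod k < k" using k1 by simp
        ultimately show "d \<le> q * k" unfolding q_def add_mult_distrib by linarith
      next
        fix l assume "l < q"
        from tb.label_sound[OF eq this]
        show "agree k (m.val i' div (3 ^ k) ^ l mod 3 ^ k) (m.val j div (3 ^ k) ^ l mod 3 ^ k)" unfolding m.bk .
      qed
      then show False using i'(3) by simp
    qed
    then show ?case using 1(1,2) by (simp add: good_def)
  next
    case (2 n' R' M' i j)
    have c: "compatible d (vec i) (vec j)" using compat[OF iN[OF 2(2)] 2(3)] 2(5) by simp
    have l: "length (vec i) = d" "length (vec j) = d" using m.vec(1) iN[OF 2(2)] 2(3) by auto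
    have "map M' [1..<d + 1] = vec i"
      by (rule nth_equalityI) (use l 2(7) in \<open>simp_all del: upt_Suc\<close>)
    moreover have "map M' [d + 1..<2 * d + 1] = vec j"
      by (rule nth_equalityI) (use l 2(8) in \<open>simp_all del: upt_Suc\<close>)
    ultimately have "reported_pair d M' = Some (vec i, vec j)" using 2(6) by (simp add: reported_pair_def)
    then show ?case using 2(1) c vecA[OF 2(2)] vecB[OF 2(4,3)] unfolding good_def by blast
  qed
  from vc_sound[OF this] obtain R' M' n' where n': "n' \<le> m.search_cost" and good: "good M'" and
    ex: "\<And>K t. \<exists>m \<tau>. run m (search_com # K, \<lambda>_. 0, M0, t) = return_pmf (K, R', M', t + \<tau>) \<and> \<tau> \<le> (n' - 0) * (2 * \<beta> + 1)"
    unfolding wp_def by (elim exE conjE) blast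
  obtain mm \<tau> where run: "run mm ([search_com], \<lambda>_. 0, M0, 0) = return_pmf ([], R', M', 0 + \<tau>)" "\<tau> \<le> (n' - 0) * (2 * \<beta> + 1)"
    using ex[of "[]" 0] by blast
  have "\<tau> \<le> n' * (2 * \<beta> + 1)" using run(2) by simp
  also have "\<dots> \<le> (1000 * max 1 N * (X * (d + 2)) * max 1 m.Wm) * (2 * \<beta> + 1)"
    using order.trans[OF n' m.search_cost_le] by (rule mult_le_mono1)
  finally have "\<tau> \<le> 1000 * max 1 N * (X * (d + 2)) * max 1 m.Wm * (2 * \<beta> + 1)" .
  moreover have "initial search_com (encode d as bs) = ([search_com], \<lambda>_. 0, M0, 0)"
    unfolding initial_def M0_def w_def ..
  ultimately show ?thesis using run(1) good
    unfolding good_def N_def X_def \<beta>_def m.Wm_def by (intro exI[of _ R'] exI[of _ M'] exI[of _ mm] exI[of _ \<tau>]) simp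
qed

lemma search_solves:
  fixes \<epsilon> \<delta> :: real
  assumes "0 \<le> \<epsilon>" and "\<epsilon> \<le> 1 / 4" and \<delta>: "0 < \<delta>" and AB: "A \<subseteq> ternary_vectors d" "B \<subseteq> ternary_vectors d"
    and cnt: "\<forall>v \<in> A \<union> B. real (count_list v 2) = \<epsilon> * real d \<and> real (count_list v 1) = real d / 2"
    and as: "distinct as" "set as = A" and bs: "distinct bs" "set bs = B"
  shows "\<exists>D. halts_with search_com (encode d as bs) D \<and>
      (\<forall>(M, t) \<in> set_pmf D.
         real t \<le> 18000 * real (overhead 0) * 2 powr ((exponent \<epsilon> + log 2 (real (overhead d)) / real d) * real d) * real (max 1 (card A + card B)) \<and>
         (\<forall>a b. reported_pair d M = Some (a, b) \<longrightarrow> a \<in> A \<and> b \<in> B \<and> compatible d a b)) \<and>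
      ((\<exists>a \<in> A. \<exists>b \<in> B. compatible d a b) \<longrightarrow>
         measure_pmf.prob D
           {(M, t). \<exists>a \<in> A. \<exists>b \<in> B. compatible d a b \<and> reported_pair d M = Some (a, b)}
         \<ge> 1 - \<delta>)"
proof -
  define h where "h = d div 2"
  \<comment> \<open>All vectors have equally many twos, so the first determines \<open>t\<close>.
    Without vectors nothing makes \<open>\<epsilon> * d\<close> an integer, and 0 is taken.\<close>
  define t where "t = (if as @ bs = [] then 0 else count_list (hd (as @ bs)) 2)"
  have c2: "real (count_list v 2) = \<epsilon> * real d" "real (count_list v 1) = real d / 2" if "v \<in> set (as @ bs)" for v
    using cnt as bs that by auto
  have c1: "2 * count_list v 1 = d" if "v \<in> set (as @ bs)" for v
  proof -
    have "real (2 * count_list v 1) = real d" using c2(2)[OF that] by simp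
    then show ?thesis by (simp only: of_nat_eq_iff)
  qed
  have tv: "real t = \<epsilon> * real d" if "as @ bs \<noteq> []"
    unfolding t_def if_not_P[OF that] by (rule c2(1)[OF hd_in_set[OF that]])
  have ct: "count_list v 2 = t" if "v \<in> set (as @ bs)" for v
  proof -
    have "as @ bs \<noteq> []" using that by auto
    then have "real (count_list v 2) = real t" using c2(1)[OF that] tv by simp
    then show ?thesis by simp
  qed
  have ch: "count_list v 1 = h" if "v \<in> set (as @ bs)" for v using c1[OF that] by (simp add: h_def)
  have d2: "d = 2 * h" if "as @ bs \<noteq> []"
  proof -
    have "even d" using c1[OF hd_in_set[OF that]] by (metis dvd_triv_left)
    then show ?thesis by (simp add: h_def)
  qed
  have t2: "2 * t \<le> h" if "as @ bs \<noteq> []"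
  proof -
    have "real t \<le> 1 / 4 * real d" unfolding tv[OF that] using assms(1,2) by (intro mult_right_mono) auto
    then show ?thesis using d2[OF that] by simp
  qed
  define Wc where "Wc = tables d * dig_base d * (d + 1)\<^sup>2 * ((blk d + 9) ^ 6 * (blk d + 9) ^ 6) ^ (d div blk d + 1)"
  define n where "n = max 1 (length as + length bs)"
  define E where "E = 2 powr (exponent \<epsilon> * real d)"
  have tern: "v \<in> ternary_vectors d" if "v \<in> set (as @ bs)" for v using that AB as(2) bs(2) by auto
  have correct: "\<exists>R' M' m \<tau>. run m (initial search_com (encode d as bs)) = return_pmf ([], R', M', \<tau>) \<and>
    \<tau> \<le> 1000 * n * (tables d * (d + 2)) * max 1 (visits_bound d h Wc t) * (2 * (4 * tables d * (d + 2)\<^sup>2) + 1) \<and>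
    (M' 0 = 0 \<and> \<not> (\<exists>a\<in>set as. \<exists>b\<in>set bs. compatible d a b) \<or>
     (\<exists>a\<in>set as. \<exists>b\<in>set bs. compatible d a b \<and> reported_pair d M' = Some (a, b)))"
    unfolding Wc_def n_def
    by (rule search_correct) (fact tern ct ch d2 t2 h_def as(1) bs(1))+
  obtain R' M' m \<tau> where run: "run m (initial search_com (encode d as bs)) = return_pmf ([], R', M', \<tau>)"
    and \<tau>: "\<tau> \<le> 1000 * n * (tables d * (d + 2)) * max 1 (visits_bound d h Wc t) * (2 * (4 * tables d * (d + 2)\<^sup>2) + 1)"
    and good: "M' 0 = 0 \<and> \<not> (\<exists>a\<in>set as. \<exists>b\<in>set bs. compatible d a b) \<or>
     (\<exists>a\<in>set as. \<exists>b\<in>set bs. compatible d a b \<and> reported_pair d M' = Some (a, b))"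
    by (rule exE[OF correct], elim exE conjE) (rule that; assumption)
  have N: "length as + length bs \<le> 2 * 3 ^ d"
    using length_ternary_le[OF as(1), of d] length_ternary_le[OF bs(1), of d] as bs AB by simp
  note pb = parameter_bounds[OF N, folded Wc_def]
  define Fl where "Fl = (d - t) ^ (d - t) * (h + t) ^ (h + t) div t ^ t div (h - t) ^ (h - t) div d ^ d"
  have E1: "1 \<le> E" unfolding E_def using exponent_nonneg[OF assms(1,2)] by (intro ge_one_powr_ge_zero) auto
  have Fl: "real Fl \<le> E"
  \<comment> \<open>Without vectors \<open>d\<close> may be odd, but then \<open>t = 0\<close> and
    the quotient of self-powers is at most 1.\<close>
  proof (cases "as @ bs = []")
    case True
    have "0 < j ^ j" for j :: nat by (cases j) auto
    then have "Fl \<le> 1" using True by (simp add: Fl_def t_def less_imp_le)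
    then show ?thesis using E1 by linarith
  next
    case False
    show ?thesis
    proof (cases "d = 0")
      case True
      then have "Fl = 1" using d2[OF False] t2[OF False] by (simp add: Fl_def)
      then show ?thesis using E1 by simp
    next
      case d0: False
      have "real Fl \<le> real ((d - t) ^ (d - t) * (h + t) ^ (h + t)) / real (t ^ t * (h - t) ^ (h - t) * d ^ d)"
        unfolding Fl_def div_mult2_eq[symmetric] by (rule of_nat_div_le_of_nat)
      also have "\<dots> = E" unfolding E_def using powr_exponent[OF assms(1,2) _ d2[OF False] tv[OF False]] d0
        by (simp only: of_nat_mult neq0_conv)
      finally show ?thesis .
    qed
  qed
  define OV where "OV = real (overhead d)"
  \<comment> \<open>18000 = 1000 * 9 * 2: the instruction count, the estimate \<open>X9\<close> for
    the cost of an instruction, and \<open>Fl + 1 \<le> 2 * E\<close>.\<close>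
  have "real \<tau> \<le> 18000 * OV * E * real n"
  proof -
    define T where "T = tables d"
    define e where "e = d + 2"
    define s where "s = ((blk d + 9) ^ 6 * (blk d + 9) ^ 6) ^ (d div blk d + 1)"
    have W1: "1 \<le> Wc" using pb(9) by simp
    have vb: "visits_bound d h Wc t = (Fl + 1) * Wc" by (simp add: visits_bound_def Fl_def)
    have "1 * 1 \<le> (Fl + 1) * Wc" using W1 by (intro mult_le_mono) auto
    then have mx: "max 1 (visits_bound d h Wc t) = (Fl + 1) * Wc" unfolding vb by simp
    have "1 \<le> T" by (simp add: T_def tables_def dig_base_def Suc_le_eq)
    then have "1 * 1 \<le> T * e\<^sup>2" by (intro mult_le_mono) (simp_all add: e_def)
    then have X9: "2 * (4 * T * e\<^sup>2) + 1 \<le> 9 * (T * e\<^sup>2)" by linarith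
    have "e ^ 5 = e * e * e * e * e" by (simp add: eval_nat_numeral)
    then have regroup: "1000 * n * (T * e) * (F * (T\<^sup>2 * e\<^sup>2 * s)) * (9 * (T * e\<^sup>2)) =
        9000 * (T ^ 4 * e ^ 5 * s) * F * n" for F
      by (simp add: power2_eq_square power4_eq_xxxx mult_ac)
    from X9 have "\<tau> \<le> 1000 * n * (T * e) * ((Fl + 1) * Wc) * (9 * (T * e\<^sup>2))"
      using \<tau> unfolding mx T_def e_def by (rule order.trans[OF _ mult_le_mono2, rotated])
    also have "\<dots> \<le> 1000 * n * (T * e) * ((Fl + 1) * (T\<^sup>2 * e\<^sup>2 * s)) * (9 * (T * e\<^sup>2))"
      using pb(13) unfolding T_def e_def s_def by (intro mult_le_mono) auto
    also have "\<dots> = 9000 * (T ^ 4 * e ^ 5 * s) * (Fl + 1) * n"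
      by (rule regroup)
    also have "T ^ 4 * e ^ 5 * s = overhead d" by (simp add: overhead_def T_def e_def s_def)
    finally have "real \<tau> \<le> real (9000 * overhead d * (Fl + 1) * n)" by (rule of_nat_mono)
    also have "\<dots> = 9000 * OV * (real Fl + 1) * real n" by (simp add: OV_def distrib_left)
    also have "\<dots> \<le> 9000 * OV * (2 * E) * real n"
      using Fl E1 by (intro mult_right_mono mult_left_mono) (auto simp: OV_def)
    finally show ?thesis by simp
  qed
  \<comment> \<open>For \<open>d = 0\<close> the whole exponent vanishes, so the overhead of this
    single dimension is moved into the constant.\<close>
  also have "\<dots> \<le> 18000 * real (overhead 0) * 2 powr ((exponent \<epsilon> + log 2 (real (overhead d)) / real d) * real d) * real n"
  proof (rule mult_right_mono)
    have ov1: "1 \<le> real (overhead d)" for d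
    proof -
      have "1 \<le> overhead d" by (simp add: overhead_def tables_def dig_base_def Suc_le_eq)
      then show ?thesis by simp
    qed
    show "18000 * OV * E \<le> 18000 * real (overhead 0) * 2 powr ((exponent \<epsilon> + log 2 (real (overhead d)) / real d) * real d)"
    proof (cases "d = 0")
      case True
      then show ?thesis by (simp add: OV_def E_def)
    next
      case False
      have "(exponent \<epsilon> + log 2 (real (overhead d)) / real d) * real d = exponent \<epsilon> * real d + log 2 OV"
        using False by (simp add: OV_def distrib_right)
      then have "2 powr ((exponent \<epsilon> + log 2 (real (overhead d)) / real d) * real d) = E * OV"
        using ov1[of d] by (simp add: powr_add E_def OV_def)
      moreover have "18000 * (E * OV) \<le> 18000 * real (overhead 0) * (E * OV)"
        using ov1[of 0] ov1[of d] E1 unfolding OV_def by (intro mult_right_mono) auto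
      ultimately show ?thesis by (simp add: mult_ac)
    qed
  qed simp
  also have "n = max 1 (card A + card B)" using distinct_card[OF as(1)] distinct_card[OF bs(1)] as(2) bs(2) by (simp add: n_def)
  finally have time: "real \<tau> \<le> 18000 * real (overhead 0) * 2 powr ((exponent \<epsilon> + log 2 (real (overhead d)) / real d) * real d) * real (max 1 (card A + card B))" .
  have sound: "a \<in> A \<and> b \<in> B \<and> compatible d a b" if r: "reported_pair d M' = Some (a, b)" for a b
    using good
  proof (elim disjE conjE bexE)
    assume "M' 0 = 0"
    then show ?thesis using r by (simp add: reported_pair_def)
  next
    fix a' b' assume "a' \<in> set as" "b' \<in> set bs" "compatible d a' b'" "reported_pair d M' = Some (a', b')"
    then show ?thesis using r as(2) bs(2) by simp
  qed
  have halts: "halts_with search_com (encode d as bs) (return_pmf (M', \<tau>))"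
    unfolding halts_with_def using run by (intro exI[of _ m]) simp
  have hit: "1 - \<delta> \<le> measure_pmf.prob (return_pmf (M', \<tau>))
      {(M, t). \<exists>a \<in> A. \<exists>b \<in> B. compatible d a b \<and> reported_pair d M = Some (a, b)}"
    if "\<exists>a \<in> A. \<exists>b \<in> B. compatible d a b"
  proof -
    have "\<exists>a \<in> A. \<exists>b \<in> B. compatible d a b \<and> reported_pair d M' = Some (a, b)"
      using good that unfolding as(2) bs(2) by blast
    then show ?thesis using \<delta> by (simp add: measure_return_pmf indicator_def)
  qed
  show ?thesis
  proof (rule exI[of _ "return_pmf (M', \<tau>)"], intro conjI impI)
    show "halts_with search_com (encode d as bs) (return_pmf (M', \<tau>))" by (rule halts)
    show "\<forall>(M, t) \<in> set_pmf (return_pmf (M', \<tau>)).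
         real t \<le> 18000 * real (overhead 0) * 2 powr ((exponent \<epsilon> + log 2 (real (overhead d)) / real d) * real d) * real (max 1 (card A + card B)) \<and>
         (\<forall>a b. reported_pair d M = Some (a, b) \<longrightarrow> a \<in> A \<and> b \<in> B \<and> compatible d a b)"
      unfolding set_return_pmf ball_simps prod.case using time sound by blast
  qed (rule hit)
qed

theorem theorem8p1:
  fixes \<epsilon> :: real
  assumes "0 \<le> \<epsilon>" and "\<epsilon> \<le> 1 / 4"
  shows "\<exists>g :: nat \<Rightarrow> real. g \<longlonglongrightarrow> 0 \<and>
    (\<forall>\<delta> :: real. \<delta> > 0 \<longrightarrow>
      (\<exists>(P :: com) (C :: real). \<forall>(d :: nat) (A :: nat list set) (B :: nat list set) as bs.
        A \<subseteq> ternary_vectors d \<longrightarrow> B \<subseteq> ternary_vectors d \<longrightarrow>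
        (\<forall>v \<in> A \<union> B. real (count_list v 2) = \<epsilon> * real d \<and> real (count_list v 1) = real d / 2) \<longrightarrow>
        distinct as \<longrightarrow> set as = A \<longrightarrow> distinct bs \<longrightarrow> set bs = B \<longrightarrow>
        (\<exists>D. halts_with P (encode d as bs) D \<and>
          (\<forall>(M, t) \<in> set_pmf D.
             real t \<le> C * 2 powr ((exponent \<epsilon> + g d) * real d) * real (max 1 (card A + card B)) \<and>
             (\<forall>a b. reported_pair d M = Some (a, b) \<longrightarrow> a \<in> A \<and> b \<in> B \<and> compatible d a b)) \<and>
          ((\<exists>a \<in> A. \<exists>b \<in> B. compatible d a b) \<longrightarrow>
             measure_pmf.prob D
               {(M, t). \<exists>a \<in> A. \<exists>b \<in> B. compatible d a b \<and> reported_pair d M = Some (a, b)}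
             \<ge> 1 - \<delta>))))"
proof (intro exI[of _ "\<lambda>d. log 2 (real (overhead d)) / real d"] conjI allI impI overhead_subexponential)
  fix \<delta> :: real assume \<delta>: "\<delta> > 0"
  show "\<exists>(P :: com) (C :: real). \<forall>(d :: nat) (A :: nat list set) (B :: nat list set) as bs.
        A \<subseteq> ternary_vectors d \<longrightarrow> B \<subseteq> ternary_vectors d \<longrightarrow>
        (\<forall>v \<in> A \<union> B. real (count_list v 2) = \<epsilon> * real d \<and> real (count_list v 1) = real d / 2) \<longrightarrow>
        distinct as \<longrightarrow> set as = A \<longrightarrow> distinct bs \<longrightarrow> set bs = B \<longrightarrow>
        (\<exists>D. halts_with P (encode d as bs) D \<and>
          (\<forall>(M, t) \<in> set_pmf D.
             real t \<le> C * 2 powr ((exponent \<epsilon> + log 2 (real (overhead d)) / real d) * real d) * real (max 1 (card A + card B)) \<and>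
             (\<forall>a b. reported_pair d M = Some (a, b) \<longrightarrow> a \<in> A \<and> b \<in> B \<and> compatible d a b)) \<and>
          ((\<exists>a \<in> A. \<exists>b \<in> B. compatible d a b) \<longrightarrow>
             measure_pmf.prob D
               {(M, t). \<exists>a \<in> A. \<exists>b \<in> B. compatible d a b \<and> reported_pair d M = Some (a, b)}
             \<ge> 1 - \<delta>))"
    by (rule exI[of _ search_com], rule exI[of _ "18000 * real (overhead 0)"], intro allI impI)
      (rule search_solves[OF assms \<delta>]; assumption)
qed

end
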